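(* Let $G=(V,E)$ be a locally independent graph and let $\Gamma\subseteq\mathrm{Aut}(G)$ be a compact group. If $V$ is a homogeneous $\Gamma$-space, if $\omega$ is the pushforward to $V$ of the Haar measure on $\Gamma$, and if $E\subseteq V\times V$ is thick with respect to the product measure $\omega\times\omega$, then $\lim_{r\to\infty}\gamma_r(G)=\vartheta(G,\mathrm{CP}(V))$.
   Context: Graphs. A topological graph is a graph $G=(V,E)$ whose vertex set $V$ is a topological space; $E$ is regarded as a symmetric subset of $V\times V$ (no loops). A set of vertices is independent if it contains no edge. $G$ is locally independent if it is a topological graph in which every compact independent set is a subset of an open independent set. $\mathrm{Aut}(G)$ is the group of edge-preserving bijections $V\to V$. Thickness. Given a topological space $X$ and a Borel measure $\mu$ on $X$, a measurable set $U\subseteq X$ is $\mu$-thick if $\mu(A\cap U)>0$ for every open set $A\subseteq X$ with $A\cap U\ne\emptyset$. Groups. Topological groups are Hausdorff. An action of a locally compact group $\Gamma$ on a locally compact Hausdorff space $V$ is a continuous map $\Gamma\times V\to V$, $(\sigma,x)\mapsto\sigma x$, such that each $x\mapsto\sigma x$ is a homeomorphism and $\sigma(\tau x)=(\sigma\tau)x$. $V$ is a homogeneous $\Gamma$-space if the action is transitive and, for $e\in V$, the map $\Gamma\to V$, $\sigma\mapsto\sigma e$, is open. Here $\Gamma\subseteq\mathrm{Aut}(G)$ acts on $V$ by the automorphisms. The Haar measure $\mu$ on a compact group is normalized by $\mu(\Gamma)=1$; its pushforward $\omega$ to $V$ is the Radon measure with $\int_V f\,d\omega=\int_\Gamma f(\sigma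 e)\,d\mu(\sigma)$ (independent of $e\in V$). Cones. $L^2_{\rm sym}(V)$ is the space of real kernels $A\in L^2(V\times V)$ with $A(x,y)=A(y,x)$ almost everywhere; $\langle\cdot,\cdot\rangle$ is the $L^2$ inner product and $(Af)(x)=\int_V A(x,y)f(y)\,d\omega(y)$. A kernel $A\in L^2_{\rm sym}(V)$ is positive semidefinite if $\langle Af,f\rangle\ge0$ for all $f\in L^2(V)$. $\mathrm{COP}(V)=\{A\in L^2_{\rm sym}(V):\langle Af,f\rangle\ge0\text{ for all }f\in L^2(V)\text{ with }f\ge0\}$ and $\mathrm{CP}(V)=\{A\in L^2_{\rm sym}(V):\langle A,Z\rangle\ge0\text{ for all }Z\in\mathrm{COP}(V)\}$. For $F\colon V^{r+2}\to\mathbb{R}$ let $(\mathcal{R}_{\mathcal{S}_{r+2}}F)(x_1,\dots,x_{r+2})=\frac1{(r+2)!}\sum_{\pi\in\mathcal{S}_{r+2}}F(x_{\pi(1)},\dots,x_{\pi(r+2)})$, where $\mathcal{S}_{r+2}$ is the symmetric group. For an integer $r\ge1$ let $\mathcal{C}_r(V)=\{A\in L^2_{\rm sym}(V):\mathcal{R}_{\mathcal{S}_{r+2}}(A\otimes\mathbf{1}^{\otimes r})\ge0\text{ a.e.}\}$, where $(A\otimes\mathbf 1^{\otimes r})(x_1,\dots,x_{r+2})=A(x_1,x_2)$, and let $\mathcal{C}_r^*(V)=\{A\in L^2_{\rm sym}(V):\langle A,Z\rangle\ge0\text{ for all }Z\in\mathcal{C}_r(V)\}$. Optimization problems. Let $J$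 be the constant-one kernel. $\vartheta(G,\mathrm{CP}(V))$ is the supremum of $\langle A,J\rangle$ over all continuous kernels $A\in\mathrm{CP}(V)$ such that $\int_V A(x,x)\,d\omega(x)=1$ and $A(x,y)=0$ whenever $xy\in E$. $\gamma_r(G)$ is the supremum of $\langle A,J\rangle$ over all continuous positive-semidefinite kernels $A\in\mathcal{C}_r^*(V)$ such that $\int_V A(x,x)\,d\omega(x)=1$ and $A(x,y)=0$ whenever $xy\in E$. *)

theory Defs
  imports "HOL-Analysis.Analysis" "HOL-Combinatorics.Permutations"
begin

section \<open>Topological graphs\<close>

text \<open>The vertex space is the whole type, with the topology of its type class.\<close>

definition topological_graph :: "('v::topological_space \<times> 'v) set \<Rightarrow> bool" where
  "topological_graph E \<longleftrightarrow> sym E \<and> irrefl E"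

definition independent_set :: "('v \<times> 'v) set \<Rightarrow> 'v set \<Rightarrow> bool" where
  "independent_set E S \<longleftrightarrow> (\<forall>x\<in>S. \<forall>y\<in>S. (x, y) \<notin> E)"

definition locally_independent :: "('v::topological_space \<times> 'v) set \<Rightarrow> bool" where
  "locally_independent E \<longleftrightarrow>
     topological_graph E \<and>
     (\<forall>K. compact K \<and> independent_set E K \<longrightarrow>
        (\<exists>U. open U \<and> independent_set E U \<and> K \<subseteq> U))"

definition graph_Aut :: "('v \<times> 'v) set \<Rightarrow> ('v \<Rightarrow> 'v) set" where
  "graph_Aut E = {\<sigma>. bij \<sigma> \<and> (\<forall>x y. (\<sigma> x, \<sigma> y) \<in> E \<longleftrightarrow> (x, y) \<in> E)}"


section \<open>Groups of transformations\<close>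

text \<open>
  A group of bijections of \<open>'v\<close> is given together with its topology, as a value \<open>\<Gamma>\<close> of type
  \<open>('v \<Rightarrow> 'v) topology\<close>; the underlying group is \<open>topspace \<Gamma>\<close>, under composition.
\<close>

definition topological_group_of_maps :: "('v \<Rightarrow> 'v) topology \<Rightarrow> bool" where
  "topological_group_of_maps \<Gamma> \<longleftrightarrow>
     id \<in> topspace \<Gamma> \<and>
     (\<forall>\<sigma>\<in>topspace \<Gamma>. bij \<sigma> \<and> inv \<sigma> \<in> topspace \<Gamma>) \<and>
     (\<forall>\<sigma>\<in>topspace \<Gamma>. \<forall>\<tau>\<in>topspace \<Gamma>. \<sigma> \<circ> \<tau> \<in> topspace \<Gamma>) \<and>
     Hausdorff_space \<Gamma> \<and>
     continuous_map (prod_topology \<Gamma> \<Gamma>) \<Gamma> (\<lambda>(\<sigma>, \<tau>). \<sigma> \<circ> \<tau>) \<and>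
     continuous_map \<Gamma> \<Gamma> inv"

definition homogeneous_space :: "('v::t2_space \<Rightarrow> 'v) topology \<Rightarrow> bool" where
  "homogeneous_space \<Gamma> \<longleftrightarrow>
     topological_group_of_maps \<Gamma> \<and>
     locally_compact_space \<Gamma> \<and>
     locally_compact_space (euclidean :: 'v topology) \<and>
     continuous_map (prod_topology \<Gamma> euclidean) euclidean (\<lambda>(\<sigma>, x). \<sigma> x) \<and>
     (\<forall>\<sigma>\<in>topspace \<Gamma>. homeomorphic_map euclidean euclidean \<sigma>) \<and>
     (\<forall>x y. \<exists>\<sigma>\<in>topspace \<Gamma>. \<sigma> x = y) \<and>
     (\<forall>e. open_map \<Gamma> euclidean (\<lambda>\<sigma>. \<sigma> e))"


section \<open>Measures\<close>

definition borel_of :: "'a topology \<Rightarrow> 'a measure" where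
  "borel_of X = sigma (topspace X) {U. openin X U}"

definition radon_measure :: "'a topology \<Rightarrow> 'a measure \<Rightarrow> bool" where
  "radon_measure X M \<longleftrightarrow>
     sets M = sets (borel_of X) \<and>
     (\<forall>K. compactin X K \<longrightarrow> emeasure M K < \<infinity>) \<and>
     (\<forall>B\<in>sets M. emeasure M B = (INF U\<in>{U. openin X U \<and> B \<subseteq> U}. emeasure M U)) \<and>
     (\<forall>U. openin X U \<longrightarrow> emeasure M U = (SUP K\<in>{K. compactin X K \<and> K \<subseteq> U}. emeasure M K))"

definition normalized_haar_measure :: "('v \<Rightarrow> 'v) topology \<Rightarrow> ('v \<Rightarrow> 'v) measure \<Rightarrow> bool" where
  "normalized_haar_measure \<Gamma> \<mu> \<longleftrightarrow>
     radon_measure \<Gamma> \<mu> \<and>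
     (\<forall>\<sigma>\<in>topspace \<Gamma>. \<forall>B\<in>sets \<mu>. emeasure \<mu> ((\<lambda>\<tau>. \<sigma> \<circ> \<tau>) ` B) = emeasure \<mu> B) \<and>
     emeasure \<mu> (topspace \<Gamma>) = 1"

definition haar_pushforward :: "('v \<Rightarrow> 'v) measure \<Rightarrow> 'v \<Rightarrow> 'v::topological_space measure" where
  "haar_pushforward \<mu> e = distr \<mu> borel (\<lambda>\<sigma>. \<sigma> e)"

text \<open>
  Without second countability, open subsets of the product space need not belong to the product
  of the two Borel sigma-algebras, so \<open>M \<Otimes>\<^sub>M N\<close> need not be a Borel measure. For finite Radon
  measures there is exactly one Radon measure on the product space with the product values on
  rectangles; it extends \<open>M \<Otimes>\<^sub>M N\<close>.
\<close>

definition radon_product ::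
    "'a::topological_space measure \<Rightarrow> 'b::topological_space measure \<Rightarrow> ('a \<times> 'b) measure \<Rightarrow> bool" where
  "radon_product M N P \<longleftrightarrow>
     radon_measure euclidean P \<and>
     (\<forall>A\<in>sets M. \<forall>B\<in>sets N. emeasure P (A \<times> B) = emeasure M A * emeasure N B)"

definition thick :: "'a::topological_space measure \<Rightarrow> 'a set \<Rightarrow> bool" where
  "thick M U \<longleftrightarrow>
     U \<in> sets M \<and> (\<forall>A. open A \<and> A \<inter> U \<noteq> {} \<longrightarrow> 0 < emeasure M (A \<inter> U))"


section \<open>Kernels and cones\<close>

text \<open>
  Elements of L2 are represented by functions rather than by classes, and the conditions below
  are invariant under almost-everywhere equality. On the product space we use \<open>M \<Otimes>\<^sub>M M\<close>: for
  a finite Radon measure \<open>M\<close> on a compact Hausdorff space, continuous functions on the product are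
  measurable for \<open>M \<Otimes>\<^sub>M M\<close> and are dense in the L2 space of the Radon product, so \<open>M \<Otimes>\<^sub>M M\<close> and
  the Radon product have the same L2 space.
\<close>

definition L2 :: "'a measure \<Rightarrow> ('a \<Rightarrow> real) set" where
  "L2 M = {f \<in> borel_measurable M. integrable M (\<lambda>x. (f x)\<^sup>2)}"

definition L2_inner :: "'a measure \<Rightarrow> ('a \<Rightarrow> real) \<Rightarrow> ('a \<Rightarrow> real) \<Rightarrow> real" where
  "L2_inner M f g = (\<integral>x. f x * g x \<partial>M)"

definition L2_sym :: "'v measure \<Rightarrow> ('v \<times> 'v \<Rightarrow> real) set" where
  "L2_sym M = {A \<in> L2 (M \<Otimes>\<^sub>M M). AE (x, y) in M \<Otimes>\<^sub>M M. A (x, y) = A (y, x)}"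

definition kernel_op :: "'v measure \<Rightarrow> ('v \<times> 'v \<Rightarrow> real) \<Rightarrow> ('v \<Rightarrow> real) \<Rightarrow> 'v \<Rightarrow> real" where
  "kernel_op M A f x = (\<integral>y. A (x, y) * f y \<partial>M)"

definition PSD :: "'v measure \<Rightarrow> ('v \<times> 'v \<Rightarrow> real) set" where
  "PSD M = {A \<in> L2_sym M. \<forall>f\<in>L2 M. 0 \<le> L2_inner M (kernel_op M A f) f}"

definition COP :: "'v measure \<Rightarrow> ('v \<times> 'v \<Rightarrow> real) set" where
  "COP M = {A \<in> L2_sym M. \<forall>f\<in>L2 M. (AE x in M. 0 \<le> f x) \<longrightarrow> 0 \<le> L2_inner M (kernel_op M A f) f}"

definition dual_cone :: "'v measure \<Rightarrow> ('v \<times> 'v \<Rightarrow> real) set \<Rightarrow> ('v \<times> 'v \<Rightarrow> real) set" where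
  "dual_cone M \<C> = {A \<in> L2_sym M. \<forall>Z\<in>\<C>. 0 \<le> L2_inner (M \<Otimes>\<^sub>M M) A Z}"

definition CP :: "'v measure \<Rightarrow> ('v \<times> 'v \<Rightarrow> real) set" where
  "CP M = dual_cone M (COP M)"

text \<open>
  For \<open>\<pi> permutes {..<n}\<close> the composition \<open>x \<circ> \<pi>\<close> leaves \<open>x\<close> unchanged outside \<open>{..<n}\<close>.
  Points of the \<open>n\<close>-fold power are functions on \<open>{..<n}\<close>, so the coordinates are numbered from 0.
\<close>

definition symmetrize :: "nat \<Rightarrow> ((nat \<Rightarrow> 'v) \<Rightarrow> real) \<Rightarrow> (nat \<Rightarrow> 'v) \<Rightarrow> real" where
  "symmetrize n F x = (\<Sum>\<pi> | \<pi> permutes {..<n}. F (x \<circ> \<pi>)) / fact n"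

definition tensor_ones :: "('v \<times> 'v \<Rightarrow> real) \<Rightarrow> (nat \<Rightarrow> 'v) \<Rightarrow> real" where
  "tensor_ones A x = A (x 0, x 1)"

definition C_cone :: "nat \<Rightarrow> 'v measure \<Rightarrow> ('v \<times> 'v \<Rightarrow> real) set" where
  "C_cone r M = {A \<in> L2_sym M.
     AE x in PiM {..<r + 2} (\<lambda>_. M). 0 \<le> symmetrize (r + 2) (tensor_ones A) x}"

definition C_dual :: "nat \<Rightarrow> 'v measure \<Rightarrow> ('v \<times> 'v \<Rightarrow> real) set" where
  "C_dual r M = dual_cone M (C_cone r M)"


section \<open>Optimization problems\<close>

definition feasible ::
    "('v::topological_space \<times> 'v) set \<Rightarrow> 'v measure \<Rightarrow> ('v \<times> 'v \<Rightarrow> real) set \<Rightarrow> ('v \<times> 'v \<Rightarrow> real) set" where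
  "feasible E M \<C> = {A \<in> \<C>. continuous_on UNIV A \<and> (\<integral>x. A (x, x) \<partial>M) = 1 \<and> (\<forall>(x, y)\<in>E. A (x, y) = 0)}"

text \<open>The suprema are taken in \<open>ereal\<close>, so no nonemptiness or boundedness is presupposed.\<close>

definition theta ::
    "('v::topological_space \<times> 'v) set \<Rightarrow> 'v measure \<Rightarrow> ('v \<times> 'v \<Rightarrow> real) set \<Rightarrow> ereal" where
  "theta E M \<C> = (SUP A\<in>feasible E M \<C>. ereal (L2_inner (M \<Otimes>\<^sub>M M) A (\<lambda>_. 1)))"

definition gamma :: "('v::topological_space \<times> 'v) set \<Rightarrow> 'v measure \<Rightarrow> nat \<Rightarrow> ereal" where
  "gamma E M r = theta E M (PSD M \<inter> C_dual r M)"

end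

theory Submission
  imports Defs "HOL-Probability.Probability"
begin

text \<open>
  Since \<open>CP \<subseteq> PSD \<inter> C\<^sub>r\<^sup>*\<close> and the cones \<open>C\<^sub>r\<^sup>*\<close> decrease, it is enough to turn kernels \<open>A\<^sub>r\<close>, feasible for
  \<open>\<gamma>\<^sub>r\<close> with value at least \<open>L > 0\<close>, into one kernel that is feasible for the limit problem with value at
  least \<open>L\<close>. Averaging over \<open>\<Gamma>\<close> makes the \<open>A\<^sub>r\<close> invariant, hence equal to 1 on the diagonal, and choosing
  them of nearly minimal norm makes them converge in L2.

  The limit has to be continuous. As \<open>0 \<le> A\<^sub>r \<le> 1\<close> as operators, \<open>A\<^sub>r\<close> is the sum over \<open>k\<close> of the kernels
  \<open>A\<^sub>r\<^sup>2 (1 - A\<^sub>r)\<^sup>k\<close>, which are positive semidefinite, invariant and bounded by their constant diagonal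
  values, and these values add up to at most 1. For invariant kernels, L2 convergence of \<open>A\<^sub>r\<close> gives uniform
  convergence of \<open>A\<^sub>r\<^sup>2 (1 - A\<^sub>r)\<^sup>k\<close> for every \<open>k\<close>, so the sum of the limits is continuous. Thickness keeps
  the limit zero on the edges, and its trace is at most 1, so normalizing it does not lower the value.

  A continuous kernel in every \<open>C\<^sub>r\<^sup>*\<close> lies in \<open>CP\<close> because it is nearly constant on the cells of a finite
  partition, and the average of a copositive kernel over the cells lies in some \<open>C\<^sub>r\<close> after adding a small
  multiple of the constant kernel.
\<close>

section \<open>Continuous kernels on a compact probability space\<close>

text \<open>An L2 limit of continuous kernels need not be continuous, and nothing forces the kernels
  \<open>A\<^sub>r\<close> themselves to converge uniformly. What the L2 norm does control is a
  composition: the sup norm of \<open>kcomp A B\<close> is at most the L2 norm of \<open>A\<close>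
  times the sup norm of \<open>B\<close> when \<open>A\<close> is invariant. The square in
  \<open>A\<^sup>2 (1 - A)\<^sup>k\<close> supplies the two factors that this needs, and the
  geometric series, formally \<open>A\<^sup>2\<close> times the inverse of
  \<open>1 - (1 - A)\<close>, gives \<open>A\<close> back without any spectral decomposition. The
  squared L2 norm of the remainder \<open>A (1 - A)\<^sup>N\<close> is the diagonal value of the
  term with index \<open>2 * N\<close>, so it is small together with that term. The diagonal value
  of the remainder itself need not be small, and this is how trace can be lost.

  The vertex space is not assumed to be second countable. Measurability of continuous kernels for
  the product sigma-algebra is therefore obtained from finite partitions, and the edge set, measured
  by the Radon product, is reached through integrals of continuous functions.\<close>

lemma finite_cover_labels:
  assumes "finite Z" and "\<And>z. z \<in> Z \<Longrightarrow> N z \<in> sets M"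
  obtains c where "c \<in> M \<rightarrow>\<^sub>M count_space UNIV" and "\<And>x. x \<in> \<Union>(N ` Z) \<Longrightarrow> c x \<in> Z \<and> x \<in> N (c x)"
proof -
  have "\<exists>c. c \<in> M \<rightarrow>\<^sub>M count_space UNIV \<and> (\<forall>x\<in>\<Union>(N ` Z). c x \<in> Z \<and> x \<in> N (c x))"
    using assms
  proof (induction Z rule: finite_induct)
    case empty
    show ?case by (intro exI[of _ "\<lambda>_. undefined"]) auto
  next
    case (insert z Z)
    then obtain c where c: "c \<in> M \<rightarrow>\<^sub>M count_space UNIV"
      "\<And>x. x \<in> \<Union>(N ` Z) \<Longrightarrow> c x \<in> Z \<and> x \<in> N (c x)" by auto
    have [measurable]: "N z \<in> sets M" using insert by auto
    note c(1)[measurable]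
    have "(\<lambda>x. if x \<in> N z then z else c x) \<in> M \<rightarrow>\<^sub>M count_space UNIV" by measurable
    then show ?case
      using c(2) by (intro exI[of _ "\<lambda>x. if x \<in> N z then z else c x"]) auto
  qed
  then show ?thesis using that by blast
qed

locale compact_prob_space = prob_space M for M :: "'v::t2_space measure" +
  assumes sets_M[simp, measurable_cong]: "sets M = sets borel"
    and compact_UNIV: "compact (UNIV :: 'v set)"
begin

lemma space_M[simp]: "space M = UNIV"
  using sets_eq_imp_space_eq[OF sets_M] by simp

lemma prob_UNIV[simp]: "prob UNIV = 1"
  using prob_space by simp

sublocale P: pair_prob_space M M ..

lemma pair_space[simp]: "space (M \<Otimes>\<^sub>M M) = UNIV"
  by (simp add: space_pair_measure)

text \<open>Compactness makes continuity at \<open>x0\<close> uniform in the other variable. This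
  stands in for uniform continuity on a space without a metric.\<close>

lemma uniform_nbhd:
  fixes A :: "'v \<times> 'v \<Rightarrow> real"
  assumes "continuous_on UNIV A" "\<epsilon> > 0"
  obtains N where "open N" "x0 \<in> N"
    "\<And>x y. x \<in> N \<Longrightarrow> \<bar>A (x, y) - A (x0, y)\<bar> \<le> \<epsilon>" "\<And>x y. x \<in> N \<Longrightarrow> \<bar>A (y, x) - A (y, x0)\<bar> \<le> \<epsilon>"
proof -
  have c1: "continuous_on (UNIV \<times> UNIV) A" using assms by simp
  have c2: "continuous_on (UNIV \<times> UNIV) (\<lambda>p. A (snd p, fst p))"
    by (intro continuous_on_compose2[OF assms(1)] continuous_intros) auto
  obtain X1 where X1: "x0 \<in> X1" "open X1" "\<forall>x\<in>X1 \<inter> UNIV. \<forall>t\<in>UNIV. dist (A (x, t)) (A (x0, t)) \<le> \<epsilon>"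
    using continuous_on_prod_compactE[OF c1 compact_UNIV _ assms(2)] by blast
  obtain X2 where X2: "x0 \<in> X2" "open X2"
    "\<forall>x\<in>X2 \<inter> UNIV. \<forall>t\<in>UNIV. dist (A (snd (x, t), fst (x, t))) (A (snd (x0, t), fst (x0, t))) \<le> \<epsilon>"
    using continuous_on_prod_compactE[OF c2 compact_UNIV _ assms(2)] by blast
  show ?thesis
    using X1 X2 by (intro that[of "X1 \<inter> X2"]) (auto simp: dist_real_def)
qed

text \<open>A finite partition is encoded by a label function \<open>c\<close> whose fibres are the
  cells. The labels are the centres of the covering neighbourhoods, so \<open>A (c x, c y)\<close>
  can serve as the value of a step kernel; a centre need not lie in its own cell.\<close>

lemma kernel_step:
  fixes A :: "'v \<times> 'v \<Rightarrow> real"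
  assumes "continuous_on UNIV A" "\<epsilon> > 0"
  obtains c :: "'v \<Rightarrow> 'v" where "c \<in> M \<rightarrow>\<^sub>M count_space UNIV" "finite (range c)"
    "\<And>x y. \<bar>A (x, y) - A (c x, c y)\<bar> \<le> \<epsilon>"
proof -
  have "\<exists>N. open N \<and> x0 \<in> N \<and> (\<forall>x\<in>N. \<forall>y. \<bar>A (x, y) - A (x0, y)\<bar> \<le> \<epsilon>/2) \<and>
      (\<forall>x\<in>N. \<forall>y. \<bar>A (y, x) - A (y, x0)\<bar> \<le> \<epsilon>/2)" for x0
    using uniform_nbhd[OF assms(1), of "\<epsilon>/2" x0] assms(2) by (metis half_gt_zero)
  then obtain N where N: "\<And>z. open (N z)" "\<And>z. z \<in> N z"
     "\<And>z x y. x \<in> N z \<Longrightarrow> \<bar>A (x, y) - A (z, y)\<bar> \<le> \<epsilon>/2"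
     "\<And>z x y. x \<in> N z \<Longrightarrow> \<bar>A (y, x) - A (y, z)\<bar> \<le> \<epsilon>/2" by metis
  have "UNIV \<subseteq> \<Union>(N ` UNIV)" using N(2) by auto
  then obtain Z where Z: "finite Z" "UNIV \<subseteq> (\<Union>z\<in>Z. N z)"
    using compactE_image[OF compact_UNIV, of UNIV N] N(1) by metis
  have "N z \<in> sets M" for z using N(1) by simp
  then obtain c where c: "c \<in> M \<rightarrow>\<^sub>M count_space UNIV" "\<And>x. x \<in> \<Union>(N ` Z) \<Longrightarrow> c x \<in> Z \<and> x \<in> N (c x)"
    using finite_cover_labels[OF Z(1)] by metis
  have cN: "c x \<in> Z" "x \<in> N (c x)" for x using c(2)[of x] Z(2) by auto
  show ?thesis
  proof (rule that[OF c(1)])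
    show "finite (range c)" using Z(1) cN(1) by (meson finite_subset image_subsetI)
    fix x y
    have "\<bar>A (x, y) - A (c x, y)\<bar> \<le> \<epsilon>/2" "\<bar>A (c x, y) - A (c x, c y)\<bar> \<le> \<epsilon>/2" using N cN by auto
    then show "\<bar>A (x, y) - A (c x, c y)\<bar> \<le> \<epsilon>" by linarith
  qed
qed

text \<open>With finitely many labels the function is a finite combination of indicators of
  measurable rectangles, whatever \<open>h\<close> is.\<close>

lemma measurable_label_pair:
  fixes h :: "'b \<Rightarrow> 'b \<Rightarrow> real"
  assumes [measurable]: "c \<in> M \<rightarrow>\<^sub>M count_space UNIV" and f: "finite (range c)"
  shows "(\<lambda>p. h (c (fst p)) (c (snd p))) \<in> borel_measurable (M \<Otimes>\<^sub>M M)"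
proof -
  have "h (c x) (c y) = (\<Sum>p\<in>range c. \<Sum>q\<in>range c. if c x = p \<and> c y = q then h p q else 0)" for x y
  proof -
    have "(\<Sum>q\<in>range c. if c x = p \<and> c y = q then h p q else 0) = (if p = c x then h p (c y) else 0)" for p
      using f by (cases "c x = p") (auto simp: sum.delta')
    then show ?thesis using f by (simp add: sum.delta)
  qed
  then have eq: "(\<lambda>p. h (c (fst p)) (c (snd p))) =
    (\<lambda>w. \<Sum>p\<in>range c. \<Sum>q\<in>range c. if c (fst w) = p \<and> c (snd w) = q then h p q else 0)" by auto
  show ?thesis unfolding eq by measurable
qed

text \<open>Open subsets of the product need not belong to the product sigma-algebra, so continuity
  alone is no argument. Uniform approximation by step kernels is.\<close>

lemma kernel_measurable[measurable]:
  fixes A :: "'v \<times> 'v \<Rightarrow> real"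
  assumes "continuous_on UNIV A"
  shows "A \<in> borel_measurable (M \<Otimes>\<^sub>M M)"
proof -
  have "\<exists>c. c \<in> M \<rightarrow>\<^sub>M count_space UNIV \<and> finite (range c) \<and>
     (\<forall>x y. \<bar>A (x, y) - A (c x, c y)\<bar> \<le> 1 / real (Suc n))" for n
    using kernel_step[OF assms, of "1 / real (Suc n)"] by (metis of_nat_0_less_iff zero_less_Suc zero_less_divide_1_iff)
  then obtain c where c: "\<And>n. c n \<in> M \<rightarrow>\<^sub>M count_space UNIV" "\<And>n. finite (range (c n))"
    "\<And>n x y. \<bar>A (x, y) - A (c n x, c n y)\<bar> \<le> 1 / real (Suc n)" by metis
  show ?thesis
  proof (rule borel_measurable_LIMSEQ_real)
    show "(\<lambda>p. A (c n (fst p), c n (snd p))) \<in> borel_measurable (M \<Otimes>\<^sub>M M)" for n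
      using measurable_label_pair[OF c(1,2), of "\<lambda>x y. A (x, y)"] by simp
    fix p
    have "(\<lambda>n. A (c n (fst p), c n (snd p)) - A p) \<longlonglongrightarrow> 0"
    proof (rule Lim_null_comparison)
      show "\<forall>\<^sub>F n in sequentially. norm (A (c n (fst p), c n (snd p)) - A p) \<le> 1 / real (Suc n)"
        using c(3)[of "fst p" "snd p"] by (intro always_eventually) (simp add: abs_minus_commute)
      show "(\<lambda>n. 1 / real (Suc n)) \<longlonglongrightarrow> 0" using LIMSEQ_inverse_real_of_nat by (simp add: inverse_eq_divide)
    qed
    then show "(\<lambda>n. A (c n (fst p), c n (snd p))) \<longlonglongrightarrow> A p" using Lim_null by blast
  qed
qed

lemma kernel_bounded:
  fixes A :: "'v \<times> 'v \<Rightarrow> real"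
  assumes "continuous_on UNIV A"
  obtains C where "C > 0" "\<And>p. \<bar>A p\<bar> \<le> C"
proof -
  have "compact (UNIV :: ('v \<times> 'v) set)" using compact_Times[OF compact_UNIV compact_UNIV] by simp
  then have "bounded (range A)" using assms compact_imp_bounded compact_continuous_image by blast
  then show ?thesis using that unfolding bounded_pos by auto
qed

lemma continuous_sections:
  assumes "continuous_on UNIV (A :: 'v \<times> 'v \<Rightarrow> real)"
  shows "continuous_on UNIV (\<lambda>x. A (x, y))" "continuous_on UNIV (\<lambda>y. A (x, y))"
     "continuous_on UNIV (\<lambda>x. A (x, x))" "continuous_on UNIV (\<lambda>p. A (snd p, fst p))"
  by (intro continuous_on_compose2[OF assms] continuous_intros; simp)+

lemma continuous_imp_measurable:
  "continuous_on UNIV (f :: 'v \<Rightarrow> real) \<Longrightarrow> f \<in> borel_measurable M"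
  using borel_measurable_continuous_onI measurable_cong_sets sets_M by blast

lemma integrable_bdd:
  fixes f :: "'v \<Rightarrow> real"
  shows "f \<in> borel_measurable M \<Longrightarrow> (\<And>x. \<bar>f x\<bar> \<le> C) \<Longrightarrow> integrable M f"
  by (intro integrable_const_bound[where B=C]) auto

lemma integrable_bdd2:
  fixes f :: "'v \<times> 'v \<Rightarrow> real"
  shows "f \<in> borel_measurable (M \<Otimes>\<^sub>M M) \<Longrightarrow> (\<And>x. \<bar>f x\<bar> \<le> C) \<Longrightarrow> integrable (M \<Otimes>\<^sub>M M) f"
  by (intro P.integrable_const_bound[where B=C]) auto

definition kcomp :: "('v \<times> 'v \<Rightarrow> real) \<Rightarrow> ('v \<times> 'v \<Rightarrow> real) \<Rightarrow> ('v \<times> 'v \<Rightarrow> real)" where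
  "kcomp A B = (\<lambda>(x, y). \<integral>z. A (x, z) * B (z, y) \<partial>M)"

text \<open>The bound holds everywhere, not just almost everywhere. The class contains the sections
  of continuous kernels and the indicators of cells, is mapped into itself by continuous kernels,
  and makes every product integrable.\<close>

definition bdd_measurable :: "('v \<Rightarrow> real) set" where
  "bdd_measurable = {f \<in> borel_measurable M. \<exists>C. \<forall>x. \<bar>f x\<bar> \<le> C}"

lemma bddE:
  assumes "f \<in> bdd_measurable"
  obtains C where "f \<in> borel_measurable M" "C > 0" "\<And>x. \<bar>f x\<bar> \<le> C"
proof -
  obtain C where C: "f \<in> borel_measurable M" "\<And>x. \<bar>f x\<bar> \<le> C" using assms by (auto simp: bdd_measurable_def)
  have "\<bar>f x\<bar> \<le> \<bar>C\<bar> + 1" for x using C(2)[of x] by linarith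
  then show ?thesis using that[of "\<bar>C\<bar> + 1"] C(1) by auto
qed

lemma bdd_integrable: "f \<in> bdd_measurable \<Longrightarrow> integrable M f"
  by (metis bddE integrable_bdd)

lemma bdd_continuous:
  assumes "continuous_on UNIV f"
  shows "f \<in> bdd_measurable"
proof -
  have "bounded (range f)" using assms compact_imp_bounded compact_continuous_image compact_UNIV by blast
  then show ?thesis using continuous_imp_measurable[OF assms] unfolding bounded_iff bdd_measurable_def by auto
qed

lemma bdd_mult: "f \<in> bdd_measurable \<Longrightarrow> g \<in> bdd_measurable \<Longrightarrow> (\<lambda>x. f x * g x) \<in> bdd_measurable"
proof -
  assume a: "f \<in> bdd_measurable" "g \<in> bdd_measurable"
  obtain C where C: "f \<in> borel_measurable M" "C > 0" "\<And>x. \<bar>f x\<bar> \<le> C" using bddE[OF a(1)] by blast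
  obtain D where D: "g \<in> borel_measurable M" "D > 0" "\<And>x. \<bar>g x\<bar> \<le> D" using bddE[OF a(2)] by blast
  have "\<bar>f x * g x\<bar> \<le> C * D" for x unfolding abs_mult using C D by (intro mult_mono) auto
  then show ?thesis unfolding bdd_measurable_def using C(1) D(1) by auto
qed

lemma bdd_diff: "f \<in> bdd_measurable \<Longrightarrow> g \<in> bdd_measurable \<Longrightarrow> (\<lambda>x. f x - g x) \<in> bdd_measurable"
proof -
  assume a: "f \<in> bdd_measurable" "g \<in> bdd_measurable"
  obtain C where C: "f \<in> borel_measurable M" "C > 0" "\<And>x. \<bar>f x\<bar> \<le> C" using bddE[OF a(1)] by blast
  obtain D where D: "g \<in> borel_measurable M" "D > 0" "\<And>x. \<bar>g x\<bar> \<le> D" using bddE[OF a(2)] by blast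
  have "\<bar>f x - g x\<bar> \<le> C + D" for x using C(3)[of x] D(3)[of x] by linarith
  then show ?thesis unfolding bdd_measurable_def using C(1) D(1) by auto
qed

lemma bdd_section:
  assumes "continuous_on UNIV A"
  shows "(\<lambda>y. A (x, y)) \<in> bdd_measurable" "(\<lambda>x. A (x, y)) \<in> bdd_measurable"
  using assms by (intro bdd_continuous continuous_sections; assumption)+

lemma kernel_form_integrable:
  assumes "continuous_on UNIV A" "f \<in> bdd_measurable" "g \<in> bdd_measurable"
  shows "integrable (M \<Otimes>\<^sub>M M) (\<lambda>(x, y). A (x, y) * f x * g y)"
proof -
  obtain B where B: "B > 0" "\<And>p. \<bar>A p\<bar> \<le> B" using kernel_bounded[OF assms(1)] by blast
  obtain C where C: "f \<in> borel_measurable M" "C > 0" "\<And>x. \<bar>f x\<bar> \<le> C" using bddE[OF assms(2)] by blast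
  obtain D where D: "g \<in> borel_measurable M" "D > 0" "\<And>x. \<bar>g x\<bar> \<le> D" using bddE[OF assms(3)] by blast
  note C(1)[measurable] D(1)[measurable] kernel_measurable[OF assms(1), measurable]
  show ?thesis
  proof (rule integrable_bdd2[of _ "B * C * D"])
    show "\<bar>case p of (x, y) \<Rightarrow> A (x, y) * f x * g y\<bar> \<le> B * C * D" for p
      using B C D by (auto simp: abs_mult split: prod.split intro!: mult_mono)
  qed measurable
qed

lemma kernel_op_continuous:
  assumes "continuous_on UNIV A" "f \<in> bdd_measurable"
  shows "continuous_on UNIV (kernel_op M A f)"
  unfolding continuous_on_topological
proof (intro ballI allI impI)
  fix x0 B assume B: "open B" "kernel_op M A f x0 \<in> B"
  then obtain \<epsilon> where \<epsilon>: "\<epsilon> > 0" "\<And>t. \<bar>t - kernel_op M A f x0\<bar> < \<epsilon> \<Longrightarrow> t \<in> B"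
    unfolding open_dist dist_real_def by blast
  obtain C where C: "f \<in> borel_measurable M" "C > 0" "\<And>x. \<bar>f x\<bar> \<le> C" using bddE[OF assms(2)] by blast
  obtain N where N: "open N" "x0 \<in> N" "\<And>x y. x \<in> N \<Longrightarrow> \<bar>A (x, y) - A (x0, y)\<bar> \<le> \<epsilon> / (2 * C)"
    using uniform_nbhd[OF assms(1), of "\<epsilon> / (2 * C)" x0] \<epsilon>(1) C(2) by (metis divide_pos_pos mult_pos_pos zero_less_numeral)
  have "kernel_op M A f x \<in> B" if "x \<in> N" for x
  proof (rule \<epsilon>(2))
    have i: "integrable M (\<lambda>y. A (x, y) * f y)" for x
      by (intro bdd_integrable bdd_mult bdd_section assms)
    have "kernel_op M A f x - kernel_op M A f x0 = (\<integral>y. (A (x, y) - A (x0, y)) * f y \<partial>M)"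
      unfolding kernel_op_def using i by (simp add: left_diff_distrib)
    also have "\<bar>\<dots>\<bar> \<le> (\<integral>y. \<epsilon> / 2 \<partial>M)"
    proof (rule order_trans[OF integral_abs_bound integral_mono])
      show "integrable M (\<lambda>y. \<bar>(A (x, y) - A (x0, y)) * f y\<bar>)"
        using i by (simp add: left_diff_distrib)
      fix y
      have "\<bar>A (x, y) - A (x0, y)\<bar> * \<bar>f y\<bar> \<le> \<epsilon> / (2 * C) * C"
        using N(3)[OF that] C \<epsilon> by (intro mult_mono) auto
      then show "\<bar>(A (x, y) - A (x0, y)) * f y\<bar> \<le> \<epsilon> / 2" using C(2) by (simp add: abs_mult)
    qed simp
    finally show "\<bar>kernel_op M A f x - kernel_op M A f x0\<bar> < \<epsilon>" using \<epsilon>(1) by (simp add: prob_space)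
  qed
  then show "\<exists>N. open N \<and> x0 \<in> N \<and> (\<forall>y\<in>UNIV. y \<in> N \<longrightarrow> kernel_op M A f y \<in> B)" using N by blast
qed

lemma kernel_op_bdd:
  "continuous_on UNIV A \<Longrightarrow> f \<in> bdd_measurable \<Longrightarrow> kernel_op M A f \<in> bdd_measurable"
  by (rule bdd_continuous[OF kernel_op_continuous])

lemma kcomp_eq: "kcomp A B (x, y) = kernel_op M A (\<lambda>z. B (z, y)) x"
  by (simp add: kcomp_def kernel_op_def)

lemma integral_abs_diff_le:
  assumes "f \<in> bdd_measurable" "g \<in> bdd_measurable" "\<And>x. \<bar>f x - g x\<bar> \<le> \<epsilon>"
  shows "\<bar>(\<integral>x. f x \<partial>M) - (\<integral>x. g x \<partial>M)\<bar> \<le> \<epsilon>"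
proof -
  have i: "integrable M f" "integrable M g" using assms bdd_integrable by auto
  have "(\<integral>x. f x \<partial>M) - (\<integral>x. g x \<partial>M) = (\<integral>x. f x - g x \<partial>M)" using i by simp
  also have "\<bar>\<dots>\<bar> \<le> (\<integral>x. \<epsilon> \<partial>M)"
    by (rule order_trans[OF integral_abs_bound integral_mono]) (use i assms in auto)
  finally show ?thesis by (simp add: prob_space)
qed

lemma kcomp_continuous:
  assumes "continuous_on UNIV A" "continuous_on UNIV B"
  shows "continuous_on UNIV (kcomp A B)"
  unfolding continuous_on_topological
proof (intro ballI allI impI)
  fix p0 U assume U: "open U" "kcomp A B p0 \<in> U"
  obtain x0 y0 where p0: "p0 = (x0, y0)" by fastforce
  obtain \<epsilon> where \<epsilon>: "\<epsilon> > 0" "\<And>t. \<bar>t - kcomp A B p0\<bar> < \<epsilon> \<Longrightarrow> t \<in> U"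
    using U unfolding open_dist dist_real_def by blast
  obtain C where C: "C > 0" "\<And>p. \<bar>A p\<bar> \<le> C" using kernel_bounded[OF assms(1)] by blast
  obtain D where D: "D > 0" "\<And>p. \<bar>B p\<bar> \<le> D" using kernel_bounded[OF assms(2)] by blast
  \<comment> \<open>The change of each factor will cost at most \<open>\<epsilon> / 4\<close>, so
    the total \<open>\<epsilon> / 2\<close> stays strictly below \<open>\<epsilon>\<close>.\<close>
  obtain N where N: "open N" "x0 \<in> N" "\<And>x y. x \<in> N \<Longrightarrow> \<bar>A (x, y) - A (x0, y)\<bar> \<le> \<epsilon> / (4 * D)"
    using uniform_nbhd[OF assms(1), of "\<epsilon> / (4 * D)" x0] \<epsilon>(1) D(1) by (metis divide_pos_pos mult_pos_pos zero_less_numeral)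
  obtain N' where N': "open N'" "y0 \<in> N'" "\<And>x y. y \<in> N' \<Longrightarrow> \<bar>B (x, y) - B (x, y0)\<bar> \<le> \<epsilon> / (4 * C)"
    using uniform_nbhd[OF assms(2), of "\<epsilon> / (4 * C)" y0] \<epsilon>(1) C(1) by (metis divide_pos_pos mult_pos_pos zero_less_numeral)
  have "kcomp A B p \<in> U" if "p \<in> N \<times> N'" for p
  proof (rule \<epsilon>(2))
    obtain x y where p: "p = (x, y)" "x \<in> N" "y \<in> N'" using \<open>p \<in> N \<times> N'\<close> by auto
    have "\<bar>kcomp A B (x, y) - kcomp A B (x0, y0)\<bar> \<le> \<epsilon> / 2"
      unfolding kcomp_def prod.case
    proof (intro integral_abs_diff_le bdd_mult bdd_section assms)
      fix z
      have "A (x, z) * B (z, y) - A (x0, z) * B (z, y0) = (A (x, z) - A (x0, z)) * B (z, y) + A (x0, z) * (B (z, y) - B (z, y0))"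
        by (simp add: algebra_simps)
      moreover have "\<bar>(A (x, z) - A (x0, z)) * B (z, y)\<bar> \<le> \<epsilon> / (4 * D) * D"
        unfolding abs_mult using N(3)[OF p(2)] D \<epsilon>(1) by (intro mult_mono) auto
      moreover have "\<bar>A (x0, z) * (B (z, y) - B (z, y0))\<bar> \<le> C * (\<epsilon> / (4 * C))"
        unfolding abs_mult using N'(3)[OF p(3)] C \<epsilon>(1) by (intro mult_mono) auto
      moreover have "\<epsilon> / (4 * D) * D = \<epsilon> / 4" "C * (\<epsilon> / (4 * C)) = \<epsilon> / 4" using C(1) D(1) by auto
      ultimately show "\<bar>A (x, z) * B (z, y) - A (x0, z) * B (z, y0)\<bar> \<le> \<epsilon> / 2" by linarith
    qed
    then show "\<bar>kcomp A B p - kcomp A B p0\<bar> < \<epsilon>" using \<epsilon>(1) p p0 by simp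
  qed
  then show "\<exists>N. open N \<and> p0 \<in> N \<and> (\<forall>y\<in>UNIV. y \<in> N \<longrightarrow> kcomp A B y \<in> U)"
    using open_Times[OF N(1) N'(1)] N(2) N'(2) p0 by (intro exI[of _ "N \<times> N'"]) auto
qed

lemma kernel_op_kcomp:
  assumes "continuous_on UNIV A" "continuous_on UNIV B" "f \<in> bdd_measurable"
  shows "kernel_op M (kcomp A B) f = kernel_op M A (kernel_op M B f)"
proof
  fix x
  have "kernel_op M (kcomp A B) f x = (\<integral>y. (\<integral>z. B (z, y) * A (x, z) * f y \<partial>M) \<partial>M)"
    unfolding kernel_op_def kcomp_def
    by (intro Bochner_Integration.integral_cong refl)
       (simp flip: integral_mult_left_zero add: mult_ac)
  also have "\<dots> = (\<integral>z. (\<integral>y. B (z, y) * A (x, z) * f y \<partial>M) \<partial>M)"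
    using kernel_form_integrable[OF assms(2) bdd_section(1)[OF assms(1)] assms(3), of x]
    by (intro P.Fubini_integral) simp
  also have "\<dots> = kernel_op M A (kernel_op M B f) x"
    unfolding kernel_op_def
    by (intro Bochner_Integration.integral_cong refl)
       (simp flip: integral_mult_right_zero add: mult_ac)
  finally show "kernel_op M (kcomp A B) f x = kernel_op M A (kernel_op M B f) x" .
qed

text \<open>Each column of \<open>kcomp B C\<close> is \<open>B\<close> applied to a column of
  \<open>C\<close>, so this is \<open>kernel_op_kcomp\<close> read column by column.\<close>

lemma kcomp_assoc:
  assumes "continuous_on UNIV A" "continuous_on UNIV B" "continuous_on UNIV C"
  shows "kcomp (kcomp A B) C = kcomp A (kcomp B C)"
proof
  fix p :: "'v \<times> 'v"
  obtain x y where p: "p = (x, y)" by fastforce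
  show "kcomp (kcomp A B) C p = kcomp A (kcomp B C) p"
    unfolding p kcomp_eq by (subst kernel_op_kcomp) (use assms bdd_section in \<open>auto simp: kcomp_eq\<close>)
qed

lemma inner_kernel_op:
  assumes "continuous_on UNIV A" "f \<in> bdd_measurable" "g \<in> bdd_measurable"
  shows "L2_inner M (kernel_op M A f) g = (\<integral>p. A p * (g (fst p) * f (snd p)) \<partial>(M \<Otimes>\<^sub>M M))"
proof -
  have "L2_inner M (kernel_op M A f) g = (\<integral>x. (\<integral>y. A (x, y) * g x * f y \<partial>M) \<partial>M)"
    unfolding L2_inner_def kernel_op_def
    by (intro Bochner_Integration.integral_cong refl) (simp flip: integral_mult_right_zero add: mult_ac)
  also have "\<dots> = (\<integral>(x, y). A (x, y) * g x * f y \<partial>(M \<Otimes>\<^sub>M M))"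
    using P.integral_fst'[OF kernel_form_integrable[OF assms(1,3,2)]] by (simp add: case_prod_beta')
  finally show ?thesis by (simp add: case_prod_beta' mult.assoc)
qed

lemma inner_kernel_op_sym:
  assumes "continuous_on UNIV A" "\<And>x y. A (x, y) = A (y, x)" "f \<in> bdd_measurable" "g \<in> bdd_measurable"
  shows "L2_inner M (kernel_op M A f) g = L2_inner M f (kernel_op M A g)"
proof -
  have "L2_inner M f (kernel_op M A g) = L2_inner M (kernel_op M A g) f"
    by (simp add: L2_inner_def mult.commute)
  also have "\<dots> = (\<integral>x. (\<integral>y. A (x, y) * f x * g y \<partial>M) \<partial>M)"
    unfolding L2_inner_def kernel_op_def
    by (intro Bochner_Integration.integral_cong refl) (simp flip: integral_mult_right_zero add: mult_ac)
  also have "\<dots> = (\<integral>y. (\<integral>x. A (x, y) * f x * g y \<partial>M) \<partial>M)"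
    using P.Fubini_integral[OF kernel_form_integrable[OF assms(1,3,4)]] by simp
  also have "\<dots> = L2_inner M (kernel_op M A f) g"
    unfolding L2_inner_def kernel_op_def
    by (intro Bochner_Integration.integral_cong refl)
       (simp flip: integral_mult_right_zero add: mult_ac assms(2))
  finally show ?thesis by simp
qed

end

section \<open>Quadratic forms and the kernels built from powers of 1 - A\<close>

context compact_prob_space
begin

lemma integral_tensor:
  assumes "f \<in> bdd_measurable" "g \<in> bdd_measurable"
  shows "integrable (M \<Otimes>\<^sub>M M) (\<lambda>p. f (fst p) * g (snd p))"
    "(\<integral>p. f (fst p) * g (snd p) \<partial>(M \<Otimes>\<^sub>M M)) = (\<integral>x. f x \<partial>M) * (\<integral>x. g x \<partial>M)"
proof -
  show i: "integrable (M \<Otimes>\<^sub>M M) (\<lambda>p. f (fst p) * g (snd p))"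
    using kernel_form_integrable[of "\<lambda>_. 1", OF _ assms] by (simp add: case_prod_beta')
  show "(\<integral>p. f (fst p) * g (snd p) \<partial>(M \<Otimes>\<^sub>M M)) = (\<integral>x. f x \<partial>M) * (\<integral>x. g x \<partial>M)"
    using P.integral_fst'[OF i] by simp
qed

text \<open>Recovers a point value of a continuous kernel from its integrals against probability
  densities concentrated near the point.\<close>

lemma kernel_average:
  assumes "continuous_on UNIV K" and f: "f \<in> bdd_measurable" "\<And>x. 0 \<le> f x" "(\<integral>x. f x \<partial>M) = 1"
    and g: "g \<in> bdd_measurable" "\<And>x. 0 \<le> g x" "(\<integral>x. g x \<partial>M) = 1"
    and close: "\<And>x y. f x \<noteq> 0 \<Longrightarrow> g y \<noteq> 0 \<Longrightarrow> \<bar>K (x, y) - k\<bar> \<le> \<epsilon>"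
  shows "\<bar>(\<integral>p. K p * (f (fst p) * g (snd p)) \<partial>(M \<Otimes>\<^sub>M M)) - k\<bar> \<le> \<epsilon>"
proof -
  let ?w = "\<lambda>p. f (fst p) * g (snd p)"
  have w: "integrable (M \<Otimes>\<^sub>M M) ?w" "(\<integral>p. ?w p \<partial>(M \<Otimes>\<^sub>M M)) = 1"
    using integral_tensor[OF f(1) g(1)] f(3) g(3) by auto
  have Kw: "integrable (M \<Otimes>\<^sub>M M) (\<lambda>p. K p * ?w p)"
    using kernel_form_integrable[OF assms(1) f(1) g(1)] by (simp add: case_prod_beta' mult.assoc)
  have "(\<integral>p. K p * ?w p \<partial>(M \<Otimes>\<^sub>M M)) - k = (\<integral>p. K p * ?w p - k * ?w p \<partial>(M \<Otimes>\<^sub>M M))"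
    using w Kw by simp
  also have "\<bar>\<dots>\<bar> \<le> (\<integral>p. \<epsilon> * ?w p \<partial>(M \<Otimes>\<^sub>M M))"
  proof (rule order_trans[OF integral_abs_bound integral_mono])
    fix p
    show "\<bar>K p * ?w p - k * ?w p\<bar> \<le> \<epsilon> * ?w p"
    proof (cases "f (fst p) = 0 \<or> g (snd p) = 0")
      case False
      then have "\<bar>K p - k\<bar> * ?w p \<le> \<epsilon> * ?w p"
        using close[of "fst p" "snd p"] f(2) g(2) by (intro mult_right_mono) auto
      moreover have "K p * ?w p - k * ?w p = (K p - k) * ?w p" by (simp add: algebra_simps)
      ultimately show ?thesis using f(2) g(2) by (simp add: abs_mult)
    qed auto
  qed (use w Kw in auto)
  also have "\<dots> = \<epsilon>" using w by simp
  finally show ?thesis .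
qed

text \<open>Tested on bounded functions only, where Fubini always applies. They include the
  normalized indicators from which pointwise inequalities are read off.\<close>

definition kpsd :: "('v \<times> 'v \<Rightarrow> real) \<Rightarrow> bool" where
  "kpsd K \<longleftrightarrow> (\<forall>f\<in>bdd_measurable. 0 \<le> L2_inner M (kernel_op M K f) f)"

lemma square_integral_le:
  assumes "f \<in> bdd_measurable"
  shows "(\<integral>x. f x \<partial>M)\<^sup>2 \<le> (\<integral>x. (f x)\<^sup>2 \<partial>M)"
proof -
  have i: "integrable M f" "integrable M (\<lambda>x. (f x)\<^sup>2)"
    using bdd_integrable[OF assms] bdd_integrable[OF bdd_mult[OF assms assms]] by (auto simp: power2_eq_square)
  show ?thesis using variance_positive[of f] variance_eq[OF i] by simp
qed

text \<open>The form is at most the square of the integral of \<open>\<bar>f\<bar>\<close>, which on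
  a probability space is at most the integral of the square. As operators this says
  \<open>A \<le> 1\<close>.\<close>

lemma kernel_op_le_norm:
  assumes "continuous_on UNIV A" "\<And>p. \<bar>A p\<bar> \<le> 1" "f \<in> bdd_measurable"
  shows "L2_inner M (kernel_op M A f) f \<le> L2_inner M f f"
proof -
  have af: "(\<lambda>x. \<bar>f x\<bar>) \<in> bdd_measurable" using assms(3) by (auto simp: bdd_measurable_def)
  have "L2_inner M (kernel_op M A f) f = (\<integral>p. A p * (f (fst p) * f (snd p)) \<partial>(M \<Otimes>\<^sub>M M))"
    by (rule inner_kernel_op[OF assms(1,3,3)])
  also have "\<dots> \<le> (\<integral>p. \<bar>f (fst p)\<bar> * \<bar>f (snd p)\<bar> \<partial>(M \<Otimes>\<^sub>M M))"
  proof (rule integral_mono)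
    show "integrable (M \<Otimes>\<^sub>M M) (\<lambda>p. A p * (f (fst p) * f (snd p)))"
      using kernel_form_integrable[OF assms(1,3,3)] by (simp add: case_prod_beta' mult.assoc)
    show "integrable (M \<Otimes>\<^sub>M M) (\<lambda>p. \<bar>f (fst p)\<bar> * \<bar>f (snd p)\<bar>)" by (rule integral_tensor(1)[OF af af])
    fix p
    have "\<bar>A p * (f (fst p) * f (snd p))\<bar> \<le> 1 * (\<bar>f (fst p)\<bar> * \<bar>f (snd p)\<bar>)"
      unfolding abs_mult using assms(2) by (intro mult_right_mono) auto
    then show "A p * (f (fst p) * f (snd p)) \<le> \<bar>f (fst p)\<bar> * \<bar>f (snd p)\<bar>" by simp
  qed
  also have "\<dots> = (\<integral>x. \<bar>f x\<bar> \<partial>M)\<^sup>2" using integral_tensor(2)[OF af af] by (simp add: power2_eq_square)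
  also have "\<dots> \<le> L2_inner M f f" using square_integral_le[OF af] by (simp add: L2_inner_def power2_eq_square)
  finally show ?thesis .
qed

text \<open>As operators, \<open>kR A k\<close> is \<open>A (1 - A)\<^sup>k\<close>, \<open>kT A k\<close> is \<open>A\<^sup>2 (1 - A)\<^sup>k\<close> and \<open>kD A\<close> is \<open>1 - A\<close>.\<close>

primrec kR :: "('v \<times> 'v \<Rightarrow> real) \<Rightarrow> nat \<Rightarrow> 'v \<times> 'v \<Rightarrow> real" where
  "kR A 0 = A"
| "kR A (Suc k) = (\<lambda>p. kR A k p - kcomp A (kR A k) p)"

abbreviation kT :: "('v \<times> 'v \<Rightarrow> real) \<Rightarrow> nat \<Rightarrow> 'v \<times> 'v \<Rightarrow> real" where
  "kT A k \<equiv> kcomp A (kR A k)"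

lemma kcomp_diff_left:
  assumes "continuous_on UNIV A" "continuous_on UNIV B" "continuous_on UNIV C"
  shows "kcomp (\<lambda>p. A p - B p) C = (\<lambda>p. kcomp A C p - kcomp B C p)"
proof
  fix p :: "'v \<times> 'v"
  obtain x y where p: "p = (x, y)" by fastforce
  show "kcomp (\<lambda>p. A p - B p) C p = kcomp A C p - kcomp B C p"
    unfolding p kcomp_def prod.case left_diff_distrib
    by (intro Bochner_Integration.integral_diff bdd_integrable bdd_mult bdd_section assms)
qed

lemma kcomp_diff_right:
  assumes "continuous_on UNIV A" "continuous_on UNIV B" "continuous_on UNIV C"
  shows "kcomp A (\<lambda>p. B p - C p) = (\<lambda>p. kcomp A B p - kcomp A C p)"
proof
  fix p :: "'v \<times> 'v"
  obtain x y where p: "p = (x, y)" by fastforce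
  show "kcomp A (\<lambda>p. B p - C p) p = kcomp A B p - kcomp A C p"
    unfolding p kcomp_def prod.case right_diff_distrib
    by (intro Bochner_Integration.integral_diff bdd_integrable bdd_mult bdd_section assms)
qed

lemma kR_continuous: "continuous_on UNIV A \<Longrightarrow> continuous_on UNIV (kR A k)"
  by (induction k) (auto intro!: continuous_on_diff kcomp_continuous)

lemma kT_continuous: "continuous_on UNIV A \<Longrightarrow> continuous_on UNIV (kT A k)"
  by (intro kcomp_continuous kR_continuous)

lemma kT_Suc: "continuous_on UNIV A \<Longrightarrow> kT A (Suc k) = (\<lambda>p. kT A k p - kcomp A (kT A k) p)"
  by (simp add: kcomp_diff_right kR_continuous kT_continuous)

text \<open>Polynomials in \<open>A\<close> commute. The exponents \<open>k\<close> and 0 will give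
  the symmetry of \<open>kR\<close>, equal exponents the L2 norm of \<open>kR\<close>.\<close>

lemma kcomp_kR_kR:
  assumes "continuous_on UNIV A"
  shows "kcomp (kR A j) (kR A k) = kT A (j + k)"
proof (induction j)
  case (Suc j)
  have "kcomp (kR A (Suc j)) (kR A k) = (\<lambda>p. kcomp (kR A j) (kR A k) p - kcomp (kcomp A (kR A j)) (kR A k) p)"
    by (simp add: kcomp_diff_left kR_continuous kT_continuous assms)
  also have "\<dots> = (\<lambda>p. kT A (j + k) p - kcomp A (kT A (j + k)) p)"
    by (simp add: kcomp_assoc kR_continuous assms Suc)
  also have "\<dots> = kT A (Suc j + k)" using kT_Suc[OF assms, of "j + k"] by simp
  finally show ?case .
qed simp

lemma kR_sym:
  assumes "continuous_on UNIV A" "\<And>x y. A (x, y) = A (y, x)"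
  shows "kR A k (x, y) = kR A k (y, x)"
proof (induction k arbitrary: x y)
  case (Suc k)
  \<comment> \<open>Transposition reverses the order of the two factors, and since they commute the
    product is unchanged.\<close>
  have "kT A k (y, x) = kcomp (kR A k) (kR A 0) (x, y)"
    unfolding kcomp_def kR.simps by (simp add: Suc[of x] assms(2)[of y] mult.commute)
  also have "\<dots> = kT A k (x, y)" using kcomp_kR_kR[OF assms(1), of k 0] by simp
  finally show ?case using Suc[of x y] by simp
qed (use assms in simp)

lemma kT_sym:
  assumes "continuous_on UNIV A" "\<And>x y. A (x, y) = A (y, x)"
  shows "kT A k (x, y) = kT A k (y, x)"
  using kR_sym[OF assms, of k x y] kR_sym[OF assms, of "Suc k" x y] by simp

text \<open>An operator on functions instead of a kernel, because the identity need not be given by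
  a kernel. The lemma \<open>kernel_op_kR\<close> is the link to the kernels
  \<open>kR\<close>.\<close>

definition kD :: "('v \<times> 'v \<Rightarrow> real) \<Rightarrow> ('v \<Rightarrow> real) \<Rightarrow> 'v \<Rightarrow> real" where
  "kD A f = (\<lambda>x. f x - kernel_op M A f x)"

lemma kD_bdd: "continuous_on UNIV A \<Longrightarrow> f \<in> bdd_measurable \<Longrightarrow> kD A f \<in> bdd_measurable"
  unfolding kD_def by (intro bdd_diff kernel_op_bdd)

lemma kD_funpow_bdd: "continuous_on UNIV A \<Longrightarrow> f \<in> bdd_measurable \<Longrightarrow> (kD A ^^ k) f \<in> bdd_measurable"
  by (induction k) (auto intro: kD_bdd)

lemma kernel_op_diff:
  assumes "continuous_on UNIV A" "f \<in> bdd_measurable" "g \<in> bdd_measurable"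
  shows "kernel_op M A (\<lambda>x. f x - g x) = (\<lambda>x. kernel_op M A f x - kernel_op M A g x)"
  unfolding kernel_op_def right_diff_distrib
  by (intro ext Bochner_Integration.integral_diff bdd_integrable bdd_mult bdd_section assms)

lemma kernel_op_kD:
  assumes "continuous_on UNIV A" "f \<in> bdd_measurable"
  shows "kernel_op M A (kD A f) = kD A (kernel_op M A f)"
  using assms by (simp add: kD_def kernel_op_diff kernel_op_bdd)

lemma kernel_op_kD_funpow:
  assumes "continuous_on UNIV A" "f \<in> bdd_measurable"
  shows "kernel_op M A ((kD A ^^ k) f) = (kD A ^^ k) (kernel_op M A f)"
  by (induction k) (simp_all add: kernel_op_kD kD_funpow_bdd assms)

lemma kernel_op_kR:
  assumes "continuous_on UNIV A" "f \<in> bdd_measurable"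
  shows "kernel_op M (kR A k) f = kernel_op M A ((kD A ^^ k) f)"
proof (induction k)
  case (Suc k)
  have "kernel_op M (kR A (Suc k)) f = (\<lambda>x. kernel_op M (kR A k) f x - kernel_op M (kT A k) f x)"
    unfolding kernel_op_def kR.simps left_diff_distrib
    by (intro ext Bochner_Integration.integral_diff bdd_integrable bdd_mult bdd_section
        kR_continuous kT_continuous assms)
  also have "\<dots> = kD A (kernel_op M A ((kD A ^^ k) f))"
    unfolding kernel_op_kcomp[OF assms(1) kR_continuous[OF assms(1)] assms(2)] Suc by (simp only: kD_def)
  finally show ?case by (simp add: kernel_op_kD kD_funpow_bdd assms)
qed simp

context
  fixes A :: "'v \<times> 'v \<Rightarrow> real"
  assumes A_cont: "continuous_on UNIV A" and A_sym: "\<And>x y. A (x, y) = A (y, x)"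
    and A_psd: "kpsd A" and A_le: "\<And>p. \<bar>A p\<bar> \<le> 1"
begin

lemma inner_diff_left:
  "f \<in> bdd_measurable \<Longrightarrow> g \<in> bdd_measurable \<Longrightarrow> h \<in> bdd_measurable \<Longrightarrow>
    L2_inner M (\<lambda>x. f x - g x) h = L2_inner M f h - L2_inner M g h"
  unfolding L2_inner_def left_diff_distrib
  by (intro Bochner_Integration.integral_diff bdd_integrable bdd_mult)

lemma inner_kD:
  assumes "f \<in> bdd_measurable" "g \<in> bdd_measurable"
  shows "L2_inner M (kD A f) g = L2_inner M f (kD A g)"
proof -
  have "L2_inner M f (kD A g) = L2_inner M (kD A g) f" by (simp add: L2_inner_def mult.commute)
  also have "\<dots> = L2_inner M g f - L2_inner M (kernel_op M A g) f"
    unfolding kD_def by (intro inner_diff_left assms kernel_op_bdd A_cont)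
  also have "\<dots> = L2_inner M f g - L2_inner M (kernel_op M A f) g"
    using inner_kernel_op_sym[OF A_cont A_sym assms(2,1)] by (simp add: L2_inner_def mult.commute)
  also have "\<dots> = L2_inner M (kD A f) g"
    unfolding kD_def by (intro inner_diff_left[symmetric] assms kernel_op_bdd A_cont)
  finally show ?thesis ..
qed

text \<open>Induction in steps of two: one factor \<open>1 - A\<close> moves to the other side of
  the inner product, which reduces \<open>k + 2\<close> at \<open>f\<close> to \<open>k\<close> at
  \<open>kD A f\<close>. The base cases are the norm and \<open>A \<le> 1\<close>, so no square root
  of \<open>1 - A\<close> is taken.\<close>

lemma kD_funpow_psd: "f \<in> bdd_measurable \<Longrightarrow> 0 \<le> L2_inner M ((kD A ^^ k) f) f"
proof (induction k arbitrary: f rule: induct_nat_012)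
  case 0
  show ?case by (simp add: L2_inner_def)
next
  case 1
  have "L2_inner M (kD A f) f = L2_inner M f f - L2_inner M (kernel_op M A f) f"
    unfolding kD_def by (intro inner_diff_left 1 kernel_op_bdd A_cont)
  then show ?case using kernel_op_le_norm[OF A_cont A_le 1] by simp
next
  case (ge2 k)
  have "L2_inner M ((kD A ^^ Suc (Suc k)) f) f = L2_inner M (kD A ((kD A ^^ k) (kD A f))) f"
    by (simp add: funpow_swap1)
  also have "\<dots> = L2_inner M ((kD A ^^ k) (kD A f)) (kD A f)"
    by (intro inner_kD kD_funpow_bdd kD_bdd ge2 A_cont)
  finally show ?case using ge2(1)[OF kD_bdd[OF A_cont ge2(3)]] by simp
qed

text \<open>With the two factors \<open>A\<close> placed on both sides of
  \<open>(1 - A)\<^sup>k\<close>, the form becomes that of \<open>(1 - A)\<^sup>k\<close> at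
  \<open>A f\<close>.\<close>

lemma kT_psd: "kpsd (kT A k)"
  unfolding kpsd_def
proof
  fix f assume f: "f \<in> bdd_measurable"
  have "L2_inner M (kernel_op M (kT A k) f) f = L2_inner M (kernel_op M A (kernel_op M A ((kD A ^^ k) f))) f"
    by (simp add: kernel_op_kcomp kR_continuous A_cont f kernel_op_kR)
  also have "\<dots> = L2_inner M ((kD A ^^ k) (kernel_op M A f)) (kernel_op M A f)"
    unfolding kernel_op_kD_funpow[OF A_cont f, symmetric]
    by (intro inner_kernel_op_sym A_cont A_sym kernel_op_bdd kD_funpow_bdd f)
  finally show "0 \<le> L2_inner M (kernel_op M (kT A k) f) f"
    using kD_funpow_psd[OF kernel_op_bdd[OF A_cont f]] by simp
qed

text \<open>For an even exponent the form at \<open>f\<close> is the form of \<open>A\<close> at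
  \<open>(1 - A)\<^sup>j f\<close>, so square roots are again avoided. The even indices are enough
  to bound all partial sums in \<open>unit_sum_kT_diag\<close>.\<close>

lemma kR_even_psd: "kpsd (kR A (2 * j))"
proof -
  have "0 \<le> L2_inner M (kernel_op M A ((kD A ^^ (2 * j)) f)) f" if "f \<in> bdd_measurable" for f
    using that
  proof (induction j arbitrary: f)
    case 0
    then show ?case using A_psd by (simp add: kpsd_def)
  next
    case (Suc j)
    have *: "(kD A ^^ (2 * Suc j)) f = kD A ((kD A ^^ (2 * j)) (kD A f))"
      by (simp add: funpow_swap1)
    have "L2_inner M (kernel_op M A ((kD A ^^ (2 * Suc j)) f)) f
        = L2_inner M (kD A (kernel_op M A ((kD A ^^ (2 * j)) (kD A f)))) f"
      unfolding * by (simp add: kernel_op_kD kD_funpow_bdd kD_bdd A_cont Suc.prems)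
    also have "\<dots> = L2_inner M (kernel_op M A ((kD A ^^ (2 * j)) (kD A f))) (kD A f)"
      by (intro inner_kD kernel_op_bdd kD_funpow_bdd kD_bdd A_cont Suc.prems)
    finally show ?case using Suc.IH[OF kD_bdd[OF A_cont Suc.prems]] by simp
  qed
  then show ?thesis by (simp add: kpsd_def kernel_op_kR A_cont)
qed

end

end

section \<open>Pointwise inequalities for positive semidefinite kernels\<close>

locale full_support_space = compact_prob_space M for M :: "'v::t2_space measure" +
  assumes full_support: "\<And>U. open U \<Longrightarrow> U \<noteq> {} \<Longrightarrow> 0 < measure M U"
begin

text \<open>The test function puts mass 1 near \<open>x\<close> and mass \<open>s\<close> near
  \<open>y\<close>. Full support allows indicators of arbitrarily small neighbourhoods to be
  normalized.\<close>

lemma psd_minor: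
  assumes K: "continuous_on UNIV K" "\<And>x y. K (x, y) = K (y, x)" "kpsd K" and s: "\<bar>s\<bar> = (1::real)"
  shows "0 \<le> K (x, x) + 2 * s * K (x, y) + K (y, y)"
proof (rule field_le_epsilon)
  fix d :: real assume "d > 0"
  \<comment> \<open>Four averages enter, each off by at most \<open>2 * \<epsilon>\<close>.\<close>
  define \<epsilon> where "\<epsilon> = d / 8"
  have \<epsilon>: "\<epsilon> > 0" using \<open>d > 0\<close> by (simp add: \<epsilon>_def)
  have "\<exists>N. open N \<and> x0 \<in> N \<and> (\<forall>x\<in>N. \<forall>y. \<bar>K (x, y) - K (x0, y)\<bar> \<le> \<epsilon>) \<and>
      (\<forall>x\<in>N. \<forall>y. \<bar>K (y, x) - K (y, x0)\<bar> \<le> \<epsilon>)" for x0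
    using uniform_nbhd[OF K(1) \<epsilon>, of x0] by metis
  then obtain N where N: "\<And>z. open (N z)" "\<And>z. z \<in> N z"
     "\<And>z x y. x \<in> N z \<Longrightarrow> \<bar>K (x, y) - K (z, y)\<bar> \<le> \<epsilon>"
     "\<And>z x y. x \<in> N z \<Longrightarrow> \<bar>K (y, x) - K (y, z)\<bar> \<le> \<epsilon>" by metis
  define u where "u z = (\<lambda>x. indicator (N z) x / measure M (N z))" for z
  have NM: "N z \<in> sets M" for z using N(1) by simp
  have pos: "0 < measure M (N z)" for z using full_support[OF N(1)] N(2) by blast
  have u_bdd: "u z \<in> bdd_measurable" for z
    unfolding bdd_measurable_def u_def using NM pos[of z]
    by (auto intro!: exI[of _ "1 / measure M (N z)"] simp: indicator_def divide_right_mono)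
  have u_nonneg: "0 \<le> u z x" for z x by (simp add: u_def)
  have u_int: "(\<integral>x. u z x \<partial>M) = 1" for z using NM pos[of z] by (simp add: u_def)
  have supp: "\<bar>K (a, b) - K (z, w)\<bar> \<le> 2 * \<epsilon>" if "u z a \<noteq> 0" "u w b \<noteq> 0" for a b z w
  proof -
    have "a \<in> N z" "b \<in> N w" using that by (auto simp: u_def indicator_def split: if_splits)
    then have "\<bar>K (a, b) - K (z, b)\<bar> \<le> \<epsilon>" "\<bar>K (z, b) - K (z, w)\<bar> \<le> \<epsilon>" using N by auto
    then show ?thesis by linarith
  qed
  define I where "I z w = (\<integral>p. K p * (u z (fst p) * u w (snd p)) \<partial>(M \<Otimes>\<^sub>M M))" for z w
  have I: "\<bar>I z w - K (z, w)\<bar> \<le> 2 * \<epsilon>" for z w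
    unfolding I_def by (intro kernel_average K u_bdd u_nonneg u_int supp)
  have int: "integrable (M \<Otimes>\<^sub>M M) (\<lambda>p. K p * (u z (fst p) * u w (snd p)))" for z w
    using kernel_form_integrable[OF K(1) u_bdd[of z] u_bdd[of w]] by (simp add: case_prod_beta' mult.assoc)
  \<comment> \<open>This is \<open>u x + s * u y\<close>, written as a difference so that
    \<open>bdd_diff\<close> applies.\<close>
  define f where "f = (\<lambda>a. u x a - (- s) * u y a)"
  have "(\<lambda>_. - s) \<in> bdd_measurable" by (rule bdd_continuous) simp
  then have f: "f \<in> bdd_measurable" unfolding f_def by (intro bdd_diff bdd_mult u_bdd)
  have "0 \<le> L2_inner M (kernel_op M K f) f" using K(3) f by (simp add: kpsd_def)
  also have "\<dots> = (\<integral>p. K p * (u x (fst p) * u x (snd p)) + s * (K p * (u x (fst p) * u y (snd p)))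
      + (s * (K p * (u y (fst p) * u x (snd p))) + s * s * (K p * (u y (fst p) * u y (snd p)))) \<partial>(M \<Otimes>\<^sub>M M))"
    unfolding inner_kernel_op[OF K(1) f f]
    by (intro Bochner_Integration.integral_cong refl) (simp add: f_def algebra_simps)
  also have "\<dots> = I x x + s * I x y + (s * I y x + s * s * I y y)"
    unfolding I_def using int by simp
  also have "s * s = 1" using s by (simp add: abs_if split: if_splits)
  finally have "0 \<le> I x x + s * I x y + s * I y x + I y y" by simp
  moreover have "s = 1 \<or> s = -1" using s by linarith
  ultimately show "0 \<le> K (x, x) + 2 * s * K (x, y) + K (y, y) + d"
    using I[of x x] I[of x y] I[of y x] I[of y y] K(2)[of x y] unfolding \<epsilon>_def abs_le_iff
    by (elim disjE) (simp only: mult_1_right mult_minus_right mult_minus_left mult_1_left, linarith)+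
qed

lemma psd_diag_nonneg:
  assumes "continuous_on UNIV K" "\<And>x y. K (x, y) = K (y, x)" "kpsd K"
  shows "0 \<le> K (x, x)"
  using psd_minor[OF assms, of 1 x x] by simp

lemma psd_le_diag:
  assumes "continuous_on UNIV K" "\<And>x y. K (x, y) = K (y, x)" "kpsd K"
  shows "2 * \<bar>K (x, y)\<bar> \<le> K (x, x) + K (y, y)"
  using psd_minor[OF assms, of 1 x y] psd_minor[OF assms, of "-1" x y] by simp

end

section \<open>Limits of invariant positive semidefinite kernels\<close>

text \<open>The point \<open>e\<close> is where constant diagonals are read off.\<close>

locale homogeneous_prob_space = full_support_space M for M :: "'v::t2_space measure" +
  fixes G :: "('v \<Rightarrow> 'v) set" and e :: 'v
  assumes G_measurable: "\<And>\<sigma>. \<sigma> \<in> G \<Longrightarrow> \<sigma> \<in> M \<rightarrow>\<^sub>M M"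
    and G_distr: "\<And>\<sigma>. \<sigma> \<in> G \<Longrightarrow> distr M M \<sigma> = M"
    and G_transitive: "\<And>x y. \<exists>\<sigma>\<in>G. \<sigma> x = y"
begin

definition kinv :: "('v \<times> 'v \<Rightarrow> real) \<Rightarrow> bool" where
  "kinv K \<longleftrightarrow> (\<forall>\<sigma>\<in>G. \<forall>x y. K (\<sigma> x, \<sigma> y) = K (x, y))"

lemma integral_G:
  fixes f :: "'v \<Rightarrow> real"
  assumes "\<sigma> \<in> G" "f \<in> borel_measurable M"
  shows "(\<integral>z. f (\<sigma> z) \<partial>M) = (\<integral>z. f z \<partial>M)"
  using integral_distr[OF G_measurable[OF assms(1)] assms(2)] G_distr[OF assms(1)] by simp

lemma kinv_diag: "kinv K \<Longrightarrow> K (x, x) = K (y, y)"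
  using G_transitive[of x y] unfolding kinv_def by metis

lemma kinv_integral_row:
  fixes h :: "real \<Rightarrow> real"
  assumes K: "continuous_on UNIV K" "kinv K" and h: "continuous_on UNIV h"
  shows "(\<integral>z. h (K (x, z)) \<partial>M) = (\<integral>z. h (K (y, z)) \<partial>M)"
proof -
  obtain \<sigma> where \<sigma>: "\<sigma> \<in> G" "\<sigma> x = y" using G_transitive by blast
  have "(\<lambda>z. h (K (y, z))) \<in> borel_measurable M"
    by (intro continuous_imp_measurable continuous_on_compose2[OF h] continuous_sections K) auto
  from integral_G[OF \<sigma>(1) this] have "(\<integral>z. h (K (\<sigma> x, \<sigma> z)) \<partial>M) = (\<integral>z. h (K (y, z)) \<partial>M)"
    using \<sigma>(2) by simp
  then show ?thesis using K(2) \<sigma>(1) by (simp add: kinv_def)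
qed

lemma kinv_kcomp:
  assumes "continuous_on UNIV A" "continuous_on UNIV B" "kinv A" "kinv B"
  shows "kinv (kcomp A B)"
  unfolding kinv_def kcomp_def prod.case
proof (intro ballI allI)
  fix \<sigma> x y assume \<sigma>: "\<sigma> \<in> G"
  have "(\<lambda>z. A (\<sigma> x, z) * B (z, \<sigma> y)) \<in> borel_measurable M"
    using assms by (intro continuous_imp_measurable continuous_on_mult continuous_sections)
  from integral_G[OF \<sigma> this]
  show "(\<integral>z. A (\<sigma> x, z) * B (z, \<sigma> y) \<partial>M) = (\<integral>z. A (x, z) * B (z, y) \<partial>M)"
    using assms(3,4) \<sigma> by (simp add: kinv_def)
qed

lemma kinv_kR: "continuous_on UNIV A \<Longrightarrow> kinv A \<Longrightarrow> kinv (kR A k)"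
proof (induction k)
  case (Suc k)
  then have "kinv (kT A k)" by (intro kinv_kcomp kR_continuous)
  with Suc show ?case by (simp add: kinv_def)
qed simp

lemma kinv_kT: "continuous_on UNIV A \<Longrightarrow> kinv A \<Longrightarrow> kinv (kT A k)"
  by (intro kinv_kcomp kR_continuous kinv_kR)

lemma integral_square_row:
  assumes K: "continuous_on UNIV K" "kinv K"
  shows "(\<integral>p. (K p)\<^sup>2 \<partial>(M \<Otimes>\<^sub>M M)) = (\<integral>z. (K (x, z))\<^sup>2 \<partial>M)"
proof -
  have "continuous_on UNIV (\<lambda>p. (K p)\<^sup>2)" using K(1) by (intro continuous_intros)
  from kernel_form_integrable[OF this, of "\<lambda>_. 1" "\<lambda>_. 1"]
  have i: "integrable (M \<Otimes>\<^sub>M M) (\<lambda>p. (K p)\<^sup>2)"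
    using bdd_continuous[of "\<lambda>_. 1"] by (simp add: case_prod_beta')
  have "(\<integral>p. (K p)\<^sup>2 \<partial>(M \<Otimes>\<^sub>M M)) = (\<integral>y. (\<integral>z. (K (y, z))\<^sup>2 \<partial>M) \<partial>M)"
    using P.integral_fst'[OF i] by simp
  also have "\<dots> = (\<integral>y. (\<integral>z. (K (x, z))\<^sup>2 \<partial>M) \<partial>M)"
    by (intro Bochner_Integration.integral_cong refl kinv_integral_row[OF K, of "\<lambda>t. t\<^sup>2"] continuous_intros)
  finally show ?thesis by simp
qed

lemma row_abs_le:
  assumes K: "continuous_on UNIV K" "kinv K"
  shows "(\<integral>z. \<bar>K (x, z)\<bar> \<partial>M) \<le> sqrt (\<integral>p. (K p)\<^sup>2 \<partial>(M \<Otimes>\<^sub>M M))"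
proof (rule real_le_rsqrt)
  have "(\<lambda>z. \<bar>K (x, z)\<bar>) \<in> bdd_measurable"
    using K(1) by (intro bdd_continuous continuous_intros continuous_sections)
  from square_integral_le[OF this]
  show "(\<integral>z. \<bar>K (x, z)\<bar> \<partial>M)\<^sup>2 \<le> (\<integral>p. (K p)\<^sup>2 \<partial>(M \<Otimes>\<^sub>M M))"
    using integral_square_row[OF K, of x] by simp
qed

text \<open>All rows of an invariant kernel have the same L2 norm, hence a common bound on their L1
  norms. Without invariance, the L2 norm of the whole kernel would leave single rows
  uncontrolled.\<close>

lemma kcomp_bound:
  assumes A: "continuous_on UNIV A" "kinv A" and B: "continuous_on UNIV B" "\<And>p. \<bar>B p\<bar> \<le> b"
  shows "\<bar>kcomp A B p\<bar> \<le> b * sqrt (\<integral>p. (A p)\<^sup>2 \<partial>(M \<Otimes>\<^sub>M M))"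
proof -
  obtain x y where p: "p = (x, y)" by fastforce
  have b: "0 \<le> b" using B(2)[of p] by linarith
  have "\<bar>kcomp A B p\<bar> \<le> (\<integral>z. b * \<bar>A (x, z)\<bar> \<partial>M)"
    unfolding p kcomp_def prod.case
  proof (rule order_trans[OF integral_abs_bound integral_mono])
    show "integrable M (\<lambda>z. \<bar>A (x, z) * B (z, y)\<bar>)"
      by (intro integrable_abs bdd_integrable bdd_mult bdd_section A B)
    show "integrable M (\<lambda>z. b * \<bar>A (x, z)\<bar>)"
      by (intro integrable_mult_right integrable_abs bdd_integrable bdd_section A)
    show "\<bar>A (x, z) * B (z, y)\<bar> \<le> b * \<bar>A (x, z)\<bar>" for z
      unfolding abs_mult using mult_right_mono[OF B(2)[of "(z, y)"], of "\<bar>A (x, z)\<bar>"] by (simp add: mult.commute)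
  qed
  also have "\<dots> \<le> b * sqrt (\<integral>p. (A p)\<^sup>2 \<partial>(M \<Otimes>\<^sub>M M))"
    using row_abs_le[OF A, of x] b by (simp add: mult_left_mono)
  finally show ?thesis .
qed

definition unit_kernel :: "('v \<times> 'v \<Rightarrow> real) \<Rightarrow> bool" where
  "unit_kernel A \<longleftrightarrow> continuous_on UNIV A \<and> (\<forall>x y. A (x, y) = A (y, x)) \<and> kpsd A \<and> kinv A \<and> (\<forall>x. A (x, x) = 1)"

context
  fixes A :: "'v \<times> 'v \<Rightarrow> real"
  assumes unit: "unit_kernel A"
begin

lemma unit_kernelD:
  shows "continuous_on UNIV A" "A (x, y) = A (y, x)" "kpsd A" "kinv A" "A (x, x) = 1"
  using unit by (auto simp: unit_kernel_def)

lemma unit_kernel_le: "\<bar>A p\<bar> \<le> 1"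
  using psd_le_diag[OF unit_kernelD(1,2,3), of "fst p" "snd p"] unit_kernelD(5) by simp

lemma unit_kT_le_diag: "\<bar>kT A k p\<bar> \<le> kT A k (e, e)"
proof -
  obtain x y where p: "p = (x, y)" by fastforce
  have "2 * \<bar>kT A k (x, y)\<bar> \<le> kT A k (x, x) + kT A k (y, y)"
    by (intro psd_le_diag kT_continuous kT_sym kT_psd unit_kernelD unit_kernel_le)
  then show ?thesis
    using kinv_diag[OF kinv_kT[OF unit_kernelD(1,4)], of k x e] kinv_diag[OF kinv_kT[OF unit_kernelD(1,4)], of k y e]
    by (simp add: p)
qed

text \<open>The sum telescopes, as \<open>kT A k\<close> is \<open>kR A k\<close> minus
  \<open>kR A (Suc k)\<close>.\<close>

lemma unit_sum_kT: "(\<Sum>k<n. kT A k p) = A p - kR A n p"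
  by (induction n) auto

lemma unit_sum_kT_diag: "(\<Sum>k<n. kT A k (e, e)) \<le> 1"
proof -
  \<comment> \<open>With \<open>2 * n\<close> terms the remainder has an even index, and so a
    nonnegative diagonal by \<open>kR_even_psd\<close>.\<close>
  have "(\<Sum>k<n. kT A k (e, e)) \<le> (\<Sum>k<2*n. kT A k (e, e))"
    by (rule sum_mono2) (use unit_kT_le_diag[of _ "(e,e)"] in auto)
  also have "\<dots> = 1 - kR A (2 * n) (e, e)" using unit_sum_kT unit_kernelD(5) by simp
  also have "\<dots> \<le> 1"
    using psd_diag_nonneg[OF kR_continuous[OF unit_kernelD(1)] kR_sym[OF unit_kernelD(1,2)]
        kR_even_psd[OF unit_kernelD(1,2,3) unit_kernel_le], of n e] by simp
  finally show ?thesis .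
qed

lemma unit_kT_le: "\<bar>kT A k p\<bar> \<le> 1"
proof -
  have "kT A k (e, e) \<le> (\<Sum>k<Suc k. kT A k (e, e))"
    by (rule member_le_sum) (use unit_kT_le_diag[of _ "(e,e)"] in auto)
  then show ?thesis using unit_kT_le_diag[of k p] unit_sum_kT_diag[of "Suc k"] by linarith
qed

text \<open>On the diagonal, a symmetric kernel composed with itself integrates the square of a row.
  The squared norm of the remainder is thus a term of the very series whose diagonal values have
  bounded sum.\<close>

lemma integral_kR_square: "(\<integral>p. (kR A k p)\<^sup>2 \<partial>(M \<Otimes>\<^sub>M M)) = kT A (2 * k) (e, e)"
proof -
  have "(\<integral>p. (kR A k p)\<^sup>2 \<partial>(M \<Otimes>\<^sub>M M)) = (\<integral>z. kR A k (e, z) * kR A k (e, z) \<partial>M)"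
    using integral_square_row[OF kR_continuous[OF unit_kernelD(1)] kinv_kR[OF unit_kernelD(1,4)], of k e]
    by (simp add: power2_eq_square)
  also have "\<dots> = kcomp (kR A k) (kR A k) (e, e)"
    unfolding kcomp_def prod.case by (subst (2) kR_sym[OF unit_kernelD(1,2)]) simp
  also have "\<dots> = kT A (2 * k) (e, e)" using kcomp_kR_kR[OF unit_kernelD(1), of k k] by (simp add: mult_2)
  finally show ?thesis .
qed

end

text \<open>With \<open>D = A - B\<close>, the identity \<open>A A - B B = A D + D B\<close> gives
  the initial constant 2. A further factor \<open>1 - A\<close> at most doubles the bound and adds
  \<open>\<delta>\<close>, and \<open>4 * 3 ^ k + 1 \<le> 2 * 3 ^ Suc k\<close>.\<close>

lemma kT_lipschitz:
  assumes A: "unit_kernel A" and B: "unit_kernel B"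
  defines "\<delta> \<equiv> sqrt (\<integral>p. (A p - B p)\<^sup>2 \<partial>(M \<Otimes>\<^sub>M M))"
  shows "\<bar>kT A k p - kT B k p\<bar> \<le> 2 * 3 ^ k * \<delta>"
proof (induction k arbitrary: p)
  note Ac = unit_kernelD(1)[OF A] and Bc = unit_kernelD(1)[OF B]
  define D where "D = (\<lambda>p. A p - B p)"
  have D: "continuous_on UNIV D" "kinv D" "\<delta> = sqrt (\<integral>p. (D p)\<^sup>2 \<partial>(M \<Otimes>\<^sub>M M))"
    using unit_kernelD(4)[OF A] unit_kernelD(4)[OF B] continuous_on_diff[OF Ac Bc] by (auto simp: D_def kinv_def \<delta>_def)
  have Dsym: "D (x, y) = D (y, x)" for x y
    using unit_kernelD(2)[OF A, of x y] unit_kernelD(2)[OF B, of x y] by (simp add: D_def)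
  have D_left: "\<bar>kcomp D K p\<bar> \<le> \<delta>" if "continuous_on UNIV K" "\<And>p. \<bar>K p\<bar> \<le> 1" for K p
    using kcomp_bound[OF D(1,2) that] D(3) by simp
  have \<delta>: "0 \<le> \<delta>" unfolding D(3) by simp
  {
    case 0
    obtain x y where p: "p = (x, y)" by fastforce
    \<comment> \<open>In \<open>kcomp_bound\<close> it is the left factor that is measured in L2, so
      the composition is transposed to bring \<open>D\<close> to the left.\<close>
    have "A (x, z) * D (z, y) = D (y, z) * A (z, x)" for z
      using Dsym[of z y] unit_kernelD(2)[OF A, of x z] by simp
    then have "kcomp A D (x, y) = kcomp D A (y, x)" by (simp add: kcomp_def)
    then have 1: "\<bar>kcomp A D p\<bar> \<le> \<delta>" using D_left[OF Ac unit_kernel_le[OF A]] p by simp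
    have 2: "\<bar>kcomp D B p\<bar> \<le> \<delta>" by (rule D_left[OF Bc unit_kernel_le[OF B]])
    have "kcomp A A p - kcomp B B p = kcomp A D p + kcomp D B p"
      unfolding D_def kcomp_diff_left[OF Ac Bc Bc] kcomp_diff_right[OF Ac Ac Bc] by simp
    with 1 2 show ?case by simp
  next
    case (Suc k)
    note TA = kT_continuous[OF Ac, of k] and TB = kT_continuous[OF Bc, of k]
    have "kT A (Suc k) p - kT B (Suc k) p
      = (kT A k p - kT B k p) - (kcomp A (\<lambda>p. kT A k p - kT B k p) p + kcomp D (kT B k) p)"
      unfolding kT_Suc[OF Ac] kT_Suc[OF Bc] kcomp_diff_right[OF Ac TA TB] D_def kcomp_diff_left[OF Ac Bc TB] by simp
    moreover have "\<bar>kcomp A (\<lambda>p. kT A k p - kT B k p) p\<bar> \<le> 2 * 3 ^ k * \<delta> * sqrt (\<integral>p. (A p)\<^sup>2 \<partial>(M \<Otimes>\<^sub>M M))"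
      by (intro kcomp_bound Ac unit_kernelD(4)[OF A] continuous_on_diff TA TB Suc)
    moreover have "(\<integral>p. (A p)\<^sup>2 \<partial>(M \<Otimes>\<^sub>M M)) \<le> (\<integral>p. 1 \<partial>(M \<Otimes>\<^sub>M M))"
    proof (rule integral_mono)
      show "(A p)\<^sup>2 \<le> 1" for p using unit_kernel_le[OF A, of p] by (simp add: abs_square_le_1)
      then show "integrable (M \<Otimes>\<^sub>M M) (\<lambda>p. (A p)\<^sup>2)"
        by (intro integrable_bdd2[where C = 1] borel_measurable_power kernel_measurable Ac) simp
    qed simp
    then have "2 * 3 ^ k * \<delta> * sqrt (\<integral>p. (A p)\<^sup>2 \<partial>(M \<Otimes>\<^sub>M M)) \<le> 2 * 3 ^ k * \<delta> * 1"
      using \<delta> P.prob_space by (intro mult_left_mono) auto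
    moreover have "\<bar>kcomp D (kT B k) p\<bar> \<le> \<delta>" by (rule D_left[OF TB unit_kT_le[OF B]])
    moreover have "\<delta> \<le> 3 ^ k * \<delta>" using \<delta> by (simp add: mult_le_cancel_right1)
    ultimately have "\<bar>kT A (Suc k) p - kT B (Suc k) p\<bar> \<le> 5 * (3 ^ k * \<delta>)"
      using Suc[of p] unfolding mult.assoc mult_1_right by linarith
    moreover have "0 \<le> 3 ^ k * \<delta>" using \<delta> by simp
    moreover have "2 * 3 ^ Suc k * \<delta> = 6 * (3 ^ k * \<delta>)" by simp
    ultimately show ?case by linarith
  }
qed

lemma square_sum3_le:
  fixes a b c d :: real
  assumes "b\<^sup>2 \<le> d" "c\<^sup>2 \<le> d"
  shows "(a + b + c)\<^sup>2 \<le> 3 * a\<^sup>2 + 6 * d"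
proof -
  have "3 * (a\<^sup>2 + b\<^sup>2 + c\<^sup>2) - (a + b + c)\<^sup>2 = (a - b)\<^sup>2 + (b - c)\<^sup>2 + (a - c)\<^sup>2"
    by (simp add: power2_eq_square algebra_simps)
  moreover have "0 \<le> (a - b)\<^sup>2 + (b - c)\<^sup>2 + (a - c)\<^sup>2" by simp
  ultimately show ?thesis using assms by (smt (verit))
qed

text \<open>\<open>A n - B\<close> splits into the remainder \<open>kR\<close>, the difference of
  two partial sums and the tail of the limit series. Diagonal mass may escape to larger and larger
  \<open>k\<close>, which is why only \<open>t \<le> 1\<close> is claimed; the remainder is
  nevertheless small in L2, by \<open>integral_kR_square\<close>.\<close>

proposition unit_kernel_limit:
  assumes A: "\<And>n. unit_kernel (A n)"
    and cauchy: "\<And>\<epsilon>. \<epsilon> > 0 \<Longrightarrow> \<exists>N. \<forall>m\<ge>N. \<forall>n\<ge>N. (\<integral>p. (A m p - A n p)\<^sup>2 \<partial>(M \<Otimes>\<^sub>M M)) < \<epsilon>"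
  obtains B t where "continuous_on UNIV B" "\<And>x y. B (x, y) = B (y, x)" "\<And>x. B (x, x) = t" "t \<le> 1"
    "\<And>p. \<bar>B p\<bar> \<le> t" "(\<lambda>n. \<integral>p. (A n p - B p)\<^sup>2 \<partial>(M \<Otimes>\<^sub>M M)) \<longlonglongrightarrow> 0"
proof -
  have unif: "uniformly_convergent_on UNIV (\<lambda>n p. kT (A n) k p)" for k
  proof (rule Cauchy_uniformly_convergent, unfold uniformly_Cauchy_on_def, intro allI impI)
    fix \<epsilon> :: real assume "\<epsilon> > 0"
    define \<eta> where "\<eta> = \<epsilon> / (2 * 3 ^ k)"
    have \<eta>: "\<eta> > 0" using \<open>\<epsilon> > 0\<close> by (simp add: \<eta>_def)
    then have "\<eta>\<^sup>2 > 0" by simp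
    from cauchy[OF this] obtain N where N: "\<And>m n. m \<ge> N \<Longrightarrow> n \<ge> N \<Longrightarrow> (\<integral>p. (A m p - A n p)\<^sup>2 \<partial>(M \<Otimes>\<^sub>M M)) < \<eta>\<^sup>2"
      by blast
    have "dist (kT (A m) k p) (kT (A n) k p) < \<epsilon>" if "m \<ge> N" "n \<ge> N" for m n p
    proof -
      have "sqrt (\<integral>p. (A m p - A n p)\<^sup>2 \<partial>(M \<Otimes>\<^sub>M M)) < \<eta>"
        using real_sqrt_less_mono[OF N[OF that]] \<eta> by simp
      then have "2 * 3 ^ k * sqrt (\<integral>p. (A m p - A n p)\<^sup>2 \<partial>(M \<Otimes>\<^sub>M M)) < 2 * 3 ^ k * \<eta>"
        by (intro mult_strict_left_mono) auto
      also have "\<dots> = \<epsilon>" by (simp add: \<eta>_def)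
      finally show ?thesis using kT_lipschitz[OF A[of m] A[of n], where k=k and p=p] by (simp add: dist_real_def)
    qed
    then show "\<exists>N. \<forall>x\<in>UNIV. \<forall>m\<ge>N. \<forall>n\<ge>N. dist (kT (A m) k x) (kT (A n) k x) < \<epsilon>" by blast
  qed
  define L where "L k p = lim (\<lambda>n. kT (A n) k p)" for k p
  have L: "uniform_limit UNIV (\<lambda>n p. kT (A n) k p) (L k) sequentially" for k
    using unif[of k] unfolding uniformly_convergent_uniform_limit_iff L_def .
  then have Lp: "(\<lambda>n. kT (A n) k p) \<longlonglongrightarrow> L k p" for k p
    by (rule tendsto_uniform_limitI) simp
  have L_cont: "continuous_on UNIV (L k)" for k
    by (rule uniform_limit_theorem[OF _ L]) (auto intro!: always_eventually kT_continuous unit_kernelD(1)[OF A])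
  have L_le: "\<bar>L k p\<bar> \<le> L k (e, e)" for k p
    by (rule LIMSEQ_le[OF tendsto_rabs[OF Lp] Lp]) (use unit_kT_le_diag[OF A] in auto)
  have L_diag: "L k (x, x) = L k (e, e)" for k x
    unfolding L_def using kinv_diag[OF kinv_kT[OF unit_kernelD(1)[OF A] unit_kernelD(4)[OF A]], of _ _ x e] by simp
  have L_sym: "L k (x, y) = L k (y, x)" for k x y
    unfolding L_def using kT_sym[OF unit_kernelD(1)[OF A] unit_kernelD(2)[OF A]] by simp
  have L_nonneg: "0 \<le> L k (e, e)" for k using L_le[of k "(e, e)"] by linarith
  have L_sum: "(\<Sum>k<n. L k (e, e)) \<le> 1" for n
    by (rule LIMSEQ_le_const2[OF tendsto_sum[OF Lp]]) (use unit_sum_kT_diag[OF A] in auto)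
  have summ: "summable (\<lambda>k. L k (e, e))"
    by (rule summableI_nonneg_bounded[OF L_nonneg L_sum])
  define B where "B p = (\<Sum>k. L k p)" for p
  have ulB: "uniform_limit UNIV (\<lambda>n p. \<Sum>k<n. L k p) B sequentially"
    unfolding B_def by (rule Weierstrass_m_test[OF _ summ]) (use L_le in auto)
  have summ_p: "summable (\<lambda>k. \<bar>L k p\<bar>)" for p
    by (rule summable_comparison_test'[OF summ]) (use L_le in auto)
  have B_cont: "continuous_on UNIV B"
    by (rule uniform_limit_theorem[OF _ ulB]) (auto intro!: always_eventually continuous_intros L_cont)
  define t where "t = (\<Sum>k. L k (e, e))"
  have tail: "\<bar>B p - (\<Sum>k<N. L k p)\<bar> \<le> t - (\<Sum>k<N. L k (e, e))" for N p
  proof -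
    have "B p - (\<Sum>k<N. L k p) = (\<Sum>k. L (k + N) p)"
      unfolding B_def using suminf_minus_initial_segment[OF summable_rabs_cancel[OF summ_p], of N] by simp
    also have "\<bar>\<dots>\<bar> \<le> (\<Sum>k. L (k + N) (e, e))"
      by (rule order_trans[OF summable_rabs suminf_le])
         (use L_le summ summ_p in \<open>auto simp: summable_iff_shift[of "\<lambda>k. \<bar>L k p\<bar>"] summable_iff_shift[of "\<lambda>k. L k (e, e)"]\<close>)
    also have "\<dots> = t - (\<Sum>k<N. L k (e, e))"
      unfolding t_def by (rule suminf_minus_initial_segment[OF summ])
    finally show ?thesis .
  qed
  have L2lim: "(\<lambda>n. \<integral>p. (A n p - B p)\<^sup>2 \<partial>(M \<Otimes>\<^sub>M M)) \<longlonglongrightarrow> 0"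
  proof (rule LIMSEQ_I)
    fix \<epsilon> :: real assume "\<epsilon> > 0"
    \<comment> \<open>By \<open>square_sum3_le\<close> the remainder will contribute less than
      \<open>3 * \<eta>\<close> and the other two pieces together \<open>6 * \<eta>\<close>.\<close>
    define \<eta> where "\<eta> = \<epsilon> / 9"
    have \<eta>: "\<eta> > 0" "sqrt \<eta> > 0" using \<open>\<epsilon> > 0\<close> by (simp_all add: \<eta>_def)
    have "(\<lambda>N. t - (\<Sum>k<N. L k (e, e))) \<longlonglongrightarrow> t - t"
      unfolding t_def by (intro tendsto_intros summable_LIMSEQ summ)
    then have ev1: "\<forall>\<^sub>F N in sequentially. t - (\<Sum>k<N. L k (e, e)) < sqrt \<eta>"
      using order_tendstoD(2) \<eta> by fastforce
    have "filterlim (\<lambda>N::nat. 2 * N) sequentially sequentially"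
      by (rule filterlim_subseq) (simp add: strict_mono_def)
    then have "(\<lambda>N. L (2 * N) (e, e)) \<longlonglongrightarrow> 0"
      using filterlim_compose[OF summable_LIMSEQ_zero[OF summ]] by blast
    then have ev2: "\<forall>\<^sub>F N in sequentially. L (2 * N) (e, e) < \<eta>"
      using order_tendstoD(2) \<eta> by fastforce
    \<comment> \<open>\<open>N\<close> is fixed before \<open>n\<close>. It makes small both the
      tail and the limit in \<open>n\<close> of the squared norm of the remainder; \<open>n\<close>
      is then taken large for this \<open>N\<close>.\<close>
    obtain N where N: "t - (\<Sum>k<N. L k (e, e)) < sqrt \<eta>" "L (2 * N) (e, e) < \<eta>"
      using eventually_happens[OF eventually_conj[OF ev1 ev2]] by auto
    have ev3: "\<forall>\<^sub>F n in sequentially. kT (A n) (2 * N) (e, e) < \<eta>"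
      by (rule order_tendstoD(2)[OF Lp N(2)])
    have ul: "uniform_limit UNIV (\<lambda>n p. \<Sum>k<N. kT (A n) k p) (\<lambda>p. \<Sum>k<N. L k p) sequentially" for N
      by (induction N) (auto intro: uniform_limit_add L uniform_limit_const)
    have ev4: "\<forall>\<^sub>F n in sequentially. \<forall>p. \<bar>(\<Sum>k<N. kT (A n) k p) - (\<Sum>k<N. L k p)\<bar> < sqrt \<eta>"
      using uniform_limitD[OF ul[of N] \<eta>(2)] by (simp add: dist_real_def)
    have "\<forall>\<^sub>F n in sequentially. (\<integral>p. (A n p - B p)\<^sup>2 \<partial>(M \<Otimes>\<^sub>M M)) < \<epsilon>"
      using ev3 ev4
    proof eventually_elim
      case (elim n)
      note An = unit_kernelD[OF A, of n]
      have m: "integrable (M \<Otimes>\<^sub>M M) (\<lambda>p. (K p)\<^sup>2)" if "continuous_on UNIV K" for K :: "'v \<times> 'v \<Rightarrow> real"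
      proof -
        have c: "continuous_on UNIV (\<lambda>p. (K p)\<^sup>2)" using that by (intro continuous_intros)
        obtain C where "\<And>p. \<bar>(K p)\<^sup>2\<bar> \<le> C" using kernel_bounded[OF c] by metis
        then show ?thesis by (intro integrable_bdd2 kernel_measurable c)
      qed
      have "(\<integral>p. (A n p - B p)\<^sup>2 \<partial>(M \<Otimes>\<^sub>M M)) \<le> (\<integral>p. 3 * (kR (A n) N p)\<^sup>2 + 6 * \<eta> \<partial>(M \<Otimes>\<^sub>M M))"
      proof (rule integral_mono)
        fix p
        let ?a = "kR (A n) N p" and ?b = "(\<Sum>k<N. kT (A n) k p) - (\<Sum>k<N. L k p)" and ?c = "(\<Sum>k<N. L k p) - B p"
        have "\<bar>?b\<bar> \<le> sqrt \<eta>" "\<bar>?c\<bar> \<le> sqrt \<eta>"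
          using elim(2)[rule_format, of p] tail[of p N] N(1) by (simp_all add: abs_minus_commute less_imp_le)
        then have "?b\<^sup>2 \<le> \<eta>" "?c\<^sup>2 \<le> \<eta>"
          using \<eta> by (metis abs_ge_zero power2_abs power_mono real_sqrt_pow2 less_imp_le)+
        moreover have "A n p - B p = ?a + ?b + ?c" using unit_sum_kT[OF A, where n = N and p = p] by simp
        ultimately show "(A n p - B p)\<^sup>2 \<le> 3 * ?a\<^sup>2 + 6 * \<eta>"
          by (simp only: square_sum3_le)
      qed (use m[OF continuous_on_diff[OF An(1) B_cont]] m[OF kR_continuous[OF An(1)]] in auto)
      also have "\<dots> = 3 * kT (A n) (2 * N) (e, e) + 6 * \<eta>"
        using m[OF kR_continuous[OF An(1)]] integral_kR_square[OF A, of n N] P.prob_space by simp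
      also have "\<dots> < \<epsilon>" using elim(1) by (simp add: \<eta>_def)
      finally show ?case .
    qed
    then obtain n0 where "\<And>n. n \<ge> n0 \<Longrightarrow> (\<integral>p. (A n p - B p)\<^sup>2 \<partial>(M \<Otimes>\<^sub>M M)) < \<epsilon>"
      unfolding eventually_sequentially by blast
    then show "\<exists>n0. \<forall>n\<ge>n0. norm ((\<integral>p. (A n p - B p)\<^sup>2 \<partial>(M \<Otimes>\<^sub>M M)) - 0) < \<epsilon>" by auto
  qed
  show ?thesis
  proof (rule that[of B t])
    show "B (x, y) = B (y, x)" for x y unfolding B_def by (intro suminf_cong L_sym)
    show "B (x, x) = t" for x unfolding B_def t_def by (intro suminf_cong L_diag)
    show "t \<le> 1" unfolding t_def by (rule suminf_le_const[OF summ L_sum])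
    show "\<bar>B p\<bar> \<le> t" for p using tail[of p 0] by simp
  qed (fact B_cont L2lim)+
qed

end

section \<open>The cones\<close>

definition offdiag :: "nat \<Rightarrow> (nat \<times> nat) set" where
  "offdiag n = {(i, j). i < n \<and> j < n \<and> i \<noteq> j}"

lemma finite_offdiag[simp]: "finite (offdiag n)"
  by (rule finite_subset[of _ "{..<n} \<times> {..<n}"]) (auto simp: offdiag_def)

lemma card_offdiag: "card (offdiag n) = n * (n - 1)"
proof -
  have "offdiag n = Sigma {..<n} (\<lambda>i. {..<n} - {i})" by (auto simp: offdiag_def)
  then show ?thesis by simp
qed

text \<open>Up to the factor \<open>n * (n - 1)\<close> this is the symmetrization, so it carries
  the sign condition of \<open>C_cone\<close> without permutations.\<close>

definition offdiag_sum :: "nat \<Rightarrow> ('a \<times> 'a \<Rightarrow> real) \<Rightarrow> (nat \<Rightarrow> 'a) \<Rightarrow> real" where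
  "offdiag_sum n A x = (\<Sum>(i, j)\<in>offdiag n. A (x i, x j))"

text \<open>Double counting of the sum of all \<open>S i j\<close>: each of them equals
  \<open>S 0 1\<close> because the permutations act transitively on ordered pairs of distinct
  indices, while a fixed permutation merely relabels the pairs.\<close>

lemma symmetrize_tensor_ones:
  assumes n: "n \<ge> 2"
  shows "symmetrize n (tensor_ones A) x * (n * (n - 1)) = offdiag_sum n A x"
proof -
  let ?P = "{\<pi>. \<pi> permutes {..<n}}"
  define S where "S i j = (\<Sum>\<pi>\<in>?P. A (x (\<pi> i), x (\<pi> j)))" for i j
  have S: "S i j = S 0 1" if ij: "(i, j) \<in> offdiag n" for i j
  proof -
    \<comment> \<open>\<open>c\<close> is what the swap of 0 and \<open>i\<close> sends to
      \<open>j\<close>, so swapping 1 with \<open>c\<close> first makes \<open>\<rho>\<close> send 1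
      to \<open>j\<close>. As \<open>i \<noteq> j\<close>, \<open>c\<close> is not 0, and the first
      swap leaves 0 to be sent to \<open>i\<close>.\<close>
    define c where "c = Transposition.transpose 0 i j"
    define \<rho> where "\<rho> = Transposition.transpose 0 i \<circ> Transposition.transpose 1 c"
    have c: "c < n" "c \<noteq> 0" using ij n by (auto simp: c_def Transposition.transpose_def offdiag_def)
    have "\<rho> permutes {..<n}" unfolding \<rho>_def
      by (intro permutes_compose permutes_swap_id) (use c n ij in \<open>auto simp: offdiag_def\<close>)
    moreover have "Transposition.transpose 1 c 0 = 0" using c(2) by (simp add: Transposition.transpose_def)
    then have "\<rho> 0 = i" "\<rho> 1 = j" by (simp_all add: \<rho>_def) (simp add: c_def)
    ultimately show ?thesis
      unfolding S_def using sum_permutations_compose_right[of \<rho> "{..<n}" "\<lambda>\<pi>. A (x (\<pi> 0), x (\<pi> 1))"] by simp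
  qed
  have perm: "(\<Sum>(i, j)\<in>offdiag n. A (x (\<pi> i), x (\<pi> j))) = offdiag_sum n A x" if p: "\<pi> permutes {..<n}" for \<pi>
    unfolding offdiag_sum_def
  proof (rule sum.reindex_bij_witness[where i="map_prod (inv \<pi>) (inv \<pi>)" and j="map_prod \<pi> \<pi>"])
    have l: "\<pi> i < n \<longleftrightarrow> i < n" "inv \<pi> i < n \<longleftrightarrow> i < n" for i
      using permutes_in_image[OF p, of i] permutes_in_image[OF permutes_inv[OF p], of i] by auto
    have l': "\<pi> i = \<pi> j \<longleftrightarrow> i = j" "inv \<pi> i = inv \<pi> j \<longleftrightarrow> i = j" for i j
      using permutes_inj[OF p] permutes_inj[OF permutes_inv[OF p]] by (auto simp: inj_eq)
    fix a assume "a \<in> offdiag n"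
    then show "map_prod \<pi> \<pi> a \<in> offdiag n" "map_prod (inv \<pi>) (inv \<pi>) a \<in> offdiag n"
      by (auto simp: offdiag_def l l')
    show "map_prod (inv \<pi>) (inv \<pi>) (map_prod \<pi> \<pi> a) = a" "map_prod \<pi> \<pi> (map_prod (inv \<pi>) (inv \<pi>) a) = a"
      using permutes_inverses[OF p] by (auto simp: map_prod_def split: prod.split)
  qed (auto split: prod.split)
  have "(\<Sum>(i, j)\<in>offdiag n. S i j) = (\<Sum>p\<in>offdiag n. S 0 1)"
    by (intro sum.cong refl) (use S in auto)
  then have "n * (n - 1) * S 0 1 = (\<Sum>(i, j)\<in>offdiag n. S i j)"
    by (simp add: card_offdiag)
  also have "\<dots> = (\<Sum>\<pi>\<in>?P. \<Sum>(i, j)\<in>offdiag n. A (x (\<pi> i), x (\<pi> j)))"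
    unfolding S_def case_prod_beta' by (rule sum.swap)
  also have "\<dots> = (\<Sum>\<pi>\<in>?P. offdiag_sum n A x)" by (intro sum.cong refl) (use perm in auto)
  also have "\<dots> = fact n * offdiag_sum n A x" by (simp add: card_permutations[of "{..<n}" n])
  finally show ?thesis by (simp add: symmetrize_def tensor_ones_def S_def field_simps)
qed

lemma symmetrize_nonneg_iff:
  assumes "n \<ge> 2"
  shows "0 \<le> symmetrize n (tensor_ones A) x \<longleftrightarrow> 0 \<le> offdiag_sum n A x"
proof -
  have "0 < real (n * (n - 1))" using assms by simp
  then show ?thesis
    using zero_le_mult_iff[of "symmetrize n (tensor_ones A) x" "real (n * (n - 1))"]
    unfolding symmetrize_tensor_ones[OF assms] by linarith
qed

lemma C_cone_iff:
  "A \<in> C_cone r M \<longleftrightarrow> A \<in> L2_sym M \<and> (AE x in PiM {..<r + 2} (\<lambda>_. M). 0 \<le> offdiag_sum (r + 2) A x)"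
  unfolding C_cone_def by (simp add: symmetrize_nonneg_iff)

lemma L2_mult_integrable:
  assumes "f \<in> L2 M" "g \<in> L2 M"
  shows "integrable M (\<lambda>x. f x * g x)"
proof -
  have [measurable]: "f \<in> borel_measurable M" "g \<in> borel_measurable M" using assms by (auto simp: L2_def)
  have i: "integrable M (\<lambda>x. (f x)\<^sup>2 + (g x)\<^sup>2)" using assms by (auto simp: L2_def)
  show ?thesis
  proof (rule Bochner_Integration.integrable_bound[OF i])
    have "\<bar>a * b\<bar> \<le> a\<^sup>2 + b\<^sup>2" for a b :: real
    proof -
      have "0 \<le> \<bar>a\<bar> * \<bar>b\<bar>" by simp
      then show ?thesis using sum_squares_bound[of "\<bar>a\<bar>" "\<bar>b\<bar>"] unfolding abs_mult power2_abs by linarith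
    qed
    then show "AE x in M. norm (f x * g x) \<le> norm ((f x)\<^sup>2 + (g x)\<^sup>2)" by auto
  qed simp
qed

section \<open>Monotonicity of the cones, and expectations under product measures\<close>

context prob_space
begin

lemma AE_PiM_reindex:
  assumes "AE x in PiM {..<n} (\<lambda>_. M). Q x" and f: "inj_on f {..<n}" "f \<in> {..<n} \<rightarrow> {..<m}"
  shows "AE x in PiM {..<m} (\<lambda>_. M). Q (\<lambda>i\<in>{..<n}. x (f i))"
proof -
  have "distr (PiM {..<m} (\<lambda>_. M)) (PiM {..<n} (\<lambda>_. M)) (\<lambda>x. \<lambda>i\<in>{..<n}. x (f i)) = PiM {..<n} (\<lambda>_. M)"
    using distr_PiM_reindex[of "{..<m}" "\<lambda>_. M" f "{..<n}"] f prob_space_axioms by simp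
  with assms(1) have "AE x in distr (PiM {..<m} (\<lambda>_. M)) (PiM {..<n} (\<lambda>_. M)) (\<lambda>x. \<lambda>i\<in>{..<n}. x (f i)). Q x" by (simp only:)
  moreover have "(\<lambda>x. \<lambda>i\<in>{..<n}. x (f i)) \<in> PiM {..<m} (\<lambda>_. M) \<rightarrow>\<^sub>M PiM {..<n} (\<lambda>_. M)"
    using f(2) by (intro measurable_restrict measurable_component_singleton) auto
  ultimately show ?thesis by (rule AE_distrD[rotated])
qed

text \<open>Each of the \<open>n + 1\<close> coordinates is dropped in turn. Adding the resulting
  inequalities counts every pair \<open>n - 1\<close> times.\<close>

lemma C_cone_Suc: "C_cone r M \<subseteq> C_cone (Suc r) M"
proof
  fix A assume "A \<in> C_cone r M"
  define n where "n = r + 2"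
  have A: "A \<in> L2_sym M" "AE x in PiM {..<n} (\<lambda>_. M). 0 \<le> offdiag_sum n A x"
    using \<open>A \<in> C_cone r M\<close> unfolding C_cone_iff n_def by blast+
  \<comment> \<open>The increasing enumeration of the indices other than \<open>k\<close>.\<close>
  define skip where "skip k i = (if i < k then i else Suc i)" for k i :: nat
  have "AE x in PiM {..<Suc n} (\<lambda>_. M). 0 \<le> offdiag_sum n A (\<lambda>i\<in>{..<n}. x (skip k i))" for k
    by (rule AE_PiM_reindex[OF A(2)]) (auto simp: skip_def inj_on_def split: if_splits)
  then have "AE x in PiM {..<Suc n} (\<lambda>_. M). \<forall>k\<in>{..<Suc n}. 0 \<le> offdiag_sum n A (\<lambda>i\<in>{..<n}. x (skip k i))"
    by (intro AE_ball_countable[THEN iffD2]) auto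
  then have "AE x in PiM {..<Suc n} (\<lambda>_. M). 0 \<le> offdiag_sum (Suc n) A x"
  proof (rule AE_mp, intro AE_I2 impI)
    fix x assume pos: "\<forall>k\<in>{..<Suc n}. 0 \<le> offdiag_sum n A (\<lambda>i\<in>{..<n}. x (skip k i))"
    let ?O = "offdiag (Suc n)"
    let ?g = "\<lambda>(i, j). A (x i, x j)"
    have skip: "offdiag_sum n A (\<lambda>i\<in>{..<n}. x (skip k i)) = (\<Sum>p\<in>{p\<in>?O. fst p \<noteq> k \<and> snd p \<noteq> k}. ?g p)"
      if "k < Suc n" for k
      unfolding offdiag_sum_def
      by (rule sum.reindex_bij_witness[where j="map_prod (skip k) (skip k)"
            and i="map_prod (\<lambda>i. if i < k then i else i - 1) (\<lambda>i. if i < k then i else i - 1)"])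
         (use that in \<open>auto simp: offdiag_def skip_def split: if_splits\<close>)
    have "0 \<le> (\<Sum>k<Suc n. offdiag_sum n A (\<lambda>i\<in>{..<n}. x (skip k i)))"
      by (intro sum_nonneg) (use pos in auto)
    also have "\<dots> = (\<Sum>k<Suc n. \<Sum>p\<in>?O. if fst p \<noteq> k \<and> snd p \<noteq> k then ?g p else 0)"
      by (intro sum.cong refl) (simp add: skip sum.inter_filter)
    also have "\<dots> = (\<Sum>p\<in>?O. \<Sum>k<Suc n. if fst p \<noteq> k \<and> snd p \<noteq> k then ?g p else 0)"
      by (rule sum.swap)
    also have "\<dots> = (\<Sum>p\<in>?O. real (n - 1) * ?g p)"
    proof (intro sum.cong refl)
      fix p assume p: "p \<in> ?O"
      have "(\<Sum>k<Suc n. if fst p \<noteq> k \<and> snd p \<noteq> k then ?g p else 0) = (\<Sum>k\<in>{..<Suc n} - {fst p, snd p}. ?g p)"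
        by (rule sum.mono_neutral_cong_right) auto
      moreover have "card ({..<Suc n} - {fst p, snd p}) = n - 1"
        using p by (subst card_Diff_subset) (auto simp: offdiag_def)
      ultimately show "(\<Sum>k<Suc n. if fst p \<noteq> k \<and> snd p \<noteq> k then ?g p else 0) = real (n - 1) * ?g p" by simp
    qed
    also have "\<dots> = real (n - 1) * offdiag_sum (Suc n) A x" by (simp add: offdiag_sum_def sum_distrib_left)
    finally show "0 \<le> offdiag_sum (Suc n) A x" by (simp add: n_def zero_le_mult_iff)
  qed
  moreover have "Suc n = Suc r + 2" by (simp add: n_def)
  ultimately show "A \<in> C_cone (Suc r) M" using A(1) unfolding C_cone_iff by metis
qed

lemma distr_PiM_pair:
  assumes ab: "(a, b) \<in> offdiag n"
  shows "distr (PiM {..<n} (\<lambda>_. M)) (M \<Otimes>\<^sub>M M) (\<lambda>x. (x a, x b)) = M \<Otimes>\<^sub>M M"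
proof (rule pair_measure_eqI[symmetric])
  interpret PF: product_sigma_finite "\<lambda>_. M" by standard
  show "sigma_finite_measure M" by unfold_locales
  then show "sigma_finite_measure M" .
  fix A B assume AB: "A \<in> sets M" "B \<in> sets M"
  have m: "a \<in> {..<n}" "b \<in> {..<n}" "a \<noteq> b" using ab by (auto simp: offdiag_def)
  let ?E = "\<lambda>i. if i = a then A else if i = b then B else space M"
  have eq: "(\<lambda>x. (x a, x b)) -` (A \<times> B) \<inter> space (PiM {..<n} (\<lambda>_. M)) = Pi\<^sub>E {..<n} ?E"
  proof (rule set_eqI)
    fix x
    have "x i \<in> ?E i \<Longrightarrow> x i \<in> space M" for i
      using sets.sets_into_space[OF AB(1)] sets.sets_into_space[OF AB(2)] by (auto split: if_splits)
    moreover have "(\<forall>i\<in>{..<n}. x i \<in> ?E i) \<Longrightarrow> x a \<in> A \<and> x b \<in> B"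
      using bspec[of "{..<n}" _ a] bspec[of "{..<n}" _ b] m by (metis (full_types))
    ultimately show "x \<in> (\<lambda>x. (x a, x b)) -` (A \<times> B) \<inter> space (PiM {..<n} (\<lambda>_. M)) \<longleftrightarrow> x \<in> Pi\<^sub>E {..<n} ?E"
      unfolding vimage_eq Int_iff space_PiM PiE_iff mem_Sigma_iff by (smt (verit))
  qed
  have "emeasure (distr (PiM {..<n} (\<lambda>_. M)) (M \<Otimes>\<^sub>M M) (\<lambda>x. (x a, x b))) (A \<times> B) = emeasure (PiM {..<n} (\<lambda>_. M)) (Pi\<^sub>E {..<n} ?E)"
    unfolding eq[symmetric] using m AB
    by (intro emeasure_distr) (auto intro!: measurable_Pair measurable_component_singleton)
  also have "\<dots> = (\<Prod>i<n. emeasure M (?E i))"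
    by (rule PF.emeasure_PiM) (use AB in auto)
  also have "\<dots> = (\<Prod>i<n. (if i = a then emeasure M A else 1) * (if i = b then emeasure M B else 1))"
    by (intro prod.cong refl) (use m in \<open>auto simp: emeasure_space_1\<close>)
  also have "\<dots> = emeasure M A * emeasure M B"
    unfolding prod.distrib using m by (simp add: prod.delta)
  finally show "emeasure M A * emeasure M B
    = emeasure (distr (PiM {..<n} (\<lambda>_. M)) (M \<Otimes>\<^sub>M M) (\<lambda>x. (x a, x b))) (A \<times> B)" ..
qed simp

text \<open>Any two distinct coordinates have the joint law \<open>M \<Otimes>\<^sub>M M\<close>.
  The probability space is arbitrary because the lemma will be applied to a measure given by a
  density.\<close>

lemma integral_offdiag_sum:
  assumes A: "integrable (M \<Otimes>\<^sub>M M) A"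
  shows "(\<integral>x. offdiag_sum n A x \<partial>PiM {..<n} (\<lambda>_. M)) = real (n * (n - 1)) * (\<integral>p. A p \<partial>(M \<Otimes>\<^sub>M M))"
proof -
  have m: "(\<lambda>x. (x a, x b)) \<in> PiM {..<n} (\<lambda>_. M) \<rightarrow>\<^sub>M M \<Otimes>\<^sub>M M" if "(a, b) \<in> offdiag n" for a b
    using that by (intro measurable_Pair measurable_component_singleton) (auto simp: offdiag_def)
  have i: "integrable (PiM {..<n} (\<lambda>_. M)) (\<lambda>x. A (x a, x b))" if "(a, b) \<in> offdiag n" for a b
    using integrable_distr[OF m[OF that], of A] A distr_PiM_pair[OF that] by simp
  have "(\<integral>x. offdiag_sum n A x \<partial>PiM {..<n} (\<lambda>_. M))
      = (\<Sum>p\<in>offdiag n. \<integral>x. A (x (fst p), x (snd p)) \<partial>PiM {..<n} (\<lambda>_. M))"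
    unfolding offdiag_sum_def case_prod_beta' by (intro Bochner_Integration.integral_sum i) auto
  also have "\<dots> = (\<Sum>p\<in>offdiag n. \<integral>p. A p \<partial>(M \<Otimes>\<^sub>M M))"
  proof (intro sum.cong refl)
    fix p assume "p \<in> offdiag n"
    then have p: "(fst p, snd p) \<in> offdiag n" by simp
    show "(\<integral>x. A (x (fst p), x (snd p)) \<partial>PiM {..<n} (\<lambda>_. M)) = (\<integral>p. A p \<partial>(M \<Otimes>\<^sub>M M))"
      using integral_distr[OF m[OF p], of A] A distr_PiM_pair[OF p] by auto
  qed
  finally show ?thesis by (simp add: card_offdiag)
qed

lemma PiM_density:
  assumes g[measurable]: "g \<in> borel_measurable M" and gp: "prob_space (density M g)"
  shows "PiM {..<n::nat} (\<lambda>_. density M g) = density (PiM {..<n} (\<lambda>_. M)) (\<lambda>x. \<Prod>i<n. g (x i))"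
proof -
  interpret PF: product_sigma_finite "\<lambda>_. M" by standard
  interpret N: prob_space "density M g" by fact
  interpret PN: product_sigma_finite "\<lambda>_. density M g" by standard
  show ?thesis
  proof (rule PN.PiM_eqI[symmetric])
    show "sets (density (PiM {..<n} (\<lambda>_. M)) (\<lambda>x. \<Prod>i<n. g (x i))) = sets (PiM {..<n} (\<lambda>_. density M g))"
      by (simp cong: sets_PiM_cong)
    fix A assume "\<And>i. i \<in> {..<n} \<Longrightarrow> A i \<in> sets (density M g)"
    then have A: "A i \<in> sets M" if "i < n" for i using that by auto
    have AP: "Pi\<^sub>E {..<n} A \<in> sets (PiM {..<n} (\<lambda>_. M))" using A by (intro sets_PiM_I_finite) auto
    have "emeasure (density (PiM {..<n} (\<lambda>_. M)) (\<lambda>x. \<Prod>i<n. g (x i))) (Pi\<^sub>E {..<n} A)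
        = (\<integral>\<^sup>+x. (\<Prod>i<n. g (x i)) * indicator (Pi\<^sub>E {..<n} A) x \<partial>PiM {..<n} (\<lambda>_. M))"
      by (rule emeasure_density) (use AP in auto)
    also have "\<dots> = (\<integral>\<^sup>+x. (\<Prod>i<n. g (x i) * indicator (A i) (x i)) \<partial>PiM {..<n} (\<lambda>_. M))"
    proof (rule nn_integral_cong)
      fix x assume x: "x \<in> space (PiM {..<n} (\<lambda>_. M))"
      have "indicator (Pi\<^sub>E {..<n} A) x = (\<Prod>i<n. indicator (A i) (x i) :: ennreal)"
      proof (cases "x \<in> Pi\<^sub>E {..<n} A")
        case True then show ?thesis by (auto simp: PiE_iff)
      next
        case False
        then obtain i where "i < n" "x i \<notin> A i" using x by (auto simp: PiE_iff space_PiM)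
        then show ?thesis using False by (auto simp: prod_zero_iff indicator_def)
      qed
      then show "(\<Prod>i<n. g (x i)) * indicator (Pi\<^sub>E {..<n} A) x = (\<Prod>i<n. g (x i) * indicator (A i) (x i))"
        by (simp add: prod.distrib)
    qed
    also have "\<dots> = (\<Prod>i<n. \<integral>\<^sup>+x. g x * indicator (A i) x \<partial>M)"
      by (rule PF.product_nn_integral_prod) (use A in auto)
    also have "\<dots> = (\<Prod>i<n. emeasure (density M g) (A i))"
      by (intro prod.cong refl emeasure_density[symmetric]) (use A in auto)
    finally show "emeasure (density (PiM {..<n} (\<lambda>_. M)) (\<lambda>x. \<Prod>i<n. g (x i))) (Pi\<^sub>E {..<n} A)
      = (\<Prod>i<n. emeasure (density M g) (A i))" .
  qed simp
qed

end

section \<open>Inclusions among the cones, and limits of L2 pairings\<close>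

context compact_prob_space
begin

lemma AE_pair_fst: "AE x in M. Q x \<Longrightarrow> AE p in M \<Otimes>\<^sub>M M. Q (fst p)"
  by (rule AE_distrD[of fst _ M]) (simp, simp only: distr_pair_fst)

lemma distr_swap: "distr (M \<Otimes>\<^sub>M M) (M \<Otimes>\<^sub>M M) (\<lambda>p. (snd p, fst p)) = M \<Otimes>\<^sub>M M"
  using P.distr_pair_swap by (simp add: case_prod_beta')

lemma AE_pair_swap: "AE p in M \<Otimes>\<^sub>M M. Q p \<Longrightarrow> AE p in M \<Otimes>\<^sub>M M. Q (snd p, fst p)"
  by (rule AE_distrD[of "\<lambda>p. (snd p, fst p)" _ "M \<Otimes>\<^sub>M M"]) (simp, simp only: distr_swap)

lemma AE_pair_snd: "AE x in M. Q x \<Longrightarrow> AE p in M \<Otimes>\<^sub>M M. Q (snd p)"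
  using AE_pair_swap[OF AE_pair_fst] by simp

lemma tensor_L2:
  assumes "f \<in> L2 M" "g \<in> L2 M"
  shows "(\<lambda>p. f (fst p) * g (snd p)) \<in> L2 (M \<Otimes>\<^sub>M M)"
proof -
  have [measurable]: "f \<in> borel_measurable M" "g \<in> borel_measurable M"
    and i: "integrable M (\<lambda>x. (f x)\<^sup>2)" "integrable M (\<lambda>x. (g x)\<^sup>2)" using assms by (auto simp: L2_def)
  have "integrable (M \<Otimes>\<^sub>M M) (\<lambda>p. (f (fst p))\<^sup>2 * (g (snd p))\<^sup>2)"
    by (rule P.Fubini_integrable) (use i in \<open>auto simp: abs_mult\<close>)
  then show ?thesis by (simp add: L2_def power_mult_distrib)
qed

lemma kernel_quadratic_form:
  assumes "A \<in> L2 (M \<Otimes>\<^sub>M M)" "f \<in> L2 M"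
  shows "L2_inner M (kernel_op M A f) f = (\<integral>p. A p * (f (fst p) * f (snd p)) \<partial>(M \<Otimes>\<^sub>M M))"
proof -
  have i: "integrable (M \<Otimes>\<^sub>M M) (\<lambda>p. A p * (f (fst p) * f (snd p)))"
    by (intro L2_mult_integrable assms tensor_L2)
  have "L2_inner M (kernel_op M A f) f = (\<integral>x. (\<integral>y. A (x, y) * (f x * f y) \<partial>M) \<partial>M)"
    unfolding L2_inner_def kernel_op_def
    by (intro Bochner_Integration.integral_cong refl) (simp flip: integral_mult_right_zero add: mult_ac)
  also have "\<dots> = (\<integral>p. A p * (f (fst p) * f (snd p)) \<partial>(M \<Otimes>\<^sub>M M))"
    using P.integral_fst'[OF i] by simp
  finally show ?thesis .
qed

text \<open>
  If \<open>X\<^sub>0, \<dots>, X\<^sub>r\<^sub>+\<^sub>1\<close> are independent with density proportional to \<open>f\<close>, then the expectation of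
  the nonnegative sum of the \<open>A (X\<^sub>i, X\<^sub>j)\<close> is a positive multiple of the quadratic form of \<open>A\<close> at \<open>f\<close>.
\<close>

lemma C_cone_subset_COP: "C_cone r M \<subseteq> COP M"
proof
  fix A assume A0: "A \<in> C_cone r M"
  define n where "n = r + 2"
  have A: "A \<in> L2_sym M" "AE x in PiM {..<n} (\<lambda>_. M). 0 \<le> offdiag_sum n A x"
    using A0 unfolding C_cone_iff n_def by blast+
  then have AL2: "A \<in> L2 (M \<Otimes>\<^sub>M M)" and [measurable]: "A \<in> borel_measurable (M \<Otimes>\<^sub>M M)"
    by (auto simp: L2_sym_def L2_def)
  have "0 \<le> L2_inner M (kernel_op M A f) f" if f: "f \<in> L2 M" "AE x in M. 0 \<le> f x" for f
  proof -
    \<comment> \<open>\<open>f\<close> is nonnegative only almost everywhere, whereas the density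
      built from \<open>h\<close> is nonnegative everywhere.\<close>
    define h where "h x = max (f x) 0" for x
    have [measurable]: "f \<in> borel_measurable M" using f by (simp add: L2_def)
    have hm[measurable]: "h \<in> borel_measurable M" unfolding h_def by measurable
    have hf: "AE x in M. f x = h x" using f(2) by (auto simp: h_def)
    have h0: "0 \<le> h x" for x by (simp add: h_def)
    have hL2: "h \<in> L2 M"
    proof -
      have "integrable M (\<lambda>x. (h x)\<^sup>2)"
        by (rule Bochner_Integration.integrable_bound[of _ "\<lambda>x. (f x)\<^sup>2"])
           (use f(1) in \<open>auto simp: L2_def h_def max_def\<close>)
      then show ?thesis by (simp add: L2_def)
    qed
    have form: "L2_inner M (kernel_op M A f) f = (\<integral>p. A p * (h (fst p) * h (snd p)) \<partial>(M \<Otimes>\<^sub>M M))"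
      unfolding kernel_quadratic_form[OF AL2 f(1)]
      by (rule integral_cong_AE) (use AE_pair_fst[OF hf] AE_pair_snd[OF hf] in auto)
    have hint: "integrable M h"
      using L2_mult_integrable[OF hL2, of "\<lambda>_. 1"] by (simp add: L2_def)
    define c where "c = (\<integral>x. h x \<partial>M)"
    have c0: "0 \<le> c" unfolding c_def by (intro integral_nonneg_AE) (simp add: h0)
    show ?thesis
    proof (cases "c = 0")
      \<comment> \<open>Nothing can be normalized here, but \<open>h\<close> vanishes almost
        everywhere and so does the integrand of the form.\<close>
      case True
      then have "AE x in M. h x = 0"
        using integral_nonneg_eq_0_iff_AE[OF hint] h0 by (simp add: c_def)
      from AE_pair_fst[OF this] have "(\<integral>p. A p * (h (fst p) * h (snd p)) \<partial>(M \<Otimes>\<^sub>M M)) = 0"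
        by (intro integral_eq_zero_AE) auto
      then show ?thesis using form by simp
    next
      case False
      with c0 have c: "c > 0" by simp
      define g where "g x = h x / c" for x
      have g0: "0 \<le> g x" for x using h0 c by (simp add: g_def)
      have [measurable]: "g \<in> borel_measurable M" unfolding g_def by measurable
      define N where "N = density M (\<lambda>x. ennreal (g x))"
      have gint: "integrable M g" "(\<integral>x. g x \<partial>M) = 1" using hint c by (auto simp: g_def[abs_def] c_def)
      have "prob_space N"
      proof
        have "emeasure N (space N) = (\<integral>\<^sup>+x. ennreal (g x) \<partial>M)"
          unfolding N_def by (simp add: emeasure_density)
        also have "\<dots> = 1" using nn_integral_eq_integral[OF gint(1)] g0 gint(2) by simp
        finally show "emeasure N (space N) = 1" .
      qed
      then interpret N: prob_space N .
      have NN: "N \<Otimes>\<^sub>M N = density (M \<Otimes>\<^sub>M M) (\<lambda>p. ennreal (g (fst p) * g (snd p)))"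
        unfolding N_def using N.sigma_finite_measure_axioms sigma_finite_measure_axioms
        by (subst pair_measure_density) (auto simp: N_def g0 ennreal_mult case_prod_beta')
      have "AE x in density (PiM {..<n} (\<lambda>_. M)) (\<lambda>x. \<Prod>i<n. ennreal (g (x i))). 0 \<le> offdiag_sum n A x"
        using A(2) by (subst AE_density) (auto simp: elim: eventually_mono)
      moreover have "PiM {..<n} (\<lambda>_. N) = density (PiM {..<n} (\<lambda>_. M)) (\<lambda>x. \<Prod>i<n. ennreal (g (x i)))"
        unfolding N_def by (rule PiM_density) (use N.prob_space_axioms in \<open>simp_all add: N_def\<close>)
      ultimately have "AE x in PiM {..<n} (\<lambda>_. N). 0 \<le> offdiag_sum n A x" by (simp only:)
      then have 1: "0 \<le> (\<integral>x. offdiag_sum n A x \<partial>PiM {..<n} (\<lambda>_. N))" by (rule integral_nonneg_AE)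
      have gg: "(\<lambda>p. g (fst p) * g (snd p)) = (\<lambda>p. h (fst p) * h (snd p) / c\<^sup>2)"
        by (auto simp: g_def power2_eq_square)
      have "integrable (M \<Otimes>\<^sub>M M) (\<lambda>p. (g (fst p) * g (snd p)) * A p)"
        using L2_mult_integrable[OF AL2 tensor_L2[OF hL2 hL2]] by (simp add: g_def mult_ac power2_eq_square)
      then have "integrable (N \<Otimes>\<^sub>M N) A"
        unfolding NN by (subst integrable_density) (auto simp: g0)
      note 2 = N.integral_offdiag_sum[OF this, of n]
      have n: "0 < real (n * (n - 1))" unfolding of_nat_0_less_iff by (simp add: n_def)
      have "0 \<le> (\<integral>p. A p \<partial>(N \<Otimes>\<^sub>M N))"
        using 1 n zero_le_mult_iff[of "real (n * (n - 1))" "\<integral>p. A p \<partial>(N \<Otimes>\<^sub>M N)"] unfolding 2 by linarith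
      also have "\<dots> = (\<integral>p. (g (fst p) * g (snd p)) * A p \<partial>(M \<Otimes>\<^sub>M M))"
        unfolding NN by (subst integral_density) (auto simp: g0)
      also have "\<dots> = (\<integral>p. A p * (h (fst p) * h (snd p)) \<partial>(M \<Otimes>\<^sub>M M)) / c\<^sup>2"
        by (simp add: g_def mult_ac power2_eq_square)
      finally have "0 \<le> (\<integral>p. A p * (h (fst p) * h (snd p)) \<partial>(M \<Otimes>\<^sub>M M))"
        using c by (simp add: zero_le_divide_iff)
      then show ?thesis using form by simp
    qed
  qed
  then show "A \<in> COP M" using A(1) by (simp add: COP_def)
qed

lemma dual_cone_antimono: "C \<subseteq> D \<Longrightarrow> dual_cone M D \<subseteq> dual_cone M C"
  by (auto simp: dual_cone_def)

lemma CP_subset_C_dual: "CP M \<subseteq> C_dual r M"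
  unfolding CP_def C_dual_def by (intro dual_cone_antimono C_cone_subset_COP)

lemma C_dual_antimono: "r \<le> s \<Longrightarrow> C_dual s M \<subseteq> C_dual r M"
  unfolding C_dual_def by (rule dual_cone_antimono, rule lift_Suc_mono_le[of "\<lambda>r. C_cone r M", OF C_cone_Suc])

text \<open>The form at \<open>h\<close> is a square, so \<open>f\<close> may change sign. Pairing
  with these kernels is what makes completely positive kernels positive semidefinite.\<close>

lemma tensor_COP:
  assumes "f \<in> L2 M"
  shows "(\<lambda>p. f (fst p) * f (snd p)) \<in> COP M"
proof -
  let ?F = "\<lambda>p. f (fst p) * f (snd p)"
  have F: "?F \<in> L2 (M \<Otimes>\<^sub>M M)" by (rule tensor_L2[OF assms assms])
  have "0 \<le> L2_inner M (kernel_op M ?F h) h" if "h \<in> L2 M" for h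
  proof -
    have "L2_inner M (kernel_op M ?F h) h = (\<integral>x. f x * h x \<partial>M) * (\<integral>x. f x * h x \<partial>M)"
      unfolding L2_inner_def kernel_op_def
      by (simp flip: integral_mult_right_zero integral_mult_left_zero add: mult_ac)
    then show ?thesis by simp
  qed
  then show ?thesis using F by (simp add: COP_def L2_sym_def mult.commute case_prod_beta')
qed

lemma CP_subset_PSD: "CP M \<subseteq> PSD M"
proof
  fix A assume A: "A \<in> CP M"
  then have "A \<in> L2_sym M" by (simp add: CP_def dual_cone_def)
  moreover have "0 \<le> L2_inner M (kernel_op M A f) f" if "f \<in> L2 M" for f
    using A tensor_COP[OF that] kernel_quadratic_form[OF _ that, of A] \<open>A \<in> L2_sym M\<close>
    by (auto simp: CP_def dual_cone_def L2_sym_def L2_inner_def)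
  ultimately show "A \<in> PSD M" by (simp add: PSD_def)
qed

lemma bdd_L2: "f \<in> bdd_measurable \<Longrightarrow> f \<in> L2 M"
  using bdd_integrable[OF bdd_mult[of f f]] by (auto simp: L2_def bdd_measurable_def power2_eq_square)

lemma L2_bdd2:
  assumes "F \<in> borel_measurable (M \<Otimes>\<^sub>M M)" "\<And>p. \<bar>F p\<bar> \<le> C"
  shows "F \<in> L2 (M \<Otimes>\<^sub>M M)"
proof -
  have "\<bar>(F p)\<^sup>2\<bar> \<le> C\<^sup>2" for p using power_mono[OF assms(2)[of p], of 2] by simp
  then have "integrable (M \<Otimes>\<^sub>M M) (\<lambda>p. (F p)\<^sup>2)" using assms(1) by (intro integrable_bdd2) auto
  then show ?thesis using assms(1) by (simp add: L2_def)
qed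

lemma kernel_L2:
  assumes "continuous_on UNIV A"
  shows "A \<in> L2 (M \<Otimes>\<^sub>M M)"
proof -
  obtain C where "\<And>p. \<bar>A p\<bar> \<le> C" using kernel_bounded[OF assms] by blast
  then show ?thesis by (intro L2_bdd2 kernel_measurable assms)
qed

lemma kernel_L2_sym: "continuous_on UNIV A \<Longrightarrow> (\<And>x y. A (x, y) = A (y, x)) \<Longrightarrow> A \<in> L2_sym M"
  using kernel_L2[of A] by (auto simp: L2_sym_def)

lemma L2_imp_integrable: "F \<in> L2 (M \<Otimes>\<^sub>M M) \<Longrightarrow> integrable (M \<Otimes>\<^sub>M M) F"
  using L2_mult_integrable[of F "M \<Otimes>\<^sub>M M" "\<lambda>_. 1"] L2_bdd2[of "\<lambda>_. 1" 1] by simp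

text \<open>Cauchy-Schwarz, in the form of a weighted inequality between arithmetic and geometric
  means.\<close>

lemma L2_inner_tendsto:
  assumes F: "\<And>n. continuous_on UNIV (F n)" and B: "continuous_on UNIV B" and Z: "Z \<in> L2 (M \<Otimes>\<^sub>M M)"
    and lim: "(\<lambda>n. \<integral>p. (F n p - B p)\<^sup>2 \<partial>(M \<Otimes>\<^sub>M M)) \<longlonglongrightarrow> 0"
  shows "(\<lambda>n. L2_inner (M \<Otimes>\<^sub>M M) (F n) Z) \<longlonglongrightarrow> L2_inner (M \<Otimes>\<^sub>M M) B Z"
proof (rule LIMSEQ_I)
  fix \<epsilon> :: real assume \<epsilon>: "\<epsilon> > 0"
  define z where "z = (\<integral>p. (Z p)\<^sup>2 \<partial>(M \<Otimes>\<^sub>M M))"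
  have z0: "0 \<le> z" by (simp add: z_def)
  \<comment> \<open>The weight comes first and keeps the share of \<open>Z\<close> at most
    \<open>\<epsilon> / 2\<close>; \<open>n0\<close> is chosen afterwards, depending on it, to bring
    the other share below \<open>\<epsilon> / 2\<close>.\<close>
  define s where "s = (z + 1) / \<epsilon>"
  have s: "s > 0" using z0 \<epsilon> by (simp add: s_def)
  have zs: "z / s \<le> \<epsilon>" using z0 \<epsilon> by (simp add: s_def field_simps)
  have "0 < \<epsilon> / s" using \<epsilon> s by simp
  then obtain n0 where n0: "\<And>n. n \<ge> n0 \<Longrightarrow> (\<integral>p. (F n p - B p)\<^sup>2 \<partial>(M \<Otimes>\<^sub>M M)) < \<epsilon> / s"
    using LIMSEQ_D[OF lim] by fastforce
  have "norm (L2_inner (M \<Otimes>\<^sub>M M) (F n) Z - L2_inner (M \<Otimes>\<^sub>M M) B Z) < \<epsilon>" if "n \<ge> n0" for n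
  proof -
    note FL = kernel_L2[OF F[of n]] and BL = kernel_L2[OF B]
    have DL: "(\<lambda>p. F n p - B p) \<in> L2 (M \<Otimes>\<^sub>M M)" by (intro kernel_L2 continuous_on_diff F B)
    have i: "integrable (M \<Otimes>\<^sub>M M) (\<lambda>p. (F n p - B p)\<^sup>2)" "integrable (M \<Otimes>\<^sub>M M) (\<lambda>p. (Z p)\<^sup>2)"
      using DL Z by (auto simp: L2_def)
    have "L2_inner (M \<Otimes>\<^sub>M M) (F n) Z - L2_inner (M \<Otimes>\<^sub>M M) B Z = (\<integral>p. (F n p - B p) * Z p \<partial>(M \<Otimes>\<^sub>M M))"
      unfolding L2_inner_def using L2_mult_integrable[OF FL Z] L2_mult_integrable[OF BL Z]
      by (simp add: left_diff_distrib)
    also have "\<bar>\<dots>\<bar> \<le> (\<integral>p. s / 2 * (F n p - B p)\<^sup>2 + 1 / (2 * s) * (Z p)\<^sup>2 \<partial>(M \<Otimes>\<^sub>M M))"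
    proof (rule order_trans[OF integral_abs_bound integral_mono])
      fix p
      have "\<bar>a * b\<bar> \<le> s / 2 * a\<^sup>2 + 1 / (2 * s) * b\<^sup>2" for a b :: real
      proof -
        have "0 \<le> (s * \<bar>a\<bar> - \<bar>b\<bar>)\<^sup>2 / (2 * s)" using s by simp
        also have "\<dots> = s / 2 * \<bar>a\<bar>\<^sup>2 + 1 / (2 * s) * \<bar>b\<bar>\<^sup>2 - \<bar>a\<bar> * \<bar>b\<bar>"
          using s by (simp add: power2_diff field_simps power2_eq_square del: abs_mult_self_eq)
        finally show ?thesis by (simp add: abs_mult)
      qed
      then show "\<bar>(F n p - B p) * Z p\<bar> \<le> s / 2 * (F n p - B p)\<^sup>2 + 1 / (2 * s) * (Z p)\<^sup>2" .
    qed (use i L2_mult_integrable[OF DL Z] in auto)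
    also have "\<dots> = s / 2 * (\<integral>p. (F n p - B p)\<^sup>2 \<partial>(M \<Otimes>\<^sub>M M)) + z / s / 2"
      unfolding z_def using i by simp
    also have "\<dots> < s / 2 * (\<epsilon> / s) + \<epsilon> / 2"
      using n0[OF that] s zs by (intro add_less_le_mono mult_strict_left_mono) auto
    also have "\<dots> = \<epsilon>" using s by simp
    finally show ?thesis by simp
  qed
  then show "\<exists>n0. \<forall>n\<ge>n0. norm (L2_inner (M \<Otimes>\<^sub>M M) (F n) Z - L2_inner (M \<Otimes>\<^sub>M M) B Z) < \<epsilon>" by blast
qed

end

section \<open>Averages of copositive kernels over the cells of a partition\<close>

context compact_prob_space
begin

context
  fixes c :: "'v \<Rightarrow> 'v" and Z :: "'v \<times> 'v \<Rightarrow> real"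
  assumes c_meas[measurable]: "c \<in> M \<rightarrow>\<^sub>M count_space UNIV" and c_fin: "finite (range c)"
    and Z: "Z \<in> COP M"
begin

definition cell_ind :: "'v \<Rightarrow> 'v \<Rightarrow> real" where
  "cell_ind p = indicator (c -` {p})"

definition cell_integral :: "'v \<Rightarrow> 'v \<Rightarrow> real" where
  "cell_integral p q = (\<integral>w. Z w * (cell_ind p (fst w) * cell_ind q (snd w)) \<partial>(M \<Otimes>\<^sub>M M))"

text \<open>The mean over a cell of measure zero is 0, as division by zero gives 0.\<close>

definition cell_mean :: "'v \<Rightarrow> 'v \<Rightarrow> real" where
  "cell_mean p q = cell_integral p q / (measure M (c -` {p}) * measure M (c -` {q}))"

text \<open>The conditional expectation of \<open>Z\<close> given the partition of the product into
  rectangles of cells.\<close>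

definition cell_average :: "'v \<times> 'v \<Rightarrow> real" where
  "cell_average w = cell_mean (c (fst w)) (c (snd w))"

lemma cell_sets[measurable]: "c -` {p} \<in> sets M"
  using measurable_sets[OF c_meas, of "{p}"] by simp

lemma cell_ind_bdd: "cell_ind p \<in> bdd_measurable"
  unfolding bdd_measurable_def cell_ind_def by (auto intro!: exI[of _ 1] simp: indicator_def)

lemma cell_ind_measurable[measurable]: "cell_ind p \<in> borel_measurable M"
  using cell_ind_bdd bddE by metis

lemma cell_ind_integral: "(\<integral>x. cell_ind p x \<partial>M) = measure M (c -` {p})"
  using cell_sets by (simp add: cell_ind_def)

lemma Z_L2: "Z \<in> L2 (M \<Otimes>\<^sub>M M)"
  using Z by (simp add: COP_def L2_sym_def)

lemma cell_integrable:
  assumes "F \<in> L2 (M \<Otimes>\<^sub>M M)"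
  shows "integrable (M \<Otimes>\<^sub>M M) (\<lambda>w. F w * (cell_ind p (fst w) * cell_ind q (snd w)))"
  by (intro L2_mult_integrable assms tensor_L2 bdd_L2 cell_ind_bdd)

lemma integral_label_expand:
  assumes "F \<in> L2 (M \<Otimes>\<^sub>M M)"
  shows "(\<integral>w. h (c (fst w)) (c (snd w)) * F w \<partial>(M \<Otimes>\<^sub>M M))
    = (\<Sum>p\<in>range c. \<Sum>q\<in>range c. h p q * (\<integral>w. F w * (cell_ind p (fst w) * cell_ind q (snd w)) \<partial>(M \<Otimes>\<^sub>M M)))"
proof -
  have "h (c x) (c y) * F (x, y) = (\<Sum>p\<in>range c. \<Sum>q\<in>range c. h p q * (F (x, y) * (cell_ind p x * cell_ind q y)))" for x y
  proof -
    have "(\<Sum>q\<in>range c. h p q * (F (x, y) * (cell_ind p x * cell_ind q y))) = (if p = c x then h p (c y) * F (x, y) else 0)" for p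
    proof -
      have "h p q * (F (x, y) * (cell_ind p x * cell_ind q y)) = (if q = c y then (if p = c x then h p q * F (x, y) else 0) else 0)" for q
        by (auto simp: cell_ind_def indicator_def)
      then show ?thesis using c_fin by (simp add: sum.delta)
    qed
    then show ?thesis using c_fin by (simp add: sum.delta)
  qed
  then have "(\<integral>w. h (c (fst w)) (c (snd w)) * F w \<partial>(M \<Otimes>\<^sub>M M))
      = (\<integral>w. (\<Sum>p\<in>range c. \<Sum>q\<in>range c. h p q * (F w * (cell_ind p (fst w) * cell_ind q (snd w)))) \<partial>(M \<Otimes>\<^sub>M M))"
    by (intro Bochner_Integration.integral_cong refl) (simp only: split_paired_all fst_conv snd_conv)
  also have "\<dots> = (\<Sum>p\<in>range c. \<Sum>q\<in>range c. h p q * (\<integral>w. F w * (cell_ind p (fst w) * cell_ind q (snd w)) \<partial>(M \<Otimes>\<^sub>M M)))"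
    using cell_integrable[OF assms] by simp
  finally show ?thesis .
qed

lemma cell_average_measurable[measurable]: "cell_average \<in> borel_measurable (M \<Otimes>\<^sub>M M)"
  unfolding cell_average_def[abs_def] by (rule measurable_label_pair[OF c_meas c_fin])

lemma cell_mean_bounded: obtains K where "K \<ge> 0" "\<And>x y. \<bar>cell_mean (c x) (c y)\<bar> \<le> K"
proof -
  let ?V = "(\<lambda>(p, q). \<bar>cell_mean p q\<bar>) ` (range c \<times> range c)"
  have f: "finite ?V" using c_fin by simp
  have "\<bar>cell_mean (c x) (c y)\<bar> \<le> Max ?V" for x y using f by (intro Max_ge) auto
  then show ?thesis using that by (meson abs_ge_zero order_trans)
qed

lemma cell_average_L2: "cell_average \<in> L2 (M \<Otimes>\<^sub>M M)"
  by (rule cell_mean_bounded, rule L2_bdd2) (auto simp: cell_average_def)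

lemma cell_mean_sym: "cell_mean p q = cell_mean q p"
proof -
  have [measurable]: "Z \<in> borel_measurable (M \<Otimes>\<^sub>M M)" using Z_L2 by (simp add: L2_def)
  have sym: "AE w in M \<Otimes>\<^sub>M M. Z w = Z (snd w, fst w)"
    using Z by (simp add: COP_def L2_sym_def case_prod_beta')
  have "cell_integral p q = (\<integral>w. Z (snd w, fst w) * (cell_ind p (fst w) * cell_ind q (snd w)) \<partial>(M \<Otimes>\<^sub>M M))"
    unfolding cell_integral_def by (rule integral_cong_AE) (use sym in auto)
  also have "\<dots> = (\<integral>w. Z w * (cell_ind p (snd w) * cell_ind q (fst w)) \<partial>distr (M \<Otimes>\<^sub>M M) (M \<Otimes>\<^sub>M M) (\<lambda>w. (snd w, fst w)))"
    by (subst integral_distr) auto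
  also have "\<dots> = cell_integral q p" unfolding distr_swap cell_integral_def by (simp add: mult.commute)
  finally show ?thesis by (simp add: cell_mean_def mult.commute)
qed

lemma integral_cell_average:
  "(\<integral>w. h (c (fst w)) (c (snd w)) * cell_average w \<partial>(M \<Otimes>\<^sub>M M)) = (\<integral>w. h (c (fst w)) (c (snd w)) * Z w \<partial>(M \<Otimes>\<^sub>M M))"
proof -
  have "(\<integral>w. cell_average w * (cell_ind p (fst w) * cell_ind q (snd w)) \<partial>(M \<Otimes>\<^sub>M M)) = cell_integral p q" for p q
  proof -
    have on_cell: "cell_average w * (cell_ind p (fst w) * cell_ind q (snd w)) = cell_mean p q * (cell_ind p (fst w) * cell_ind q (snd w))" for w
      by (auto simp: cell_average_def cell_ind_def indicator_def)
    have "(\<integral>w. cell_average w * (cell_ind p (fst w) * cell_ind q (snd w)) \<partial>(M \<Otimes>\<^sub>M M))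
        = cell_mean p q * (measure M (c -` {p}) * measure M (c -` {q}))"
      unfolding on_cell
      using integral_tensor[OF cell_ind_bdd cell_ind_bdd, of p q] by (simp add: cell_ind_integral)
    also have "\<dots> = cell_integral p q"
    proof (cases "measure M (c -` {p}) = 0 \<or> measure M (c -` {q}) = 0")
      \<comment> \<open>The default mean 0 is consistent: the integral of \<open>Z\<close> over a
        rectangle with a null side vanishes as well.\<close>
      case True
      have null: "AE x in M. cell_ind r x = 0" if "measure M (c -` {r}) = 0" for r
        using AE_not_in[of "c -` {r}" M] that cell_sets
        by (auto simp: null_sets_def emeasure_eq_measure cell_ind_def indicator_def elim: eventually_mono)
      have "AE w in M \<Otimes>\<^sub>M M. cell_ind p (fst w) = 0 \<or> cell_ind q (snd w) = 0"
        using True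
      proof
        assume "measure M (c -` {p}) = 0"
        from AE_pair_fst[OF null[OF this]] show ?thesis by (auto elim: eventually_mono)
      next
        assume "measure M (c -` {q}) = 0"
        from AE_pair_snd[OF null[OF this]] show ?thesis by (auto elim: eventually_mono)
      qed
      then have "cell_integral p q = 0"
        unfolding cell_integral_def by (intro integral_eq_zero_AE) auto
      then show ?thesis using True by auto
    qed (simp add: cell_mean_def)
    finally show ?thesis .
  qed
  then show ?thesis
    unfolding integral_label_expand[OF cell_average_L2] integral_label_expand[OF Z_L2]
    by (simp add: cell_integral_def)
qed

text \<open>The sign of the mean is constant on rectangles of cells, so by
  \<open>integral_cell_average\<close> it may be integrated against \<open>Z\<close> instead of the
  average.\<close>

lemma cell_average_abs: "(\<integral>w. \<bar>cell_average w\<bar> \<partial>(M \<Otimes>\<^sub>M M)) \<le> (\<integral>w. \<bar>Z w\<bar> \<partial>(M \<Otimes>\<^sub>M M))"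
proof -
  let ?h = "\<lambda>p q. sgn (cell_mean p q)"
  have hL2: "(\<lambda>w. ?h (c (fst w)) (c (snd w))) \<in> L2 (M \<Otimes>\<^sub>M M)"
    by (rule L2_bdd2[where C=1], rule measurable_label_pair[OF c_meas c_fin]) (auto simp: sgn_if)
  have "(\<integral>w. \<bar>cell_average w\<bar> \<partial>(M \<Otimes>\<^sub>M M)) = (\<integral>w. ?h (c (fst w)) (c (snd w)) * cell_average w \<partial>(M \<Otimes>\<^sub>M M))"
    by (intro Bochner_Integration.integral_cong refl) (simp add: cell_average_def abs_sgn mult.commute)
  also have "\<dots> = (\<integral>w. ?h (c (fst w)) (c (snd w)) * Z w \<partial>(M \<Otimes>\<^sub>M M))"
    by (rule integral_cell_average)
  also have "\<dots> \<le> (\<integral>w. \<bar>Z w\<bar> \<partial>(M \<Otimes>\<^sub>M M))"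
    by (intro integral_mono L2_mult_integrable[OF hL2 Z_L2] integrable_abs L2_imp_integrable Z_L2)
       (auto simp: sgn_if)
  finally show ?thesis .
qed

text \<open>\<open>Z\<close> is tested on the sum of the normalized indicators of the cells of the
  points \<open>x i\<close>, repetitions included. A null cell contributes the zero function, in
  agreement with its mean 0.\<close>

lemma cell_mean_copositive: "0 \<le> (\<Sum>i<n. \<Sum>j<n::nat. cell_mean (c (x i)) (c (x j)))"
proof -
  define u where "u p = (\<lambda>y. cell_ind p y / measure M (c -` {p}))" for p
  define f where "f y = (\<Sum>i<n::nat. u (c (x i)) y)" for y
  have uL2: "u p \<in> L2 M" for p
    using bdd_L2[OF cell_ind_bdd[of p]] by (auto simp: L2_def u_def power_divide)
  have "f \<in> bdd_measurable"
  proof -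
    have "f \<in> borel_measurable M" unfolding f_def u_def by measurable
    moreover have "\<bar>f y\<bar> \<le> (\<Sum>i<n. 1 / measure M (c -` {c (x i)}))" for y
      unfolding f_def
      by (rule order_trans[OF sum_abs sum_mono]) (auto simp: u_def cell_ind_def indicator_def)
    ultimately show ?thesis by (auto simp: bdd_measurable_def)
  qed
  then have fL2: "f \<in> L2 M" by (rule bdd_L2)
  have "0 \<le> f y" for y unfolding f_def u_def by (intro sum_nonneg) (simp add: cell_ind_def)
  then have "0 \<le> L2_inner M (kernel_op M Z f) f" using Z fL2 by (simp add: COP_def)
  also have "\<dots> = (\<integral>w. (\<Sum>i<n. \<Sum>j<n. Z w * (u (c (x i)) (fst w) * u (c (x j)) (snd w))) \<partial>(M \<Otimes>\<^sub>M M))"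
    unfolding kernel_quadratic_form[OF Z_L2 fL2] f_def sum_product by (simp only: sum_distrib_left)
  also have "\<dots> = (\<Sum>i<n. \<Sum>j<n. \<integral>w. Z w * (u (c (x i)) (fst w) * u (c (x j)) (snd w)) \<partial>(M \<Otimes>\<^sub>M M))"
    by (simp add: L2_mult_integrable[OF Z_L2 tensor_L2[OF uL2 uL2]])
  also have "\<dots> = (\<Sum>i<n. \<Sum>j<n. cell_mean (c (x i)) (c (x j)))"
    by (simp add: u_def cell_mean_def cell_integral_def)
  finally show ?thesis .
qed

text \<open>
  Copositivity only fails to give nonnegativity of the sum over pairs \<open>i \<noteq> j\<close> by the \<open>n\<close> diagonal terms,
  which are dominated by the \<open>n * (n - 1)\<close> terms coming from a small multiple of the constant kernel.
\<close>

lemma cell_average_in_C_cone: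
  assumes "\<epsilon> > 0"
  obtains r where "(\<lambda>w. cell_average w + \<epsilon>) \<in> C_cone r M"
proof -
  obtain K where K: "K \<ge> 0" "\<And>x y. \<bar>cell_mean (c x) (c y)\<bar> \<le> K" using cell_mean_bounded by blast
  \<comment> \<open>The \<open>n\<close> diagonal terms cost at most \<open>n * K\<close>, and
    \<open>n - 1 > r\<close> makes the gain \<open>n * (n - 1) * \<epsilon>\<close> at least as
    large.\<close>
  obtain r :: nat where r: "K / \<epsilon> < r" using reals_Archimedean2 by blast
  define n where "n = r + 2"
  have "0 \<le> offdiag_sum n (\<lambda>w. cell_average w + \<epsilon>) x" for x
  proof -
    let ?m = "\<lambda>i j. cell_mean (c (x i)) (c (x j))"
    have "(\<Sum>i<n. \<Sum>j<n. ?m i j) = (\<Sum>p\<in>{..<n} \<times> {..<n}. ?m (fst p) (snd p))"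
      by (simp add: sum.cartesian_product case_prod_beta')
    also have "{..<n} \<times> {..<n} = offdiag n \<union> (\<lambda>i. (i, i)) ` {..<n}" by (auto simp: offdiag_def)
    also have "(\<Sum>p\<in>offdiag n \<union> (\<lambda>i. (i, i)) ` {..<n}. ?m (fst p) (snd p))
        = (\<Sum>p\<in>offdiag n. ?m (fst p) (snd p)) + (\<Sum>i<n. ?m i i)"
      by (subst sum.union_disjoint) (auto simp: sum.reindex inj_on_def, auto simp: offdiag_def)
    finally have 1: "0 \<le> (\<Sum>p\<in>offdiag n. ?m (fst p) (snd p)) + (\<Sum>i<n. ?m i i)"
      using cell_mean_copositive[of x n] by simp
    have "(\<Sum>i<n. ?m i i) \<le> (\<Sum>i<n. K)" by (intro sum_mono) (use K(2) in \<open>simp add: abs_le_iff\<close>)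
    then have 2: "(\<Sum>i<n. ?m i i) \<le> real n * K" by simp
    have 3: "offdiag_sum n (\<lambda>w. cell_average w + \<epsilon>) x = (\<Sum>p\<in>offdiag n. ?m (fst p) (snd p)) + real (n * (n - 1)) * \<epsilon>"
      by (simp add: offdiag_sum_def case_prod_beta' cell_average_def sum.distrib card_offdiag)
    have "K \<le> real r * \<epsilon>" using r assms by (simp add: field_simps)
    also have "\<dots> \<le> real (n - 1) * \<epsilon>" using assms by (intro mult_right_mono) (auto simp: n_def)
    finally have "real n * K \<le> real (n * (n - 1)) * \<epsilon>"
      by (simp add: mult_left_mono mult.assoc del: of_nat_diff)
    with 1 2 3 show ?thesis by linarith
  qed
  moreover have "(\<lambda>w. cell_average w + \<epsilon>) \<in> L2_sym M"
  proof -
    have "(\<lambda>w. cell_average w + \<epsilon>) \<in> L2 (M \<Otimes>\<^sub>M M)"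
    proof (rule L2_bdd2)
      show "\<bar>cell_average w + \<epsilon>\<bar> \<le> K + \<epsilon>" for w
        using K(2)[of "fst w" "snd w"] assms by (simp add: cell_average_def)
    qed measurable
    then show ?thesis by (auto simp: L2_sym_def cell_average_def cell_mean_sym)
  qed
  ultimately show ?thesis using that[of r] by (simp add: C_cone_iff n_def)
qed

end

text \<open>Only pairings are compared. \<open>A\<close> is uniformly close to a kernel
  \<open>B\<close> that is constant on rectangles of cells, and \<open>B\<close> pairs equally with
  \<open>Z\<close> and with the average of \<open>Z\<close>; the average lies in some
  \<open>C_cone\<close> up to an arbitrarily small constant.\<close>

lemma C_dual_Inter_continuous:
  assumes A: "continuous_on UNIV A" "\<And>r. A \<in> C_dual r M"
  shows "A \<in> CP M"
proof -
  have "0 \<le> L2_inner (M \<Otimes>\<^sub>M M) A Z" if Z: "Z \<in> COP M" for Z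
  proof (rule field_le_epsilon)
    fix d :: real assume d: "d > 0"
    have ZL2: "Z \<in> L2 (M \<Otimes>\<^sub>M M)" using Z by (simp add: COP_def L2_sym_def)
    have AL2: "A \<in> L2 (M \<Otimes>\<^sub>M M)" by (rule kernel_L2[OF A(1)])
    define z where "z = (\<integral>w. \<bar>Z w\<bar> \<partial>(M \<Otimes>\<^sub>M M))"
    have z0: "0 \<le> z" by (simp add: z_def)
    \<comment> \<open>\<open>A\<close> is exchanged for \<open>B\<close> twice, against
      \<open>Z\<close> and against its average, at a cost of at most \<open>\<delta> * z\<close>
      each time.\<close>
    define \<delta> where "\<delta> = d / (2 * (z + 1))"
    have \<delta>: "\<delta> > 0" using d z0 by (simp add: \<delta>_def)
    have "\<delta> * z * 2 \<le> \<delta> * (2 * (z + 1))" using \<delta> by (simp add: field_simps)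
    also have "\<dots> = d" using z0 by (simp add: \<delta>_def)
    finally have \<delta>z: "2 * (\<delta> * z) \<le> d" by (simp add: mult_ac)
    obtain c where c: "c \<in> M \<rightarrow>\<^sub>M count_space UNIV" "finite (range c)"
      "\<And>x y. \<bar>A (x, y) - A (c x, c y)\<bar> \<le> \<delta>" using kernel_step[OF A(1) \<delta>] by blast
    define ZP where "ZP = cell_average c Z"
    have ZPL2: "ZP \<in> L2 (M \<Otimes>\<^sub>M M)" unfolding ZP_def by (rule cell_average_L2[OF c(1,2) Z])
    have pos: "0 \<le> L2_inner (M \<Otimes>\<^sub>M M) A ZP"
    proof (rule field_le_epsilon)
      fix \<epsilon> :: real assume \<epsilon>: "\<epsilon> > 0"
      define a where "a = (\<integral>w. A w \<partial>(M \<Otimes>\<^sub>M M))"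
      define \<eta> where "\<eta> = \<epsilon> / (\<bar>a\<bar> + 1)"
      have \<eta>: "\<eta> > 0" using \<epsilon> by (simp add: \<eta>_def add_nonneg_pos)
      obtain r where "(\<lambda>w. cell_average c Z w + \<eta>) \<in> C_cone r M"
        using cell_average_in_C_cone[OF c(1,2) Z \<eta>] by blast
      then have "0 \<le> L2_inner (M \<Otimes>\<^sub>M M) A (\<lambda>w. ZP w + \<eta>)"
        using A(2)[of r] by (simp add: C_dual_def dual_cone_def ZP_def)
      also have "\<dots> = L2_inner (M \<Otimes>\<^sub>M M) A ZP + a * \<eta>"
        unfolding L2_inner_def a_def
        using L2_mult_integrable[OF AL2 ZPL2] L2_imp_integrable[OF AL2] by (simp add: distrib_left)
      also have "a * \<eta> \<le> (\<bar>a\<bar> + 1) * \<eta>" using \<eta> by (intro mult_right_mono) auto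
      also have "(\<bar>a\<bar> + 1) * \<eta> = \<epsilon>" by (simp add: \<eta>_def add_nonneg_pos)
      finally show "0 \<le> L2_inner (M \<Otimes>\<^sub>M M) A ZP + \<epsilon>" by simp
    qed
    define B where "B = (\<lambda>w. A (c (fst w), c (snd w)))"
    have BL2: "B \<in> L2 (M \<Otimes>\<^sub>M M)"
    proof -
      obtain C where "\<And>p. \<bar>A p\<bar> \<le> C" using kernel_bounded[OF A(1)] by blast
      then show ?thesis
        unfolding B_def
        using measurable_label_pair[OF c(1,2), of "\<lambda>x y. A (x, y)"] by (intro L2_bdd2[where C=C]) auto
    qed
    have close: "\<bar>L2_inner (M \<Otimes>\<^sub>M M) A F - L2_inner (M \<Otimes>\<^sub>M M) B F\<bar> \<le> \<delta> * (\<integral>w. \<bar>F w\<bar> \<partial>(M \<Otimes>\<^sub>M M))"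
      if F: "F \<in> L2 (M \<Otimes>\<^sub>M M)" for F
    proof -
      note i = L2_mult_integrable[OF AL2 F] L2_mult_integrable[OF BL2 F] L2_imp_integrable[OF F]
      have "L2_inner (M \<Otimes>\<^sub>M M) A F - L2_inner (M \<Otimes>\<^sub>M M) B F = (\<integral>w. A w * F w - B w * F w \<partial>(M \<Otimes>\<^sub>M M))"
        unfolding L2_inner_def using i by simp
      also have "\<bar>\<dots>\<bar> \<le> (\<integral>w. \<delta> * \<bar>F w\<bar> \<partial>(M \<Otimes>\<^sub>M M))"
      proof (rule order_trans[OF integral_abs_bound integral_mono])
        fix w
        have "\<bar>A w - B w\<bar> * \<bar>F w\<bar> \<le> \<delta> * \<bar>F w\<bar>"
          using c(3)[of "fst w" "snd w"] by (intro mult_right_mono) (auto simp: B_def)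
        then show "\<bar>A w * F w - B w * F w\<bar> \<le> \<delta> * \<bar>F w\<bar>"
          by (simp add: abs_mult flip: left_diff_distrib)
      qed (use i in auto)
      finally show ?thesis by simp
    qed
    have "L2_inner (M \<Otimes>\<^sub>M M) B ZP = L2_inner (M \<Otimes>\<^sub>M M) B Z"
      unfolding L2_inner_def B_def ZP_def
      using integral_cell_average[OF c(1,2) Z, of "\<lambda>x y. A (x, y)"] by simp
    moreover have "\<delta> * (\<integral>w. \<bar>ZP w\<bar> \<partial>(M \<Otimes>\<^sub>M M)) \<le> \<delta> * z"
      unfolding z_def ZP_def using cell_average_abs[OF c(1,2) Z] \<delta> by (intro mult_left_mono) auto
    ultimately show "0 \<le> L2_inner (M \<Otimes>\<^sub>M M) A Z + d"
      using pos close[OF ZPL2] close[OF ZL2] \<delta>z unfolding z_def by linarith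
  qed
  moreover have "A \<in> L2_sym M" using A(2)[of 0] by (simp add: C_dual_def dual_cone_def)
  ultimately show ?thesis by (simp add: CP_def dual_cone_def)
qed

end

section \<open>Measure-preserving maps acting on kernels\<close>

context homogeneous_prob_space
begin

lemma distr_pair_G:
  assumes "\<sigma> \<in> G"
  shows "distr (M \<Otimes>\<^sub>M M) (M \<Otimes>\<^sub>M M) (\<lambda>p. (\<sigma> (fst p), \<sigma> (snd p))) = M \<Otimes>\<^sub>M M"
proof -
  have "sigma_finite_measure (distr M M \<sigma>)" using G_distr[OF assms] sigma_finite_measure_axioms by simp
  from pair_measure_distr[OF G_measurable[OF assms] G_measurable[OF assms] this]
  show ?thesis using G_distr[OF assms] by (simp add: case_prod_beta')
qed

lemma pair_G_measurable[measurable]: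
  "\<sigma> \<in> G \<Longrightarrow> (\<lambda>p. (\<sigma> (fst p), \<sigma> (snd p))) \<in> M \<Otimes>\<^sub>M M \<rightarrow>\<^sub>M M \<Otimes>\<^sub>M M"
  using G_measurable[of \<sigma>] by measurable

lemma pair_integral_G:
  fixes F :: "'v \<times> 'v \<Rightarrow> real"
  assumes "\<sigma> \<in> G" "F \<in> borel_measurable (M \<Otimes>\<^sub>M M)"
  shows "(\<integral>p. F (\<sigma> (fst p), \<sigma> (snd p)) \<partial>(M \<Otimes>\<^sub>M M)) = (\<integral>p. F p \<partial>(M \<Otimes>\<^sub>M M))"
  using integral_distr[OF pair_G_measurable[OF assms(1)] assms(2)] distr_pair_G[OF assms(1)] by simp

lemma L2_pair_G:
  assumes "\<sigma> \<in> G" "F \<in> L2 (M \<Otimes>\<^sub>M M)"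
  shows "(\<lambda>p. F (\<sigma> (fst p), \<sigma> (snd p))) \<in> L2 (M \<Otimes>\<^sub>M M)"
proof -
  have [measurable]: "F \<in> borel_measurable (M \<Otimes>\<^sub>M M)" and i: "integrable (M \<Otimes>\<^sub>M M) (\<lambda>p. (F p)\<^sup>2)"
    using assms(2) by (auto simp: L2_def)
  have "integrable (distr (M \<Otimes>\<^sub>M M) (M \<Otimes>\<^sub>M M) (\<lambda>p. (\<sigma> (fst p), \<sigma> (snd p)))) (\<lambda>p. (F p)\<^sup>2)"
    using i distr_pair_G[OF assms(1)] by simp
  then have "integrable (M \<Otimes>\<^sub>M M) (\<lambda>p. (F (\<sigma> (fst p), \<sigma> (snd p)))\<^sup>2)"
    using pair_G_measurable[OF assms(1)] by (subst (asm) integrable_distr_eq) auto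
  moreover have "(\<lambda>p. F (\<sigma> (fst p), \<sigma> (snd p))) \<in> borel_measurable (M \<Otimes>\<^sub>M M)"
    using measurable_compose[OF pair_G_measurable[OF assms(1)], of F borel] by simp
  ultimately show ?thesis by (simp add: L2_def)
qed

lemma L2_G:
  assumes "\<sigma> \<in> G" "f \<in> L2 M"
  shows "(\<lambda>x. f (\<sigma> x)) \<in> L2 M"
proof -
  have [measurable]: "f \<in> borel_measurable M" and i: "integrable M (\<lambda>x. (f x)\<^sup>2)"
    using assms(2) by (auto simp: L2_def)
  have "integrable (distr M M \<sigma>) (\<lambda>x. (f x)\<^sup>2)" using i G_distr[OF assms(1)] by simp
  then have "integrable M (\<lambda>x. (f (\<sigma> x))\<^sup>2)"
    using G_measurable[OF assms(1)] by (subst (asm) integrable_distr_eq) auto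
  then show ?thesis using measurable_compose[OF G_measurable[OF assms(1)], of f borel] by (simp add: L2_def)
qed

text \<open>Moving all coordinates by the same \<open>\<sigma>\<close> preserves the product
  measure, so it preserves conditions that hold almost everywhere.\<close>

lemma C_cone_G:
  assumes \<sigma>: "\<sigma> \<in> G" and Z: "Z \<in> C_cone r M"
  shows "(\<lambda>p. Z (\<sigma> (fst p), \<sigma> (snd p))) \<in> C_cone r M"
proof -
  define n where "n = r + 2"
  have Z': "Z \<in> L2_sym M" "AE x in PiM {..<n} (\<lambda>_. M). 0 \<le> offdiag_sum n Z x"
    using Z unfolding C_cone_iff n_def by blast+
  have "AE p in M \<Otimes>\<^sub>M M. Z p = Z (snd p, fst p)" using Z'(1) by (simp add: L2_sym_def case_prod_beta')
  then have "AE p in distr (M \<Otimes>\<^sub>M M) (M \<Otimes>\<^sub>M M) (\<lambda>p. (\<sigma> (fst p), \<sigma> (snd p))). Z p = Z (snd p, fst p)"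
    by (simp only: distr_pair_G[OF \<sigma>])
  from AE_distrD[OF pair_G_measurable[OF \<sigma>] this]
  have 1: "(\<lambda>p. Z (\<sigma> (fst p), \<sigma> (snd p))) \<in> L2_sym M"
    using L2_pair_G[OF \<sigma>, of Z] Z'(1) by (simp add: L2_sym_def case_prod_beta')
  have "distr (PiM {..<n} (\<lambda>_. M)) (PiM {..<n} (\<lambda>_. M)) (compose {..<n} \<sigma>) = PiM {..<n} (\<lambda>_. distr M M \<sigma>)"
    by (rule distr_PiM_finite_prob_space') (use prob_space_axioms G_measurable[OF \<sigma>] in auto)
  then have "AE x in distr (PiM {..<n} (\<lambda>_. M)) (PiM {..<n} (\<lambda>_. M)) (compose {..<n} \<sigma>). 0 \<le> offdiag_sum n Z x"
    using Z'(2) by (simp only: G_distr[OF \<sigma>])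
  moreover have "compose {..<n} \<sigma> \<in> PiM {..<n} (\<lambda>_. M) \<rightarrow>\<^sub>M PiM {..<n} (\<lambda>_. M)"
    unfolding compose_def
    by (rule measurable_restrict, rule measurable_compose[OF _ G_measurable[OF \<sigma>]], rule measurable_component_singleton)
  ultimately have "AE x in PiM {..<n} (\<lambda>_. M). 0 \<le> offdiag_sum n Z (compose {..<n} \<sigma> x)"
    by (rule AE_distrD[rotated])
  moreover have "offdiag_sum n Z (compose {..<n} \<sigma> x) = offdiag_sum n (\<lambda>p. Z (\<sigma> (fst p), \<sigma> (snd p))) x" for x
    unfolding offdiag_sum_def by (intro sum.cong refl) (auto simp: offdiag_def compose_def)
  ultimately have "AE x in PiM {..<n} (\<lambda>_. M). 0 \<le> offdiag_sum n (\<lambda>p. Z (\<sigma> (fst p), \<sigma> (snd p))) x" by simp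
  with 1 show ?thesis unfolding C_cone_iff n_def by blast
qed

text \<open>Around a point of asymmetry there is an open rectangle of such points, and full support
  gives it positive measure. A rectangle is used because it is measurable for the product
  sigma-algebra.\<close>

lemma continuous_L2_sym_imp_sym:
  assumes "continuous_on UNIV A" "A \<in> L2_sym M"
  shows "A (x, y) = A (y, x)"
proof (rule ccontr)
  assume ne: "A (x, y) \<noteq> A (y, x)"
  define D where "D = (\<lambda>p. A p - A (snd p, fst p))"
  have D: "continuous_on UNIV D"
    unfolding D_def by (intro continuous_on_diff continuous_sections assms)
  have "open (D -` (- {0}))" using D by (intro open_vimage) auto
  moreover have "(x, y) \<in> D -` (- {0})" using ne by (simp add: D_def)
  ultimately obtain U W where UW: "open U" "open W" "x \<in> U" "y \<in> W" "U \<times> W \<subseteq> D -` (- {0})"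
    by (metis mem_Sigma_iff open_prod_elim)
  have "AE p in M \<Otimes>\<^sub>M M. D p = 0"
    using assms(2) by (simp add: L2_sym_def case_prod_beta' D_def)
  then have "AE p in M \<Otimes>\<^sub>M M. p \<notin> U \<times> W" by eventually_elim (use UW(5) in auto)
  moreover have "U \<in> sets M" "W \<in> sets M" using UW by auto
  ultimately have "emeasure (M \<Otimes>\<^sub>M M) (U \<times> W) = 0"
    using AE_iff_measurable[of "U \<times> W" "M \<Otimes>\<^sub>M M" "\<lambda>p. p \<notin> U \<times> W"] by auto
  then have "measure M U = 0 \<or> measure M W = 0"
    using emeasure_pair_measure_Times[OF \<open>U \<in> sets M\<close> \<open>W \<in> sets M\<close>] by (simp add: emeasure_eq_measure)
  then show False using full_support[OF UW(1)] full_support[OF UW(2)] UW(3,4) by fastforce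
qed

end

section \<open>Averaging over the group\<close>

locale haar_action =
  fixes \<Gamma> :: "('v::t2_space \<Rightarrow> 'v) topology" and \<mu> :: "('v \<Rightarrow> 'v) measure" and e :: 'v and \<omega> :: "'v measure"
  assumes group: "topological_group_of_maps \<Gamma>" and compact: "compact_space \<Gamma>"
    and homogeneous: "homogeneous_space \<Gamma>" and haar: "normalized_haar_measure \<Gamma> \<mu>"
    and \<omega>_def: "\<omega> = haar_pushforward \<mu> e"
begin

abbreviation "G \<equiv> topspace \<Gamma>"

lemma sets_\<mu>: "sets \<mu> = sets (borel_of \<Gamma>)"
  using haar by (simp add: normalized_haar_measure_def radon_measure_def)

lemma sets_borel_of: "sets (borel_of X) = sigma_sets (topspace X) {U. openin X U}"
  and space_borel_of: "space (borel_of X) = topspace X"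
proof -
  have "{U. openin X U} \<subseteq> Pow (topspace X)" using openin_subset by blast
  then show "sets (borel_of X) = sigma_sets (topspace X) {U. openin X U}" "space (borel_of X) = topspace X"
    by (simp_all add: borel_of_def)
qed

lemma space_\<mu>: "space \<mu> = G"
  using sets_eq_imp_space_eq[OF sets_\<mu>] by (simp add: space_borel_of)

lemma open_sets_\<mu>: "openin \<Gamma> U \<Longrightarrow> U \<in> sets \<mu>"
  unfolding sets_\<mu> sets_borel_of by auto

lemma continuous_measurable_borel:
  fixes f :: "('v \<Rightarrow> 'v) \<Rightarrow> 'b::topological_space"
  assumes "continuous_map \<Gamma> euclidean f"
  shows "f \<in> \<mu> \<rightarrow>\<^sub>M borel"
proof (rule borel_measurableI)
  fix S :: "'b set" assume "open S"
  then have "openin \<Gamma> {x \<in> topspace \<Gamma>. f x \<in> S}"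
    using openin_continuous_map_preimage[OF assms] by simp
  moreover have "f -` S \<inter> space \<mu> = {x \<in> topspace \<Gamma>. f x \<in> S}" by (auto simp: space_\<mu>)
  ultimately show "f -` S \<inter> space \<mu> \<in> sets \<mu>" using open_sets_\<mu> by simp
qed

lemma continuous_measurable_self:
  assumes "continuous_map \<Gamma> \<Gamma> f"
  shows "f \<in> \<mu> \<rightarrow>\<^sub>M \<mu>"
proof (rule measurable_sigma_sets[where \<Omega> = G and A = "{U. openin \<Gamma> U}"])
  show "sets \<mu> = sigma_sets G {U. openin \<Gamma> U}" by (simp add: sets_\<mu> sets_borel_of)
  show "{U. openin \<Gamma> U} \<subseteq> Pow G" using openin_subset by blast
  show "f \<in> space \<mu> \<rightarrow> G" using assms by (auto simp: space_\<mu> continuous_map_def)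
  fix U assume "U \<in> {U. openin \<Gamma> U}"
  then have "openin \<Gamma> {x \<in> topspace \<Gamma>. f x \<in> U}" using openin_continuous_map_preimage[OF assms] by simp
  moreover have "f -` U \<inter> space \<mu> = {x \<in> topspace \<Gamma>. f x \<in> U}" by (auto simp: space_\<mu>)
  ultimately show "f -` U \<inter> space \<mu> \<in> sets \<mu>" using open_sets_\<mu> by simp
qed

lemma action_continuous: "continuous_map (prod_topology \<Gamma> euclidean) euclidean (\<lambda>(\<sigma>, x). \<sigma> x)"
  using homogeneous by (simp add: homogeneous_space_def)

lemma G_closed:
  "\<sigma> \<in> G \<Longrightarrow> bij \<sigma>" "\<sigma> \<in> G \<Longrightarrow> inv \<sigma> \<in> G" "\<sigma> \<in> G \<Longrightarrow> \<tau> \<in> G \<Longrightarrow> \<sigma> \<circ> \<tau> \<in> G"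
  using group by (auto simp: topological_group_of_maps_def)

lemma G_trans: "\<exists>\<sigma>\<in>G. \<sigma> x = y"
  using homogeneous by (simp add: homogeneous_space_def)

lemma G_continuous: "\<sigma> \<in> G \<Longrightarrow> continuous_on UNIV \<sigma>"
  using homogeneous homeomorphic_imp_continuous_map by (fastforce simp: homogeneous_space_def)

lemma orbit_continuous: "continuous_map \<Gamma> euclidean (\<lambda>\<sigma>. \<sigma> x)"
proof -
  have "continuous_map \<Gamma> (prod_topology \<Gamma> euclidean) (\<lambda>\<sigma>. (\<sigma>, x))"
    by (intro continuous_map_pairedI) (auto simp: continuous_map_id[unfolded id_def])
  from continuous_map_compose[OF this action_continuous] show ?thesis by (simp add: o_def)
qed

lemma left_translation_continuous:
  assumes "\<sigma> \<in> G"
  shows "continuous_map \<Gamma> \<Gamma> (\<lambda>\<tau>. \<sigma> \<circ> \<tau>)"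
proof -
  have 1: "continuous_map \<Gamma> (prod_topology \<Gamma> \<Gamma>) (\<lambda>\<tau>. (\<sigma>, \<tau>))"
    using assms by (intro continuous_map_pairedI) (auto simp: continuous_map_id[unfolded id_def])
  have "continuous_map (prod_topology \<Gamma> \<Gamma>) \<Gamma> (\<lambda>(\<sigma>, \<tau>). \<sigma> \<circ> \<tau>)"
    using group by (simp add: topological_group_of_maps_def)
  from continuous_map_compose[OF 1 this] show ?thesis by (simp add: comp_def)
qed

text \<open>The Haar condition speaks of images of sets, the pushforward of preimages. Translation
  by the inverse shows that every measurable set is the image of its preimage.\<close>

lemma left_invariant:
  assumes \<sigma>: "\<sigma> \<in> G"
  shows "distr \<mu> \<mu> (\<lambda>\<tau>. \<sigma> \<circ> \<tau>) = \<mu>"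
proof (rule measure_eqI)
  fix B assume "B \<in> sets (distr \<mu> \<mu> (\<lambda>\<tau>. \<sigma> \<circ> \<tau>))"
  then have B: "B \<in> sets \<mu>" by simp
  note m = continuous_measurable_self[OF left_translation_continuous[OF \<sigma>]]
  let ?B = "(\<lambda>\<tau>. \<sigma> \<circ> \<tau>) -` B \<inter> space \<mu>"
  have "(\<lambda>\<tau>. \<sigma> \<circ> \<tau>) ` ?B = B"
  proof
    show "B \<subseteq> (\<lambda>\<tau>. \<sigma> \<circ> \<tau>) ` ?B"
    proof
      fix \<rho> assume \<rho>: "\<rho> \<in> B"
      then have "\<rho> \<in> G" using sets.sets_into_space[OF B] space_\<mu> by auto
      then have "inv \<sigma> \<circ> \<rho> \<in> space \<mu>" using G_closed \<sigma> space_\<mu> by auto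
      moreover have "\<sigma> \<circ> (inv \<sigma> \<circ> \<rho>) = \<rho>"
        using G_closed(1)[OF \<sigma>] by (simp add: fun_eq_iff bij_is_surj surj_f_inv_f)
      ultimately show "\<rho> \<in> (\<lambda>\<tau>. \<sigma> \<circ> \<tau>) ` ?B" using \<rho> by (intro image_eqI[of _ _ "inv \<sigma> \<circ> \<rho>"]) auto
    qed
  qed auto
  moreover have "?B \<in> sets \<mu>" using measurable_sets[OF m B] .
  then have "emeasure \<mu> ((\<lambda>\<tau>. \<sigma> \<circ> \<tau>) ` ?B) = emeasure \<mu> ?B"
    using haar \<sigma> by (simp add: normalized_haar_measure_def)
  ultimately show "emeasure (distr \<mu> \<mu> (\<lambda>\<tau>. \<sigma> \<circ> \<tau>)) B = emeasure \<mu> B"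
    by (simp add: emeasure_distr[OF m B])
qed simp

lemma prob_\<mu>: "prob_space \<mu>"
  using haar by (intro prob_spaceI) (simp add: space_\<mu> normalized_haar_measure_def)

lemma orbit_measurable: "(\<lambda>\<sigma>. \<sigma> x) \<in> \<mu> \<rightarrow>\<^sub>M borel"
  by (rule continuous_measurable_borel[OF orbit_continuous])

lemma compact_vertices: "compact (UNIV :: 'v set)"
proof -
  have "compactin euclidean ((\<lambda>\<sigma>. \<sigma> e) ` G)"
    using compact by (intro image_compactin[OF _ orbit_continuous]) (simp add: compact_space_def)
  moreover have "(\<lambda>\<sigma>. \<sigma> e) ` G = UNIV" using G_trans[of e] by (auto simp: image_iff) metis
  ultimately show ?thesis by simp
qed

lemma \<omega>_invariant:
  assumes \<sigma>: "\<sigma> \<in> G"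
  shows "distr \<omega> \<omega> \<sigma> = \<omega>"
proof -
  have m: "\<sigma> \<in> borel_measurable borel" by (rule borel_measurable_continuous_onI[OF G_continuous[OF \<sigma>]])
  have "distr \<omega> \<omega> \<sigma> = distr \<omega> borel \<sigma>"
    by (rule distr_cong) (simp_all add: \<omega>_def haar_pushforward_def)
  also have "\<dots> = distr \<mu> borel (\<sigma> \<circ> (\<lambda>\<tau>. \<tau> e))"
    unfolding \<omega>_def haar_pushforward_def by (rule distr_distr[OF m orbit_measurable])
  also have "\<dots> = distr (distr \<mu> \<mu> (\<lambda>\<tau>. \<sigma> \<circ> \<tau>)) borel (\<lambda>\<tau>. \<tau> e)"
    by (subst distr_distr[OF orbit_measurable continuous_measurable_self[OF left_translation_continuous[OF \<sigma>]]])
       (simp add: o_def)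
  also have "\<dots> = \<omega>" by (simp only: left_invariant[OF \<sigma>] \<omega>_def haar_pushforward_def)
  finally show ?thesis .
qed

lemma prob_\<omega>: "prob_space \<omega>"
  unfolding \<omega>_def haar_pushforward_def by (rule prob_space.prob_space_distr[OF prob_\<mu> orbit_measurable])

lemma sets_\<omega>: "sets \<omega> = sets borel"
  by (simp add: \<omega>_def haar_pushforward_def)

lemma G_measurable_\<omega>: "\<sigma> \<in> G \<Longrightarrow> \<sigma> \<in> \<omega> \<rightarrow>\<^sub>M \<omega>"
  using borel_measurable_continuous_onI[OF G_continuous] by (simp add: measurable_cong_sets[OF sets_\<omega> sets_\<omega>])

text \<open>By transitivity and compactness finitely many preimages of \<open>U\<close> under group
  elements cover the space. They all have the measure of \<open>U\<close>, so a null
  \<open>U\<close> would make the whole space null.\<close>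

lemma \<omega>_full_support:
  assumes U: "open U" "U \<noteq> {}"
  shows "0 < measure \<omega> U"
proof (rule ccontr)
  interpret prob_space \<omega> by (rule prob_\<omega>)
  have sp: "space \<omega> = UNIV" using sets_eq_imp_space_eq[OF sets_\<omega>] by simp
  assume "\<not> 0 < measure \<omega> U"
  then have "emeasure \<omega> U = 0" by (simp add: emeasure_eq_measure zero_less_measure_iff)
  have op: "open (\<sigma> -` U)" if "\<sigma> \<in> G" for \<sigma> by (rule open_vimage[OF U(1) G_continuous[OF that]])
  have null: "emeasure \<omega> (\<sigma> -` U) = 0" if "\<sigma> \<in> G" for \<sigma>
  proof -
    have "emeasure (distr \<omega> \<omega> \<sigma>) U = emeasure \<omega> (\<sigma> -` U \<inter> space \<omega>)"
      by (rule emeasure_distr[OF G_measurable_\<omega>[OF that]]) (use U sets_\<omega> in auto)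
    then show ?thesis using \<omega>_invariant[OF that] \<open>emeasure \<omega> U = 0\<close> sp by simp
  qed
  obtain u where "u \<in> U" using U(2) by blast
  then have "UNIV \<subseteq> (\<Union>\<sigma>\<in>G. \<sigma> -` U)" using G_trans[of _ u] by blast
  then obtain F where F: "F \<subseteq> G" "finite F" "UNIV \<subseteq> (\<Union>\<sigma>\<in>F. \<sigma> -` U)"
    using compactE_image[OF compact_vertices, of G "\<lambda>\<sigma>. \<sigma> -` U"] op by metis
  have "emeasure \<omega> (\<Union>\<sigma>\<in>F. \<sigma> -` U) \<le> (\<Sum>\<sigma>\<in>F. emeasure \<omega> (\<sigma> -` U))"
    by (rule emeasure_subadditive_finite) (use F op sets_\<omega> in auto)
  also have "\<dots> = 0" using null F(1) by (intro sum.neutral) auto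
  finally have "emeasure \<omega> UNIV = 0" using F(3) by (simp add: top.extremum_unique)
  then show False using emeasure_space_1 sp by simp
qed

sublocale H: homogeneous_prob_space \<omega> G e
proof -
  interpret prob_space \<omega> by (rule prob_\<omega>)
  show "homogeneous_prob_space \<omega> G"
    by standard (use sets_\<omega> compact_vertices \<omega>_full_support \<omega>_invariant G_trans G_measurable_\<omega> in auto)
qed

end

section \<open>The average of a kernel over the group\<close>

context haar_action
begin

text \<open>The inverses make left invariance of \<open>\<mu>\<close> sufficient for the average to be invariant.\<close>

definition group_average :: "('v \<times> 'v \<Rightarrow> real) \<Rightarrow> 'v \<times> 'v \<Rightarrow> real" where
  "group_average A p = (\<integral>\<sigma>. A (inv \<sigma> (fst p), inv \<sigma> (snd p)) \<partial>\<mu>)"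

lemma translate_continuous:
  assumes "continuous_on UNIV (A :: 'v \<times> 'v \<Rightarrow> real)" "\<sigma> \<in> G"
  shows "continuous_on UNIV (\<lambda>p. A (\<sigma> (fst p), \<sigma> (snd p)))"
proof -
  have "continuous_on UNIV (\<lambda>p::'v \<times> 'v. \<sigma> (fst p))" "continuous_on UNIV (\<lambda>p::'v \<times> 'v. \<sigma> (snd p))"
    by (intro continuous_on_compose2[OF G_continuous[OF assms(2)]] continuous_intros; simp)+
  then show ?thesis
    by (intro continuous_on_compose2[OF assms(1)] continuous_on_Pair) auto
qed

context
  fixes A :: "'v \<times> 'v \<Rightarrow> real"
  assumes A: "continuous_on UNIV A"
begin

lemma translate_joint_continuous:
  "continuous_map (prod_topology \<Gamma> euclidean) euclidean (\<lambda>z. A (inv (fst z) (fst (snd z)), inv (fst z) (snd (snd z))))"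
proof -
  have inv: "continuous_map \<Gamma> \<Gamma> inv" using group by (simp add: topological_group_of_maps_def)
  have h: "continuous_map (prod_topology \<Gamma> euclidean) euclidean (\<lambda>z. inv (fst z) (g (snd z)))"
    if "continuous_on UNIV g" for g :: "'v \<times> 'v \<Rightarrow> 'v"
  proof -
    have "continuous_map (prod_topology \<Gamma> euclidean) (prod_topology \<Gamma> euclidean) (\<lambda>z. (inv (fst z), g (snd z)))"
    proof (intro continuous_map_pairedI)
      show "continuous_map (prod_topology \<Gamma> euclidean) \<Gamma> (\<lambda>z. inv (fst z))"
        using continuous_map_compose[OF continuous_map_fst inv] by (simp add: o_def)
      have "continuous_map euclidean euclidean g" using that by simp
      from continuous_map_compose[OF continuous_map_snd this]
      show "continuous_map (prod_topology \<Gamma> euclidean) euclidean (\<lambda>z. g (snd z))" by (simp add: o_def)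
    qed
    from continuous_map_compose[OF this action_continuous] show ?thesis by (simp add: o_def)
  qed
  have "continuous_map (prod_topology \<Gamma> euclidean) (prod_topology euclidean euclidean)
      (\<lambda>z. (inv (fst z) (fst (snd z)), inv (fst z) (snd (snd z))))"
    by (intro continuous_map_pairedI h continuous_intros)
  from continuous_map_compose[OF this, of euclidean A] A show ?thesis by (simp add: o_def)
qed

text \<open>The tube lemma, along the compact space of pairs, makes the estimate uniform in
  \<open>p\<close>.\<close>

lemma translate_nbhd:
  assumes \<tau>: "\<tau> \<in> G" and \<epsilon>: "\<epsilon> > 0"
  obtains N where "openin \<Gamma> N" "\<tau> \<in> N"
    "\<And>\<sigma> p. \<sigma> \<in> N \<Longrightarrow> \<bar>A (inv \<sigma> (fst p), inv \<sigma> (snd p)) - A (inv \<tau> (fst p), inv \<tau> (snd p))\<bar> \<le> \<epsilon>"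
proof -
  define D where "D = (\<lambda>z. A (inv (fst z) (fst (snd z)), inv (fst z) (snd (snd z)))
    - A (inv \<tau> (fst (snd z)), inv \<tau> (snd (snd z))))"
  have "continuous_map (prod_topology \<Gamma> euclidean) euclidean (\<lambda>z. A (inv \<tau> (fst (snd z)), inv \<tau> (snd (snd z))))"
  proof -
    have "continuous_map euclidean euclidean (\<lambda>p. A (inv \<tau> (fst p), inv \<tau> (snd p)))"
      using translate_continuous[OF A G_closed(2)[OF \<tau>]] by simp
    from continuous_map_compose[OF continuous_map_snd this] show ?thesis by (simp add: o_def)
  qed
  then have D: "continuous_map (prod_topology \<Gamma> euclidean) euclidean D"
    unfolding D_def by (intro continuous_map_diff translate_joint_continuous)
  define W where "W = {z \<in> topspace (prod_topology \<Gamma> euclidean). D z \<in> {-\<epsilon><..<\<epsilon>}}"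
  have W: "openin (prod_topology \<Gamma> euclidean) W"
    unfolding W_def by (rule openin_continuous_map_preimage[OF D]) simp
  have "compact (UNIV \<times> UNIV :: ('v \<times> 'v) set)" by (intro compact_Times compact_vertices)
  then have C: "compactin euclidean (UNIV :: ('v \<times> 'v) set)" by simp
  have sub: "{\<tau>} \<times> UNIV \<subseteq> W" using \<tau> \<epsilon> by (auto simp: W_def D_def)
  obtain N N' where N: "openin \<Gamma> N" "\<tau> \<in> N" "UNIV \<subseteq> N'" "N \<times> N' \<subseteq> W"
    using tube_lemma_right[OF W C \<tau> sub] by blast
  have "\<bar>A (inv \<sigma> (fst p), inv \<sigma> (snd p)) - A (inv \<tau> (fst p), inv \<tau> (snd p))\<bar> \<le> \<epsilon>" if "\<sigma> \<in> N" for \<sigma> p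
  proof -
    have "(\<sigma>, p) \<in> W" using N that by blast
    then show ?thesis by (auto simp: W_def D_def)
  qed
  then show ?thesis using that N(1,2) by blast
qed

lemma translate_measurable: "(\<lambda>\<sigma>. A (inv \<sigma> x, inv \<sigma> y)) \<in> borel_measurable \<mu>"
proof -
  have "continuous_map \<Gamma> (prod_topology \<Gamma> euclidean) (\<lambda>\<sigma>. (\<sigma>, (x, y)))"
    by (intro continuous_map_pairedI) (auto simp: continuous_map_id[unfolded id_def])
  from continuous_map_compose[OF this translate_joint_continuous]
  have "continuous_map \<Gamma> euclidean (\<lambda>\<sigma>. A (inv \<sigma> x, inv \<sigma> y))" by (simp add: o_def)
  then show ?thesis by (rule continuous_measurable_borel)
qed

text \<open>Takes the place of exchanging the integral over the group with integrals over vertices: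
  lower bounds on pairings that hold for all translates pass to convex combinations, and then to the
  average. The weights are the Haar measures of the cells of a finite partition of the
  group.\<close>

lemma group_average_approx:
  assumes \<epsilon>: "\<epsilon> > 0"
  obtains I w where "finite I" "I \<subseteq> G" "\<And>\<tau>. \<tau> \<in> I \<Longrightarrow> 0 \<le> (w \<tau> :: real)" "(\<Sum>\<tau>\<in>I. w \<tau>) = 1"
    "\<And>p. \<bar>group_average A p - (\<Sum>\<tau>\<in>I. w \<tau> * A (inv \<tau> (fst p), inv \<tau> (snd p)))\<bar> \<le> \<epsilon>"
proof -
  interpret \<mu>: prob_space \<mu> by (rule prob_\<mu>)
  let ?F = "\<lambda>p \<sigma>. A (inv \<sigma> (fst p), inv \<sigma> (snd p))"
  have "\<exists>N. openin \<Gamma> N \<and> \<tau> \<in> N \<and> (\<forall>\<sigma>\<in>N. \<forall>p. \<bar>?F p \<sigma> - ?F p \<tau>\<bar> \<le> \<epsilon>)" if "\<tau> \<in> G" for \<tau>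
    using translate_nbhd[OF that \<epsilon>] by metis
  then obtain N where N: "\<And>\<tau>. \<tau> \<in> G \<Longrightarrow> openin \<Gamma> (N \<tau>)" "\<And>\<tau>. \<tau> \<in> G \<Longrightarrow> \<tau> \<in> N \<tau>"
    "\<And>\<tau> \<sigma> p. \<tau> \<in> G \<Longrightarrow> \<sigma> \<in> N \<tau> \<Longrightarrow> \<bar>?F p \<sigma> - ?F p \<tau>\<bar> \<le> \<epsilon>" by metis
  have "\<exists>\<F>. finite \<F> \<and> \<F> \<subseteq> N ` G \<and> G \<subseteq> \<Union>\<F>"
    using compact N(1,2) unfolding compact_space_def by (intro compactinD) auto
  then obtain Z where Z: "finite Z" "Z \<subseteq> G" "G \<subseteq> \<Union>(N ` Z)"
    by (metis finite_subset_image)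
  have NZ: "N z \<in> sets \<mu>" if "z \<in> Z" for z using that Z(2) N(1) open_sets_\<mu> by blast
  obtain c where c: "c \<in> \<mu> \<rightarrow>\<^sub>M count_space UNIV" "\<And>x. x \<in> \<Union>(N ` Z) \<Longrightarrow> c x \<in> Z \<and> x \<in> N (c x)"
    using finite_cover_labels[where N=N, OF Z(1) NZ] by metis
  note c(1)[measurable]
  have cZ: "c \<sigma> \<in> Z" "\<sigma> \<in> N (c \<sigma>)" if "\<sigma> \<in> G" for \<sigma> using c(2)[of \<sigma>] Z(3) that by auto
  define w where "w \<tau> = measure \<mu> (c -` {\<tau>} \<inter> space \<mu>)" for \<tau>
  have cell: "c -` {\<tau>} \<inter> space \<mu> \<in> sets \<mu>" for \<tau> by measurable
  have cell_sum: "(\<integral>\<sigma>. h (c \<sigma>) \<partial>\<mu>) = (\<Sum>\<tau>\<in>Z. w \<tau> * h \<tau>)" for h :: "('v \<Rightarrow> 'v) \<Rightarrow> real"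
  proof -
    have "(\<integral>\<sigma>. h (c \<sigma>) \<partial>\<mu>) = (\<integral>\<sigma>. (\<Sum>\<tau>\<in>Z. h \<tau> * indicator (c -` {\<tau>} \<inter> space \<mu>) \<sigma>) \<partial>\<mu>)"
    proof (rule Bochner_Integration.integral_cong[OF refl])
      fix \<sigma> assume \<sigma>: "\<sigma> \<in> space \<mu>"
      have "(\<Sum>\<tau>\<in>Z. h \<tau> * indicator (c -` {\<tau>} \<inter> space \<mu>) \<sigma>) = (\<Sum>\<tau>\<in>Z. if \<tau> = c \<sigma> then h \<tau> else 0)"
        by (intro sum.cong refl) (use \<sigma> in \<open>auto simp: indicator_def\<close>)
      then show "h (c \<sigma>) = (\<Sum>\<tau>\<in>Z. h \<tau> * indicator (c -` {\<tau>} \<inter> space \<mu>) \<sigma>)"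
        using Z(1) cZ(1)[of \<sigma>] \<sigma> space_\<mu> by simp
    qed
    also have "\<dots> = (\<Sum>\<tau>\<in>Z. w \<tau> * h \<tau>)"
      using cell by (simp add: w_def mult.commute \<mu>.emeasure_eq_measure)
    finally show ?thesis .
  qed
  show ?thesis
  proof (rule that[of Z w])
    show "(\<Sum>\<tau>\<in>Z. w \<tau>) = 1" using cell_sum[of "\<lambda>_. 1"] \<mu>.prob_space by simp
    fix p
    obtain C where C: "\<And>p. \<bar>A p\<bar> \<le> C" using H.kernel_bounded[OF A] by blast
    have i1: "integrable \<mu> (\<lambda>\<sigma>. ?F p \<sigma>)"
      by (rule \<mu>.integrable_const_bound[where B=C]) (use C translate_measurable in auto)
    have i2: "integrable \<mu> (\<lambda>\<sigma>. ?F p (c \<sigma>))"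
    proof (rule \<mu>.integrable_const_bound[where B=C])
      show "(\<lambda>\<sigma>. ?F p (c \<sigma>)) \<in> borel_measurable \<mu>" by (rule measurable_compose[OF c(1)]) simp
    qed (use C in auto)
    have "group_average A p - (\<Sum>\<tau>\<in>Z. w \<tau> * ?F p \<tau>) = (\<integral>\<sigma>. ?F p \<sigma> - ?F p (c \<sigma>) \<partial>\<mu>)"
      unfolding group_average_def using i1 i2 cell_sum[of "?F p"] by simp
    also have "\<bar>\<dots>\<bar> \<le> (\<integral>\<sigma>. \<epsilon> \<partial>\<mu>)"
    proof (rule order_trans[OF integral_abs_bound integral_mono])
      fix \<sigma> assume "\<sigma> \<in> space \<mu>"
      then have "\<sigma> \<in> G" by (simp add: space_\<mu>)
      then show "\<bar>?F p \<sigma> - ?F p (c \<sigma>)\<bar> \<le> \<epsilon>" using N(3) cZ Z(2) by blast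
    qed (use i1 i2 in auto)
    finally show "\<bar>group_average A p - (\<Sum>\<tau>\<in>Z. w \<tau> * ?F p \<tau>)\<bar> \<le> \<epsilon>" by (simp add: \<mu>.prob_space)
  qed (use Z in \<open>auto simp: w_def\<close>)
qed

lemma group_average_continuous: "continuous_on UNIV (group_average A)"
proof -
  have "\<exists>S. continuous_on UNIV S \<and> (\<forall>p. \<bar>group_average A p - S p\<bar> \<le> inverse (real (Suc n)))" for n
  proof -
    have n: "inverse (real (Suc n)) > 0" by simp
    obtain I w where I: "finite I" "I \<subseteq> G" "\<And>\<tau>. \<tau> \<in> I \<Longrightarrow> 0 \<le> (w \<tau> :: real)" "(\<Sum>\<tau>\<in>I. w \<tau>) = 1"
      "\<And>p. \<bar>group_average A p - (\<Sum>\<tau>\<in>I. w \<tau> * A (inv \<tau> (fst p), inv \<tau> (snd p)))\<bar> \<le> inverse (real (Suc n))"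
      using group_average_approx[OF n] by blast
    have "continuous_on UNIV (\<lambda>p. \<Sum>\<tau>\<in>I. w \<tau> * A (inv \<tau> (fst p), inv \<tau> (snd p)))"
      using I(2) G_closed(2) by (intro continuous_on_sum continuous_on_mult continuous_on_const translate_continuous[OF A]) auto
    then show ?thesis using I(5) by blast
  qed
  then obtain S where S: "\<And>n. continuous_on UNIV (S n)" "\<And>n p. \<bar>group_average A p - S n p\<bar> \<le> inverse (real (Suc n))"
    by metis
  have "uniform_limit UNIV S (group_average A) sequentially"
  proof (rule uniform_limitI)
    fix \<epsilon> :: real assume "\<epsilon> > 0"
    then have "\<forall>\<^sub>F n in sequentially. inverse (real (Suc n)) < \<epsilon>"
      using LIMSEQ_inverse_real_of_nat order_tendstoD(2) by blast
    then show "\<forall>\<^sub>F n in sequentially. \<forall>x\<in>UNIV. dist (S n x) (group_average A x) < \<epsilon>"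
    proof eventually_elim
      case (elim n)
      show ?case using S(2)[of _ n] elim by (auto simp: dist_real_def abs_minus_commute intro: le_less_trans)
    qed
  qed
  then show ?thesis by (rule uniform_limit_theorem[rotated]) (use S(1) in auto)
qed

text \<open>Serves three purposes, according to \<open>Z\<close>: elements of \<open>C_cone\<close>
  give the dual cone, products \<open>f (fst p) * f (snd p)\<close> give semidefiniteness, and the
  constant 1 gives the value.\<close>

lemma group_average_inner_ge:
  assumes Z: "Z \<in> L2 (\<omega> \<Otimes>\<^sub>M \<omega>)"
    and v: "\<And>\<sigma>. \<sigma> \<in> G \<Longrightarrow> v \<le> L2_inner (\<omega> \<Otimes>\<^sub>M \<omega>) (\<lambda>p. A (\<sigma> (fst p), \<sigma> (snd p))) Z"
  shows "v \<le> L2_inner (\<omega> \<Otimes>\<^sub>M \<omega>) (group_average A) Z"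
proof (rule field_le_epsilon)
  fix d :: real assume d: "d > 0"
  define z where "z = (\<integral>w. \<bar>Z w\<bar> \<partial>(\<omega> \<Otimes>\<^sub>M \<omega>))"
  have z0: "0 \<le> z" by (simp add: z_def)
  define \<delta> where "\<delta> = d / (z + 1)"
  have \<delta>: "\<delta> > 0" "\<delta> * z \<le> d" using d z0 by (auto simp: \<delta>_def field_simps)
  obtain I w where I: "finite I" "I \<subseteq> G" "\<And>\<tau>. \<tau> \<in> I \<Longrightarrow> 0 \<le> (w \<tau> :: real)" "(\<Sum>\<tau>\<in>I. w \<tau>) = 1"
    "\<And>p. \<bar>group_average A p - (\<Sum>\<tau>\<in>I. w \<tau> * A (inv \<tau> (fst p), inv \<tau> (snd p)))\<bar> \<le> \<delta>"
    using group_average_approx[OF \<delta>(1)] by blast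
  define S where "S p = (\<Sum>\<tau>\<in>I. w \<tau> * A (inv \<tau> (fst p), inv \<tau> (snd p)))" for p
  have tr: "(\<lambda>p. A (inv \<tau> (fst p), inv \<tau> (snd p))) \<in> L2 (\<omega> \<Otimes>\<^sub>M \<omega>)" if "\<tau> \<in> I" for \<tau>
    using that I(2) G_closed(2) by (intro H.kernel_L2 translate_continuous[OF A]) auto
  have i1: "integrable (\<omega> \<Otimes>\<^sub>M \<omega>) (\<lambda>p. group_average A p * Z p)"
    by (intro L2_mult_integrable H.kernel_L2 group_average_continuous Z)
  have i: "integrable (\<omega> \<Otimes>\<^sub>M \<omega>) (\<lambda>p. A (inv \<tau> (fst p), inv \<tau> (snd p)) * Z p)" if "\<tau> \<in> I" for \<tau>
    by (intro L2_mult_integrable tr that Z)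
  have SZ: "S p * Z p = (\<Sum>\<tau>\<in>I. w \<tau> * (A (inv \<tau> (fst p), inv \<tau> (snd p)) * Z p))" for p
    by (simp add: S_def sum_distrib_right mult.assoc)
  have i2: "integrable (\<omega> \<Otimes>\<^sub>M \<omega>) (\<lambda>p. S p * Z p)" unfolding SZ using i by simp
  have "v = (\<Sum>\<tau>\<in>I. w \<tau> * v)" using I(4) by (simp flip: sum_distrib_right)
  also have "\<dots> \<le> (\<Sum>\<tau>\<in>I. w \<tau> * L2_inner (\<omega> \<Otimes>\<^sub>M \<omega>) (\<lambda>p. A (inv \<tau> (fst p), inv \<tau> (snd p))) Z)"
    using I(2,3) G_closed(2) by (intro sum_mono mult_left_mono v) auto
  also have "\<dots> = L2_inner (\<omega> \<Otimes>\<^sub>M \<omega>) S Z"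
    unfolding L2_inner_def SZ using i by simp
  finally have 1: "v \<le> L2_inner (\<omega> \<Otimes>\<^sub>M \<omega>) S Z" .
  have "L2_inner (\<omega> \<Otimes>\<^sub>M \<omega>) S Z - L2_inner (\<omega> \<Otimes>\<^sub>M \<omega>) (group_average A) Z = (\<integral>p. S p * Z p - group_average A p * Z p \<partial>(\<omega> \<Otimes>\<^sub>M \<omega>))"
    unfolding L2_inner_def using i1 i2 by simp
  also have "\<dots> \<le> (\<integral>p. \<delta> * \<bar>Z p\<bar> \<partial>(\<omega> \<Otimes>\<^sub>M \<omega>))"
  proof (rule integral_mono)
    fix p
    have "\<bar>S p - group_average A p\<bar> * \<bar>Z p\<bar> \<le> \<delta> * \<bar>Z p\<bar>"
      using I(5)[of p] by (intro mult_right_mono) (auto simp: S_def abs_minus_commute)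
    then have "\<bar>(S p - group_average A p) * Z p\<bar> \<le> \<delta> * \<bar>Z p\<bar>" by (simp add: abs_mult)
    then show "S p * Z p - group_average A p * Z p \<le> \<delta> * \<bar>Z p\<bar>" by (simp add: left_diff_distrib abs_le_iff)
  qed (use i1 i2 H.L2_imp_integrable[OF Z] in auto)
  also have "\<dots> = \<delta> * z" by (simp add: z_def)
  finally show "v \<le> L2_inner (\<omega> \<Otimes>\<^sub>M \<omega>) (group_average A) Z + d" using 1 \<delta>(2) by linarith
qed

lemma group_average_invariant: "H.kinv (group_average A)"
  unfolding H.kinv_def
proof (intro ballI allI)
  fix \<tau> x y assume \<tau>: "\<tau> \<in> G"
  note \<tau>' = G_closed(2)[OF \<tau>]
  have "inv \<sigma> (\<tau> z) = inv (inv \<tau> \<circ> \<sigma>) z" if "\<sigma> \<in> G" for \<sigma> z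
    using G_closed(1)[OF \<tau>] G_closed(1)[OF that] G_closed(1)[OF \<tau>']
    by (simp add: o_inv_distrib inv_inv_eq)
  then have "group_average A (\<tau> x, \<tau> y) = (\<integral>\<sigma>. A (inv (inv \<tau> \<circ> \<sigma>) x, inv (inv \<tau> \<circ> \<sigma>) y) \<partial>\<mu>)"
    unfolding group_average_def by (intro Bochner_Integration.integral_cong refl) (simp add: space_\<mu>)
  also have "\<dots> = (\<integral>\<sigma>. A (inv \<sigma> x, inv \<sigma> y) \<partial>distr \<mu> \<mu> (\<lambda>\<sigma>. inv \<tau> \<circ> \<sigma>))"
    by (rule integral_distr[symmetric, OF continuous_measurable_self[OF left_translation_continuous[OF \<tau>']] translate_measurable])
  also have "\<dots> = group_average A (x, y)" by (simp add: left_invariant[OF \<tau>'] group_average_def)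
  finally show "group_average A (\<tau> x, \<tau> y) = group_average A (x, y)" .
qed

text \<open>The trace is not an L2 pairing, so \<open>group_average_inner_ge\<close> does not reach
  it; the uniform approximation controls the diagonal directly.\<close>

lemma group_average_trace: "(\<integral>x. group_average A (x, x) \<partial>\<omega>) = (\<integral>x. A (x, x) \<partial>\<omega>)"
proof -
  have le: "\<bar>(\<integral>x. group_average A (x, x) \<partial>\<omega>) - (\<integral>x. A (x, x) \<partial>\<omega>)\<bar> \<le> \<epsilon>" if \<epsilon>: "\<epsilon> > 0" for \<epsilon>
  proof -
    obtain I w where I: "finite I" "I \<subseteq> G" "\<And>\<tau>. \<tau> \<in> I \<Longrightarrow> 0 \<le> (w \<tau> :: real)" "(\<Sum>\<tau>\<in>I. w \<tau>) = 1"
      "\<And>p. \<bar>group_average A p - (\<Sum>\<tau>\<in>I. w \<tau> * A (inv \<tau> (fst p), inv \<tau> (snd p)))\<bar> \<le> \<epsilon>"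
      using group_average_approx[OF \<epsilon>] by blast
    define S where "S p = (\<Sum>\<tau>\<in>I. w \<tau> * A (inv \<tau> (fst p), inv \<tau> (snd p)))" for p
    have tr: "continuous_on UNIV (\<lambda>p. A (inv \<tau> (fst p), inv \<tau> (snd p)))" if "\<tau> \<in> I" for \<tau>
      using that I(2) G_closed(2) by (intro translate_continuous[OF A]) auto
    have S: "continuous_on UNIV S"
      unfolding S_def by (intro continuous_on_sum continuous_on_mult continuous_on_const tr)
    have i: "integrable \<omega> (\<lambda>x. A (inv \<tau> x, inv \<tau> x))" if "\<tau> \<in> I" for \<tau>
      using H.bdd_integrable[OF H.bdd_continuous[OF H.continuous_sections(3)[OF tr[OF that]]]] by simp
    have "(\<integral>x. S (x, x) \<partial>\<omega>) = (\<Sum>\<tau>\<in>I. w \<tau> * (\<integral>x. A (inv \<tau> x, inv \<tau> x) \<partial>\<omega>))"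
      unfolding S_def using i by simp
    also have "\<dots> = (\<Sum>\<tau>\<in>I. w \<tau> * (\<integral>x. A (x, x) \<partial>\<omega>))"
    proof (intro sum.cong refl)
      fix \<tau> assume "\<tau> \<in> I"
      then have "inv \<tau> \<in> G" using I(2) G_closed(2) by auto
      from H.integral_G[OF this H.continuous_imp_measurable[OF H.continuous_sections(3)[OF A]]]
      show "w \<tau> * (\<integral>x. A (inv \<tau> x, inv \<tau> x) \<partial>\<omega>) = w \<tau> * (\<integral>x. A (x, x) \<partial>\<omega>)" by simp
    qed
    also have "\<dots> = (\<integral>x. A (x, x) \<partial>\<omega>)" using I(4) by (simp flip: sum_distrib_right)
    finally have "(\<integral>x. S (x, x) \<partial>\<omega>) = (\<integral>x. A (x, x) \<partial>\<omega>)" .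
    moreover have "\<bar>(\<integral>x. group_average A (x, x) \<partial>\<omega>) - (\<integral>x. S (x, x) \<partial>\<omega>)\<bar> \<le> \<epsilon>"
      using I(5) by (intro H.integral_abs_diff_le H.bdd_continuous H.continuous_sections group_average_continuous S) (metis S_def)
    ultimately show ?thesis by simp
  qed
  show ?thesis using field_le_epsilon[of "\<bar>(\<integral>x. group_average A (x, x) \<partial>\<omega>) - (\<integral>x. A (x, x) \<partial>\<omega>)\<bar>" 0] le by simp
qed

lemma translate_inner:
  assumes \<sigma>: "\<sigma> \<in> G" and Z: "Z \<in> L2 (\<omega> \<Otimes>\<^sub>M \<omega>)"
  shows "L2_inner (\<omega> \<Otimes>\<^sub>M \<omega>) (\<lambda>p. A (\<sigma> (fst p), \<sigma> (snd p))) Z = L2_inner (\<omega> \<Otimes>\<^sub>M \<omega>) A (\<lambda>p. Z (inv \<sigma> (fst p), inv \<sigma> (snd p)))"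
proof -
  note \<sigma>' = G_closed(2)[OF \<sigma>]
  have "(\<lambda>p. A p * Z (inv \<sigma> (fst p), inv \<sigma> (snd p))) \<in> borel_measurable (\<omega> \<Otimes>\<^sub>M \<omega>)"
    using H.L2_pair_G[OF \<sigma>' Z] H.kernel_measurable[OF A] by (auto simp: L2_def)
  from H.pair_integral_G[OF \<sigma> this] show ?thesis
    unfolding L2_inner_def using G_closed(1)[OF \<sigma>] by (simp add: bij_is_inj)
qed

text \<open>In each pairing the translation is moved from \<open>A\<close> to \<open>Z\<close>, and
  \<open>C_cone\<close> is stable under the group.\<close>

lemma group_average_C_dual:
  assumes "A \<in> C_dual r \<omega>"
  shows "group_average A \<in> C_dual r \<omega>"
proof -
  have sym: "A (x, y) = A (y, x)" for x y
    using H.continuous_L2_sym_imp_sym[OF A] assms by (simp add: C_dual_def dual_cone_def)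
  have "group_average A \<in> L2_sym \<omega>"
    by (intro H.kernel_L2_sym group_average_continuous) (simp add: group_average_def sym)
  moreover have "0 \<le> L2_inner (\<omega> \<Otimes>\<^sub>M \<omega>) (group_average A) Z" if Z: "Z \<in> C_cone r \<omega>" for Z
  proof (rule group_average_inner_ge)
    show ZL: "Z \<in> L2 (\<omega> \<Otimes>\<^sub>M \<omega>)" using Z by (simp add: C_cone_def L2_sym_def)
    fix \<sigma> assume \<sigma>: "\<sigma> \<in> G"
    show "0 \<le> L2_inner (\<omega> \<Otimes>\<^sub>M \<omega>) (\<lambda>p. A (\<sigma> (fst p), \<sigma> (snd p))) Z"
      using translate_inner[OF \<sigma> ZL] H.C_cone_G[OF G_closed(2)[OF \<sigma>] Z] assms
      by (simp add: C_dual_def dual_cone_def)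
  qed
  ultimately show ?thesis by (simp add: C_dual_def dual_cone_def)
qed

lemma group_average_kpsd:
  assumes "A \<in> PSD \<omega>"
  shows "H.kpsd (group_average A)"
  unfolding H.kpsd_def
proof
  fix f assume f: "f \<in> H.bdd_measurable"
  then have fL: "f \<in> L2 \<omega>" by (rule H.bdd_L2)
  have "0 \<le> L2_inner (\<omega> \<Otimes>\<^sub>M \<omega>) (group_average A) (\<lambda>p. f (fst p) * f (snd p))"
  proof (rule group_average_inner_ge)
    show FL: "(\<lambda>p. f (fst p) * f (snd p)) \<in> L2 (\<omega> \<Otimes>\<^sub>M \<omega>)" by (intro H.tensor_L2 fL)
    fix \<sigma> assume \<sigma>: "\<sigma> \<in> G"
    note gL = H.L2_G[OF G_closed(2)[OF \<sigma>] fL]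
    show "0 \<le> L2_inner (\<omega> \<Otimes>\<^sub>M \<omega>) (\<lambda>p. A (\<sigma> (fst p), \<sigma> (snd p))) (\<lambda>p. f (fst p) * f (snd p))"
    proof -
      have "0 \<le> L2_inner \<omega> (kernel_op \<omega> A (\<lambda>x. f (inv \<sigma> x))) (\<lambda>x. f (inv \<sigma> x))"
        using assms gL by (simp add: PSD_def)
      then show ?thesis
        unfolding translate_inner[OF \<sigma> FL] H.kernel_quadratic_form[OF H.kernel_L2[OF A] gL] by (simp add: L2_inner_def)
    qed
  qed
  then show "0 \<le> L2_inner \<omega> (kernel_op \<omega> (group_average A) f) f"
    using H.kernel_quadratic_form[OF H.kernel_L2[OF group_average_continuous] fL] by (simp add: L2_inner_def)
qed

end

end

section \<open>The limit problem\<close>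

context compact_prob_space
begin

lemma integrable_kernel_square:
  fixes A :: "'v \<times> 'v \<Rightarrow> real"
  assumes "continuous_on UNIV A"
  shows "integrable (M \<Otimes>\<^sub>M M) (\<lambda>p. (A p)\<^sup>2)"
  using kernel_L2[OF assms] by (simp add: L2_def)

text \<open>
  Elements of nearly minimal norm in decreasing convex sets form a Cauchy sequence, by the
  parallelogram law. This replaces weak compactness by norm convergence.
\<close>

lemma decreasing_convex_cauchy:
  fixes S :: "nat \<Rightarrow> ('v \<times> 'v \<Rightarrow> real) set"
  assumes ne: "\<And>r. S r \<noteq> {}" and anti: "\<And>r. S (Suc r) \<subseteq> S r"
    and cont: "\<And>r A. A \<in> S r \<Longrightarrow> continuous_on UNIV A"
    and mid: "\<And>r A B. A \<in> S r \<Longrightarrow> B \<in> S r \<Longrightarrow> (\<lambda>p. (A p + B p) / 2) \<in> S r"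
    and bd: "\<And>r A p. A \<in> S r \<Longrightarrow> \<bar>A p\<bar> \<le> 1"
  obtains A where "\<And>n. A n \<in> S n"
    "\<And>\<epsilon>. \<epsilon> > 0 \<Longrightarrow> \<exists>N. \<forall>m\<ge>N. \<forall>n\<ge>N. (\<integral>p. (A m p - A n p)\<^sup>2 \<partial>(M \<Otimes>\<^sub>M M)) < \<epsilon>"
proof -
  define q where "q A = (\<integral>p. (A p)\<^sup>2 \<partial>(M \<Otimes>\<^sub>M M))" for A :: "'v \<times> 'v \<Rightarrow> real"
  define m where "m r = (INF A\<in>S r. q A)" for r
  have q0: "0 \<le> q A" for A by (simp add: q_def)
  have below: "bdd_below (q ` S r)" for r using q0 by (intro bdd_belowI2[where m=0]) auto
  have m_le: "m r \<le> q A" if "A \<in> S r" for r A unfolding m_def by (rule cINF_lower[OF below that])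
  have antim: "S s \<subseteq> S r" if "r \<le> s" for r s using lift_Suc_antimono_le[of S, OF anti that] .
  have m_mono: "incseq m"
    unfolding m_def by (intro incseq_SucI cINF_superset_mono ne below anti order_refl)
  have m_le1: "m r \<le> 1" for r
  proof -
    obtain A where A: "A \<in> S r" using ne[of r] by blast
    have "q A \<le> (\<integral>p. 1 \<partial>(M \<Otimes>\<^sub>M M))"
      unfolding q_def using bd[OF A]
      by (intro integral_mono integrable_kernel_square cont[OF A]) (auto simp: abs_square_le_1)
    then show ?thesis using m_le[OF A] P.prob_space by simp
  qed
  have "\<exists>A\<in>S r. q A < m r + 1 / real (Suc r)" for r
    using cInf_lessD[of "q ` S r" "m r + 1 / real (Suc r)"] ne[of r] by (auto simp: m_def)
  then obtain A where A: "\<And>r. A r \<in> S r" "\<And>r. q (A r) < m r + 1 / real (Suc r)" by metis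
  obtain l where l: "m \<longlonglongrightarrow> l" "\<And>i. m i \<le> l"
    using incseq_convergent[OF m_mono, of 1] m_le1 by blast
  have dist_le: "(\<integral>p. (A i p - A j p)\<^sup>2 \<partial>(M \<Otimes>\<^sub>M M)) \<le> 2 * (l - m i) + 4 / real (Suc i)" if "i \<le> j" for i j
  proof -
    \<comment> \<open>The sets decrease, so \<open>A j\<close> and the midpoint both lie in
      \<open>S i\<close>, and the squared norm of the midpoint is at least
      \<open>m i\<close>.\<close>
    have Aj: "A j \<in> S i" using A(1)[of j] antim[OF that] by blast
    note c = cont[OF A(1)[of i]] cont[OF Aj] cont[OF mid[OF A(1)[of i] Aj]]
    note int = c[THEN integrable_kernel_square]
    have par: "(A i p - A j p)\<^sup>2 = 2 * (A i p)\<^sup>2 + 2 * (A j p)\<^sup>2 - 4 * ((A i p + A j p) / 2)\<^sup>2" for p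
      by (simp add: power2_eq_square field_simps)
    \<comment> \<open>The slacks allowed in the choice of \<open>A i\<close> and \<open>A j\<close>.
      The parallelogram law leaves \<open>2 * (m j - m i) + 2 * a + 2 * b\<close>, to be bounded
      with \<open>m j \<le> l\<close> and \<open>b \<le> a\<close>.\<close>
    define a b where "a = 1 / real (Suc i)" and "b = 1 / real (Suc j)"
    have "(\<integral>p. (A i p - A j p)\<^sup>2 \<partial>(M \<Otimes>\<^sub>M M)) = 2 * q (A i) + 2 * q (A j) - 4 * q (\<lambda>p. (A i p + A j p) / 2)"
      unfolding par q_def using int by (simp del: power_divide)
    moreover have "m i \<le> q (\<lambda>p. (A i p + A j p) / 2)" by (rule m_le[OF mid[OF A(1) Aj]])
    moreover have "b \<le> a" using that by (simp add: a_def b_def frac_le)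
    moreover have "q (A i) < m i + a" "q (A j) < m j + b" using A(2)[of i] A(2)[of j] by (simp_all add: a_def b_def)
    ultimately have "(\<integral>p. (A i p - A j p)\<^sup>2 \<partial>(M \<Otimes>\<^sub>M M)) \<le> 2 * (l - m i) + 4 * a"
      using l(2)[of j] by argo
    then show ?thesis by (simp add: a_def)
  qed
  have "(\<lambda>i. 2 * (l - m i) + 4 * inverse (real (Suc i))) \<longlonglongrightarrow> 2 * (l - l) + 4 * 0"
    by (intro tendsto_intros l(1) LIMSEQ_inverse_real_of_nat)
  then have lim: "(\<lambda>i. 2 * (l - m i) + 4 / real (Suc i)) \<longlonglongrightarrow> 0" by (simp add: inverse_eq_divide)
  show ?thesis
  proof (rule that[OF A(1)])
    fix \<epsilon> :: real assume "\<epsilon> > 0"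
    with lim obtain N where N: "\<And>i. i \<ge> N \<Longrightarrow> 2 * (l - m i) + 4 / real (Suc i) < \<epsilon>"
      using order_tendstoD(2)[OF lim] unfolding eventually_sequentially by blast
    have "(\<integral>p. (A i p - A j p)\<^sup>2 \<partial>(M \<Otimes>\<^sub>M M)) < \<epsilon>" if "i \<ge> N" "j \<ge> N" for i j
    proof (cases "i \<le> j")
      case True
      then show ?thesis using dist_le[OF True] N[OF that(1)] by linarith
    next
      case False
      then show ?thesis using dist_le[of j i] N[OF that(2)] by (simp add: power2_commute)
    qed
    then show "\<exists>N. \<forall>m\<ge>N. \<forall>n\<ge>N. (\<integral>p. (A m p - A n p)\<^sup>2 \<partial>(M \<Otimes>\<^sub>M M)) < \<epsilon>" by blast
  qed
qed

text \<open>The Borel sets of the product contain the measurable rectangles, so the identity is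
  measurable from \<open>P\<close> to the product measure; its image measure is the product, since
  both agree on rectangles. \<open>F\<close> is measurable already for the smaller
  sigma-algebra.\<close>

lemma radon_product_integral:
  fixes F :: "'v \<times> 'v \<Rightarrow> real"
  assumes P: "radon_product M M P" and F: "continuous_on UNIV F"
  shows "(\<integral>p. F p \<partial>P) = (\<integral>p. F p \<partial>(M \<Otimes>\<^sub>M M))"
    and "emeasure P UNIV = 1" and "sets P = sets borel"
proof -
  have "sets P = sets (borel_of (euclidean :: ('v \<times> 'v) topology))"
    using P by (simp add: radon_product_def radon_measure_def)
  also have "\<dots> = sets borel" by (simp add: borel_of_def borel_def)
  finally show sets_P: "sets P = sets borel" .
  have "emeasure P (UNIV \<times> UNIV) = emeasure M UNIV * emeasure M UNIV"
    using P unfolding radon_product_def by (metis sets.top space_M)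
  then show "emeasure P UNIV = 1" using emeasure_space_1 by simp
  have "fst \<in> P \<rightarrow>\<^sub>M M" "snd \<in> P \<rightarrow>\<^sub>M M"
    by (simp_all add: measurable_cong_sets[OF sets_P sets_M] borel_measurable_continuous_onI continuous_on_fst continuous_on_snd)
  then have id: "(\<lambda>p. p) \<in> P \<rightarrow>\<^sub>M M \<Otimes>\<^sub>M M" by (simp add: measurable_pair_iff o_def)
  have "M \<Otimes>\<^sub>M M = distr P (M \<Otimes>\<^sub>M M) (\<lambda>p. p)"
  proof (rule pair_measure_eqI)
    fix A B assume AB: "A \<in> sets M" "B \<in> sets M"
    then have "emeasure (distr P (M \<Otimes>\<^sub>M M) (\<lambda>p. p)) (A \<times> B) = emeasure P (A \<times> B)"
      using sets_eq_imp_space_eq[OF sets_P] by (subst emeasure_distr[OF id]) auto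
    then show "emeasure M A * emeasure M B = emeasure (distr P (M \<Otimes>\<^sub>M M) (\<lambda>p. p)) (A \<times> B)"
      using P AB by (simp add: radon_product_def)
  qed (simp_all add: sigma_finite_measure_axioms)
  then show "(\<integral>p. F p \<partial>P) = (\<integral>p. F p \<partial>(M \<Otimes>\<^sub>M M))"
    using integral_distr[OF id kernel_measurable[OF F]] by simp
qed

text \<open>If \<open>B\<close> is nonzero at a point of \<open>E\<close>, then on the part of
  \<open>E\<close> in a neighbourhood every \<open>A n\<close> differs from \<open>B\<close> by at
  least \<open>b\<close>, and thickness gives this part positive measure. The estimate takes place
  in \<open>P\<close>, where \<open>E\<close> is measurable.\<close>

lemma limit_zero_on_thick:
  fixes B :: "'v \<times> 'v \<Rightarrow> real"
  assumes P: "radon_product M M P" and thick: "thick P E"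
    and A: "\<And>n. continuous_on UNIV (A n)" "\<And>n p. p \<in> E \<Longrightarrow> A n p = 0" and B: "continuous_on UNIV B"
    and lim: "(\<lambda>n. \<integral>p. (A n p - B p)\<^sup>2 \<partial>(M \<Otimes>\<^sub>M M)) \<longlonglongrightarrow> 0"
    and pE: "p \<in> E"
  shows "B p = 0"
proof (rule ccontr)
  assume "B p \<noteq> 0"
  define b where "b = \<bar>B p\<bar> / 2"
  have b: "b > 0" using \<open>B p \<noteq> 0\<close> by (simp add: b_def)
  note sets_P = radon_product_integral(3)[OF P B] and UNIV_P = radon_product_integral(2)[OF P B]
  have space_P: "space P = UNIV" using sets_eq_imp_space_eq[OF sets_P] by simp
  interpret PP: prob_space P by (rule prob_spaceI) (simp add: space_P UNIV_P)
  define U where "U = (\<lambda>p. \<bar>B p\<bar>) -` {b<..}"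
  have U: "open U" unfolding U_def using B by (intro open_vimage continuous_intros) auto
  have "p \<in> U" using b by (simp add: U_def b_def)
  then have "0 < emeasure P (U \<inter> E)" using thick U pE by (auto simp: thick_def)
  then have pos: "0 < measure P (U \<inter> E)" by (simp add: PP.emeasure_eq_measure)
  have UE: "U \<inter> E \<in> sets P" using thick U sets_P by (auto simp: thick_def)
  have "b\<^sup>2 * measure P (U \<inter> E) \<le> (\<integral>p. (A n p - B p)\<^sup>2 \<partial>(M \<Otimes>\<^sub>M M))" for n
  proof -
    have c: "continuous_on UNIV (\<lambda>p. (A n p - B p)\<^sup>2)" by (intro continuous_intros A B)
    obtain C where C: "\<And>p. \<bar>(A n p - B p)\<^sup>2\<bar> \<le> C" using kernel_bounded[OF c] by blast
    have "(\<lambda>p. (A n p - B p)\<^sup>2) \<in> borel_measurable P"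
      using borel_measurable_continuous_onI[OF c] measurable_cong_sets[OF sets_P refl] by blast
    then have i: "integrable P (\<lambda>p. (A n p - B p)\<^sup>2)"
      by (intro PP.integrable_const_bound[where B=C]) (use C in auto)
    have "b\<^sup>2 * measure P (U \<inter> E) = (\<integral>p. b\<^sup>2 * indicator (U \<inter> E) p \<partial>P)" using UE by simp
    also have "\<dots> \<le> (\<integral>p. (A n p - B p)\<^sup>2 \<partial>P)"
    proof (rule integral_mono[OF _ i])
      show "integrable P (\<lambda>p. b\<^sup>2 * indicator (U \<inter> E) p)" using UE by (simp add: PP.emeasure_eq_measure)
      fix p
      show "b\<^sup>2 * indicator (U \<inter> E) p \<le> (A n p - B p)\<^sup>2"
      proof (cases "p \<in> U \<inter> E")
        case True
        then have "b \<le> \<bar>B p\<bar>" "A n p = 0" using A(2) by (auto simp: U_def)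
        then show ?thesis using True power_mono[of b "\<bar>B p\<bar>" 2] b by simp
      qed simp
    qed
    also have "\<dots> = (\<integral>p. (A n p - B p)\<^sup>2 \<partial>(M \<Otimes>\<^sub>M M))" by (rule radon_product_integral(1)[OF P c])
    finally show ?thesis .
  qed
  then have "b\<^sup>2 * measure P (U \<inter> E) \<le> 0" by (intro LIMSEQ_le_const[OF lim]) auto
  moreover have "0 < b\<^sup>2 * measure P (U \<inter> E)" using b pos by simp
  ultimately show False by linarith
qed

end

section \<open>A feasible kernel for the limit problem\<close>

context full_support_space
begin

text \<open>A single vertex is compact and independent, so it has an open independent neighbourhood
  \<open>U\<close>. A continuous function vanishing outside \<open>U\<close>, tensored with itself,
  vanishes on all edges. This settles the lower bounds \<open>L \<le> 0\<close> in the
  theorem.\<close>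

lemma exists_CP_feasible:
  fixes E :: "('v \<times> 'v) set"
  assumes E: "locally_independent E"
  obtains A where "A \<in> feasible E M (CP M)" "0 \<le> L2_inner (M \<Otimes>\<^sub>M M) A (\<lambda>_. 1)"
proof -
  fix v :: 'v
  have "independent_set E {v}"
    using E by (simp add: independent_set_def locally_independent_def topological_graph_def irrefl_def)
  then obtain U where U: "open U" "independent_set E U" "v \<in> U"
    using E unfolding locally_independent_def by (metis compact_sing insert_subset)
  have "Hausdorff_space (euclidean :: 'v topology)"
    unfolding Hausdorff_space_def disjnt_def open_openin[symmetric] using hausdorff by blast
  then have "normal_space (euclidean :: 'v topology)"
    using compact_UNIV by (intro compact_Hausdorff_or_regular_imp_normal_space) (auto simp: compact_space_def)
  then obtain f where f: "continuous_map euclidean (top_of_set {0..1::real}) f" "f ` (- U) \<subseteq> {0}" "f ` {v} \<subseteq> {1}"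
    using Urysohn_lemma[of "euclidean :: 'v topology" "- U" "{v}" 0 1] U by (auto simp: disjnt_def)
  have fc: "continuous_on UNIV f" and f01: "\<And>x. 0 \<le> f x"
    using f(1) by (auto simp: continuous_map_in_subtopology)
  have fb: "f \<in> bdd_measurable" by (rule bdd_continuous[OF fc])
  define s where "s = (\<integral>x. (f x)\<^sup>2 \<partial>M)"
  have "s > 0"
  proof -
    \<comment> \<open>On this neighbourhood of \<open>v\<close> the square of \<open>f\<close>
      exceeds 1/4.\<close>
    define W where "W = f -` {1/2<..}"
    have W: "open W" unfolding W_def using fc by (intro open_vimage) auto
    have "v \<in> W" using f(3) by (simp add: W_def)
    have "0 < measure M W / 4" using full_support[OF W] \<open>v \<in> W\<close> by auto
    also have "measure M W / 4 = (\<integral>x. indicator W x / 4 \<partial>M)" using W by simp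
    also have "\<dots> \<le> s"
      unfolding s_def
    proof (rule integral_mono)
      show "integrable M (\<lambda>x. indicator W x / 4 :: real)" using W by (intro integrable_divide integrable_real_indicator) (auto simp: emeasure_eq_measure)
      show "integrable M (\<lambda>x. (f x)\<^sup>2)" using bdd_L2[OF fb] by (simp add: L2_def)
      show "indicator W x / 4 \<le> (f x)\<^sup>2" for x
        using power_mono[of "1/2" "f x" 2] by (auto simp: indicator_def W_def power_divide)
    qed
    finally show ?thesis .
  qed
  define A where "A = (\<lambda>p. f (fst p) * f (snd p) / s)"
  have Ac: "continuous_on UNIV A"
    unfolding A_def by (intro continuous_intros continuous_on_compose2[OF fc]) (use \<open>s > 0\<close> in auto)
  have "A \<in> L2_sym M" by (rule kernel_L2_sym[OF Ac]) (simp add: A_def mult.commute)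
  moreover have "0 \<le> L2_inner (M \<Otimes>\<^sub>M M) A Z" if Z: "Z \<in> COP M" for Z
  proof -
    have "L2_inner (M \<Otimes>\<^sub>M M) A Z = (\<integral>p. Z p * (f (fst p) * f (snd p)) \<partial>(M \<Otimes>\<^sub>M M)) / s"
      by (simp add: L2_inner_def A_def mult.commute)
    also have "\<dots> = L2_inner M (kernel_op M Z f) f / s"
      using kernel_quadratic_form[OF _ bdd_L2[OF fb], of Z] Z by (simp add: COP_def L2_sym_def)
    also have "\<dots> \<ge> 0" using Z bdd_L2[OF fb] f01 \<open>s > 0\<close> by (simp add: COP_def)
    finally show ?thesis .
  qed
  ultimately have "A \<in> CP M" by (simp add: CP_def dual_cone_def)
  moreover have "(\<integral>x. A (x, x) \<partial>M) = 1" using \<open>s > 0\<close> by (simp add: A_def s_def power2_eq_square)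
  moreover have "A p = 0" if "p \<in> E" for p
  proof -
    have "fst p \<notin> U \<or> snd p \<notin> U" using U(2) that by (cases p) (auto simp: independent_set_def)
    then show ?thesis using f(2) by (auto simp: A_def)
  qed
  ultimately have "A \<in> feasible E M (CP M)" using Ac by (auto simp: feasible_def)
  moreover have "0 \<le> L2_inner (M \<Otimes>\<^sub>M M) A (\<lambda>_. 1)"
    unfolding L2_inner_def A_def using f01 \<open>s > 0\<close> by (intro integral_nonneg_AE) auto
  ultimately show ?thesis using that by blast
qed

end

section \<open>From invariant kernels to a kernel of the limit problem\<close>

context homogeneous_prob_space
begin

lemma unit_kernel_midpoint:
  assumes A: "unit_kernel A" and B: "unit_kernel B"
  shows "unit_kernel (\<lambda>p. (A p + B p) / 2)"
proof -
  note c = unit_kernelD(1)[OF A] unit_kernelD(1)[OF B]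
  have cm: "continuous_on UNIV (\<lambda>p. (A p + B p) / 2)" by (intro continuous_intros c) simp
  have "0 \<le> L2_inner M (kernel_op M (\<lambda>p. (A p + B p) / 2) f) f" if f: "f \<in> bdd_measurable" for f
  proof -
    note i = kernel_form_integrable[OF c(1) f f] kernel_form_integrable[OF c(2) f f]
    have "L2_inner M (kernel_op M (\<lambda>p. (A p + B p) / 2) f) f
        = (\<integral>p. A p * (f (fst p) * f (snd p)) / 2 + B p * (f (fst p) * f (snd p)) / 2 \<partial>(M \<Otimes>\<^sub>M M))"
      unfolding inner_kernel_op[OF cm f f] by (intro Bochner_Integration.integral_cong refl) (simp add: field_simps)
    also have "\<dots> = (L2_inner M (kernel_op M A f) f + L2_inner M (kernel_op M B f) f) / 2"
      unfolding inner_kernel_op[OF c(1) f f] inner_kernel_op[OF c(2) f f]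
      using i by (simp add: case_prod_beta' mult.assoc add_divide_distrib)
    also have "\<dots> \<ge> 0" using unit_kernelD(3)[OF A] unit_kernelD(3)[OF B] f by (simp add: kpsd_def)
    finally show ?thesis .
  qed
  then show ?thesis
    using cm unit_kernelD[OF A] unit_kernelD[OF B] by (simp add: unit_kernel_def kpsd_def kinv_def)
qed

lemma L2_inner_midpoint:
  assumes "continuous_on UNIV A" "continuous_on UNIV B" "Z \<in> L2 (M \<Otimes>\<^sub>M M)"
  shows "L2_inner (M \<Otimes>\<^sub>M M) (\<lambda>p. (A p + B p) / 2) Z = (L2_inner (M \<Otimes>\<^sub>M M) A Z + L2_inner (M \<Otimes>\<^sub>M M) B Z) / 2"
proof -
  have "L2_inner (M \<Otimes>\<^sub>M M) (\<lambda>p. (A p + B p) / 2) Z = (\<integral>p. A p * Z p / 2 + B p * Z p / 2 \<partial>(M \<Otimes>\<^sub>M M))"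
    unfolding L2_inner_def by (intro Bochner_Integration.integral_cong refl) (simp add: field_simps)
  then show ?thesis
    using L2_mult_integrable[OF kernel_L2[OF assms(1)] assms(3)] L2_mult_integrable[OF kernel_L2[OF assms(2)] assms(3)]
    by (simp add: L2_inner_def add_divide_distrib)
qed

lemma C_dual_midpoint:
  assumes c: "continuous_on UNIV A" "continuous_on UNIV B" and d: "A \<in> C_dual r M" "B \<in> C_dual r M"
  shows "(\<lambda>p. (A p + B p) / 2) \<in> C_dual r M"
proof -
  have cm: "continuous_on UNIV (\<lambda>p. (A p + B p) / 2)" by (intro continuous_intros c) simp
  have s: "A (x, y) = A (y, x)" "B (x, y) = B (y, x)" for x y
    using d continuous_L2_sym_imp_sym[OF c(1)] continuous_L2_sym_imp_sym[OF c(2)] by (auto simp: C_dual_def dual_cone_def)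
  have "(\<lambda>p. (A p + B p) / 2) \<in> L2_sym M" by (rule kernel_L2_sym[OF cm]) (simp add: s(1)[of _] s(2)[of _])
  moreover have "0 \<le> L2_inner (M \<Otimes>\<^sub>M M) (\<lambda>p. (A p + B p) / 2) Z" if Z: "Z \<in> C_cone r M" for Z
  proof -
    have "0 \<le> L2_inner (M \<Otimes>\<^sub>M M) A Z" "0 \<le> L2_inner (M \<Otimes>\<^sub>M M) B Z"
      using d Z by (auto simp: C_dual_def dual_cone_def)
    moreover have "Z \<in> L2 (M \<Otimes>\<^sub>M M)" using Z by (simp add: C_cone_def L2_sym_def)
    ultimately show ?thesis by (simp add: L2_inner_midpoint[OF c])
  qed
  ultimately show ?thesis by (simp add: C_dual_def dual_cone_def)
qed

text \<open>The limit of the kernels may lose trace, but dividing by its trace then only increases the value.\<close>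

lemma limit_feasible:
  fixes E :: "('v \<times> 'v) set"
  assumes P: "radon_product M M P" and thick: "thick P E" and L: "L > 0"
    and ex: "\<And>r. \<exists>A. unit_kernel A \<and> A \<in> C_dual r M \<and> (\<forall>p\<in>E. A p = 0) \<and> L \<le> L2_inner (M \<Otimes>\<^sub>M M) A (\<lambda>_. 1)"
  obtains B where "B \<in> feasible E M (CP M)" "L \<le> L2_inner (M \<Otimes>\<^sub>M M) B (\<lambda>_. 1)"
proof -
  define S where "S r = {A. unit_kernel A \<and> A \<in> C_dual r M \<and> (\<forall>p\<in>E. A p = 0) \<and> L \<le> L2_inner (M \<Otimes>\<^sub>M M) A (\<lambda>_. 1)}" for r
  have one: "(\<lambda>_. 1) \<in> L2 (M \<Otimes>\<^sub>M M)" by (rule L2_bdd2[where C=1]) auto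
  obtain A where A: "\<And>n. A n \<in> S n"
    "\<And>\<epsilon>. \<epsilon> > 0 \<Longrightarrow> \<exists>N. \<forall>m\<ge>N. \<forall>n\<ge>N. (\<integral>p. (A m p - A n p)\<^sup>2 \<partial>(M \<Otimes>\<^sub>M M)) < \<epsilon>"
  proof (rule decreasing_convex_cauchy[of S])
    show "S r \<noteq> {}" for r using ex[of r] by (auto simp: S_def)
    show "S (Suc r) \<subseteq> S r" for r using C_dual_antimono[of r "Suc r"] by (auto simp: S_def)
    show "continuous_on UNIV A" if "A \<in> S r" for r A using that by (auto simp: S_def unit_kernel_def)
    show "\<bar>A p\<bar> \<le> 1" if "A \<in> S r" for r A p using that unit_kernel_le by (auto simp: S_def)
    show "(\<lambda>p. (A p + B p) / 2) \<in> S r" if "A \<in> S r" "B \<in> S r" for r A B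
    proof -
      have c: "continuous_on UNIV A" "continuous_on UNIV B" using that by (auto simp: S_def unit_kernel_def)
      show ?thesis
        using that unit_kernel_midpoint[of A B] C_dual_midpoint[OF c, of r] L2_inner_midpoint[OF c one]
        by (auto simp: S_def)
    qed
  qed blast
  have Au: "unit_kernel (A n)" and Ad: "A n \<in> C_dual n M" and AE: "\<And>p. p \<in> E \<Longrightarrow> A n p = 0"
    and AL: "L \<le> L2_inner (M \<Otimes>\<^sub>M M) (A n) (\<lambda>_. 1)" for n
    using A(1)[of n] by (auto simp: S_def)
  note Ac = unit_kernelD(1)[OF Au]
  obtain B t where B: "continuous_on UNIV B" "\<And>x y. B (x, y) = B (y, x)" "\<And>x. B (x, x) = t" "t \<le> 1"
    "\<And>p. \<bar>B p\<bar> \<le> t" "(\<lambda>n. \<integral>p. (A n p - B p)\<^sup>2 \<partial>(M \<Otimes>\<^sub>M M)) \<longlonglongrightarrow> 0"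
    using unit_kernel_limit[of A, OF Au A(2)] by blast
  have lim: "(\<lambda>n. L2_inner (M \<Otimes>\<^sub>M M) (A n) Z) \<longlonglongrightarrow> L2_inner (M \<Otimes>\<^sub>M M) B Z" if "Z \<in> L2 (M \<Otimes>\<^sub>M M)" for Z
    by (rule L2_inner_tendsto[OF Ac B(1) that B(6)])
  have "B \<in> C_dual r M" for r
  proof -
    have "0 \<le> L2_inner (M \<Otimes>\<^sub>M M) B Z" if Z: "Z \<in> C_cone r M" for Z
    proof (rule LIMSEQ_le_const[OF lim])
      show "Z \<in> L2 (M \<Otimes>\<^sub>M M)" using Z by (simp add: C_cone_def L2_sym_def)
      \<comment> \<open>As the dual cones decrease, \<open>A n\<close> is known to lie in the
        \<open>r\<close>-th one from \<open>n = r\<close> on.\<close>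
      have "0 \<le> L2_inner (M \<Otimes>\<^sub>M M) (A n) Z" if "n \<ge> r" for n
        using Ad[of n] C_dual_antimono[OF that] Z by (auto simp: C_dual_def dual_cone_def)
      then show "\<exists>N. \<forall>n\<ge>N. 0 \<le> L2_inner (M \<Otimes>\<^sub>M M) (A n) Z" by blast
    qed
    then show ?thesis using kernel_L2_sym[OF B(1,2)] by (simp add: C_dual_def dual_cone_def)
  qed
  then have BCP: "B \<in> CP M" by (rule C_dual_Inter_continuous[OF B(1)])
  have BL: "L \<le> L2_inner (M \<Otimes>\<^sub>M M) B (\<lambda>_. 1)"
    by (rule LIMSEQ_le_const[OF lim[OF one]]) (use AL in auto)
  \<comment> \<open>Positivity of \<open>L\<close> enters here: \<open>t\<close> bounds all values
    of \<open>B\<close>, so otherwise \<open>B\<close> and its value would be zero.\<close>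
  have "t > 0"
  proof (rule ccontr)
    assume "\<not> t > 0"
    then have "B p = 0" for p using B(5)[of p] by simp
    then show False using BL L by (simp add: L2_inner_def)
  qed
  define K where "K = (\<lambda>p. B p / t)"
  have Kc: "continuous_on UNIV K" unfolding K_def by (intro continuous_intros B(1)) (use \<open>t > 0\<close> in auto)
  have K_inner: "L2_inner (M \<Otimes>\<^sub>M M) K Z = L2_inner (M \<Otimes>\<^sub>M M) B Z / t" for Z
    by (simp add: L2_inner_def K_def)
  have "K \<in> CP M"
    using kernel_L2_sym[OF Kc] B(2) BCP K_inner \<open>t > 0\<close> by (simp add: CP_def dual_cone_def K_def)
  moreover have "K p = 0" if "p \<in> E" for p
    using limit_zero_on_thick[OF P thick Ac AE B(1,6) that] by (simp add: K_def)
  moreover have "(\<integral>x. K (x, x) \<partial>M) = 1" using B(3) \<open>t > 0\<close> by (simp add: K_def)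
  ultimately have "K \<in> feasible E M (CP M)" using Kc by (auto simp: feasible_def)
  moreover have "L \<le> L2_inner (M \<Otimes>\<^sub>M M) K (\<lambda>_. 1)"
  proof -
    have "L * t \<le> L * 1" using L B(4) by (intro mult_left_mono) auto
    then show ?thesis using BL \<open>t > 0\<close> by (simp add: K_inner field_simps)
  qed
  ultimately show ?thesis using that by blast
qed

end

section \<open>Averages of feasible kernels, and the convergence of the bounds\<close>

context haar_action
begin

lemma group_average_feasible:
  fixes E :: "('v \<times> 'v) set"
  assumes aut: "G \<subseteq> graph_Aut E" and A: "A \<in> feasible E \<omega> (PSD \<omega> \<inter> C_dual r \<omega>)"
    and L: "L \<le> L2_inner (\<omega> \<Otimes>\<^sub>M \<omega>) A (\<lambda>_. 1)"
  shows "H.unit_kernel (group_average A) \<and> group_average A \<in> C_dual r \<omega> \<and> (\<forall>p\<in>E. group_average A p = 0) \<and>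
    L \<le> L2_inner (\<omega> \<Otimes>\<^sub>M \<omega>) (group_average A) (\<lambda>_. 1)"
proof (intro conjI ballI)
  have Ac: "continuous_on UNIV A" and Apsd: "A \<in> PSD \<omega>" and Ad: "A \<in> C_dual r \<omega>"
    and AE: "\<And>p. p \<in> E \<Longrightarrow> A p = 0" and tr: "(\<integral>x. A (x, x) \<partial>\<omega>) = 1"
    using A by (auto simp: feasible_def)
  note gc = group_average_continuous[OF Ac] and gd = group_average_C_dual[OF Ac Ad] and gi = group_average_invariant[OF Ac]
  show "group_average A \<in> C_dual r \<omega>" by (rule gd)
  \<comment> \<open>The diagonal is constant by invariance and has integral 1 for a probability
    measure.\<close>
  have "group_average A (x, x) = 1" for x
  proof -
    have "(\<integral>y. group_average A (y, y) \<partial>\<omega>) = (\<integral>y. group_average A (x, x) \<partial>\<omega>)"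
      by (intro Bochner_Integration.integral_cong refl H.kinv_diag[OF gi])
    then show ?thesis using group_average_trace[OF Ac] tr by simp
  qed
  moreover have "group_average A (x, y) = group_average A (y, x)" for x y
    using gd by (intro H.continuous_L2_sym_imp_sym gc) (simp add: C_dual_def dual_cone_def)
  ultimately show "H.unit_kernel (group_average A)"
    using gc gi group_average_kpsd[OF Ac Apsd] by (simp add: H.unit_kernel_def)
  fix p assume p: "p \<in> E"
  \<comment> \<open>Automorphisms send edges to edges, so every translate vanishes at
    \<open>p\<close>.\<close>
  have "A (inv \<sigma> (fst p), inv \<sigma> (snd p)) = 0" if "\<sigma> \<in> G" for \<sigma>
    using AE aut G_closed(2)[OF that] p by (auto simp: graph_Aut_def)
  then have "group_average A p = (\<integral>\<sigma>. 0 \<partial>\<mu>)"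
    unfolding group_average_def by (intro Bochner_Integration.integral_cong refl) (simp add: space_\<mu>)
  then show "group_average A p = 0" by simp
next
  have Ac: "continuous_on UNIV A" using A by (simp add: feasible_def)
  show "L \<le> L2_inner (\<omega> \<Otimes>\<^sub>M \<omega>) (group_average A) (\<lambda>_. 1)"
  proof (rule group_average_inner_ge[OF Ac])
    show one: "(\<lambda>_. 1) \<in> L2 (\<omega> \<Otimes>\<^sub>M \<omega>)" by (rule H.L2_bdd2[where C=1]) auto
    show "L \<le> L2_inner (\<omega> \<Otimes>\<^sub>M \<omega>) (\<lambda>p. A (\<sigma> (fst p), \<sigma> (snd p))) (\<lambda>_. 1)" if "\<sigma> \<in> G" for \<sigma>
      using translate_inner[OF Ac that one] L by simp
  qed
qed

end

lemma theta_mono: "\<C> \<subseteq> \<D> \<Longrightarrow> theta E M \<C> \<le> theta E M \<D>"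
  unfolding theta_def by (rule SUP_subset_mono) (auto simp: feasible_def)

theorem theorem5p6:
  fixes E :: "('v::t2_space \<times> 'v) set"
    and \<Gamma> :: "('v \<Rightarrow> 'v) topology"
    and \<mu> :: "('v \<Rightarrow> 'v) measure"
    and e :: 'v
    and \<omega> :: "'v measure"
    and \<omega>\<omega> :: "('v \<times> 'v) measure"
  assumes "locally_independent E"
    and "topspace \<Gamma> \<subseteq> graph_Aut E"
    and "topological_group_of_maps \<Gamma>"
    and "compact_space \<Gamma>"
    and "homogeneous_space \<Gamma>"
    and "normalized_haar_measure \<Gamma> \<mu>"
    and "\<omega> = haar_pushforward \<mu> e"
    and "radon_product \<omega> \<omega> \<omega>\<omega>"
    and "thick \<omega>\<omega> E"
  shows "(\<lambda>r. gamma E \<omega> r) \<longlonglongrightarrow> theta E \<omega> (CP \<omega>)"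
proof -
  interpret haar_action \<Gamma> \<mu> e \<omega>
    by standard (use assms in auto)
  have "decseq (\<lambda>r. gamma E \<omega> r)"
    unfolding gamma_def decseq_def using H.C_dual_antimono by (intro allI impI theta_mono) blast
  then have lim: "(\<lambda>r. gamma E \<omega> r) \<longlonglongrightarrow> (INF r. gamma E \<omega> r)" by (rule LIMSEQ_INF)
  have ge: "theta E \<omega> (CP \<omega>) \<le> (INF r. gamma E \<omega> r)"
    unfolding gamma_def using H.CP_subset_PSD H.CP_subset_C_dual by (intro INF_greatest theta_mono) blast
  have "(INF r. gamma E \<omega> r) \<le> theta E \<omega> (CP \<omega>)"
  proof (rule dense_le)
    \<comment> \<open>Suprema need not be attained, but a bound strictly below the infimum is
      exceeded by a feasible kernel for every \<open>r\<close>.\<close>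
    fix y assume y: "y < (INF r. gamma E \<omega> r)"
    show "y \<le> theta E \<omega> (CP \<omega>)"
    proof (cases y)
      case (real L)
      show ?thesis
      proof (cases "L > 0")
        case True
        have "\<exists>A. H.unit_kernel A \<and> A \<in> C_dual r \<omega> \<and> (\<forall>p\<in>E. A p = 0) \<and> L \<le> L2_inner (\<omega> \<Otimes>\<^sub>M \<omega>) A (\<lambda>_. 1)" for r
        proof -
          have "ereal L < gamma E \<omega> r" using y real less_le_trans INF_lower[of r UNIV "gamma E \<omega>"] by blast
          then obtain A where "A \<in> feasible E \<omega> (PSD \<omega> \<inter> C_dual r \<omega>)" "L < L2_inner (\<omega> \<Otimes>\<^sub>M \<omega>) A (\<lambda>_. 1)"
            unfolding gamma_def theta_def less_SUP_iff by auto
          then show ?thesis using group_average_feasible[OF assms(2), of A r L] by fastforce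
        qed
        from H.limit_feasible[OF assms(8,9) True this] obtain B
          where "B \<in> feasible E \<omega> (CP \<omega>)" "L \<le> L2_inner (\<omega> \<Otimes>\<^sub>M \<omega>) B (\<lambda>_. 1)" by blast
        then show ?thesis unfolding real theta_def by (intro SUP_upper2) auto
      next
        case False
        obtain B where "B \<in> feasible E \<omega> (CP \<omega>)" "0 \<le> L2_inner (\<omega> \<Otimes>\<^sub>M \<omega>) B (\<lambda>_. 1)"
          using H.exists_CP_feasible[OF assms(1)] by blast
        then show ?thesis using False unfolding real theta_def by (intro SUP_upper2[of B]) auto
      qed
    \<comment> \<open>The infinite values: \<open>y\<close> is strictly below something, hence not
      plus infinity, and minus infinity is below every value.\<close>
    qed (use y in auto)
  qed
  then have "(INF r. gamma E \<omega> r) = theta E \<omega> (CP \<omega>)" using ge by (rule antisym)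
  with lim show ?thesis by (simp only:)
qed

end
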